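(* For any cardinal $\kappa$, the class $\kappa\text{-HOD}$ is an inner model of ZF. If $\kappa$ is strongly compact, then $\kappa\text{-HOD}$ satisfies the Axiom of Choice.
   Context: A set $x$ is $\kappa$-OD if it is ordinal definable from some $\kappa$-complete ultrafilter $U$ over an ordinal (i.e., $x\in\mathrm{OD}_U$). $\kappa\text{-HOD}$ is the class of hereditarily $\kappa$-OD sets. $\kappa$ is strongly compact if for every $\lambda\ge\kappa$ there is a $\kappa$-complete fine ultrafilter over $P_\kappa(\lambda)$. *)

theory Defs
  imports Main
begin

text \<open>
  The theorem is a theorem of ZFC about proper classes. It is stated for an arbitrary model
  \<open>(V, E)\<close> of first-order ZFC, \<open>V\<close> being the type \<open>'v\<close>: no well-foundedness of \<open>E\<close> in the sense
  of HOL is assumed, and Separation and Replacement range over first-order formulas only.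
\<close>

datatype fm = Mem nat nat | Eq nat nat | Neg fm | Conj fm fm | Ex fm

text \<open>
  Satisfaction in the structure \<open>(D, E)\<close>. Variables are de Bruijn indices; \<open>case_nat x env\<close> is the
  assignment \<open>x, env 0, env 1, \<dots>\<close>.
\<close>

primrec sat :: "('v \<Rightarrow> 'v \<Rightarrow> bool) \<Rightarrow> 'v set \<Rightarrow> (nat \<Rightarrow> 'v) \<Rightarrow> fm \<Rightarrow> bool" where
  "sat E D env (Mem i j) \<longleftrightarrow> E (env i) (env j)"
| "sat E D env (Eq i j) \<longleftrightarrow> env i = env j"
| "sat E D env (Neg \<phi>) \<longleftrightarrow> \<not> sat E D env \<phi>"
| "sat E D env (Conj \<phi> \<psi>) \<longleftrightarrow> sat E D env \<phi> \<and> sat E D env \<psi>"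
| "sat E D env (Ex \<phi>) \<longleftrightarrow> (\<exists>x\<in>D. sat E D (case_nat x env) \<phi>)"

locale set_universe =
  fixes E :: "'v \<Rightarrow> 'v \<Rightarrow> bool"  (infix "\<^bold>\<in>" 50)
begin

subsection \<open>The axioms, relativized to a class\<close>

definition extensionality :: "'v set \<Rightarrow> bool" where
  "extensionality D \<longleftrightarrow>
     (\<forall>x\<in>D. \<forall>y\<in>D. (\<forall>z\<in>D. z \<^bold>\<in> x \<longleftrightarrow> z \<^bold>\<in> y) \<longrightarrow> x = y)"

definition foundation :: "'v set \<Rightarrow> bool" where
  "foundation D \<longleftrightarrow>
     (\<forall>x\<in>D. (\<exists>y\<in>D. y \<^bold>\<in> x) \<longrightarrow>
        (\<exists>y\<in>D. y \<^bold>\<in> x \<and> \<not> (\<exists>z\<in>D. z \<^bold>\<in> x \<and> z \<^bold>\<in> y)))"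

definition pairing :: "'v set \<Rightarrow> bool" where
  "pairing D \<longleftrightarrow>
     (\<forall>x\<in>D. \<forall>y\<in>D. \<exists>p\<in>D. \<forall>z\<in>D. z \<^bold>\<in> p \<longleftrightarrow> z = x \<or> z = y)"

definition union :: "'v set \<Rightarrow> bool" where
  "union D \<longleftrightarrow>
     (\<forall>x\<in>D. \<exists>u\<in>D. \<forall>z\<in>D. z \<^bold>\<in> u \<longleftrightarrow> (\<exists>y\<in>D. y \<^bold>\<in> x \<and> z \<^bold>\<in> y))"

definition power_set :: "'v set \<Rightarrow> bool" where
  "power_set D \<longleftrightarrow>
     (\<forall>x\<in>D. \<exists>p\<in>D. \<forall>z\<in>D. z \<^bold>\<in> p \<longleftrightarrow> (\<forall>w\<in>D. w \<^bold>\<in> z \<longrightarrow> w \<^bold>\<in> x))"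

definition infinity :: "'v set \<Rightarrow> bool" where
  "infinity D \<longleftrightarrow>
     (\<exists>x\<in>D. (\<exists>e\<in>D. e \<^bold>\<in> x \<and> (\<forall>z\<in>D. \<not> z \<^bold>\<in> e)) \<and>
        (\<forall>y\<in>D. y \<^bold>\<in> x \<longrightarrow>
           (\<exists>s\<in>D. s \<^bold>\<in> x \<and> (\<forall>z\<in>D. z \<^bold>\<in> s \<longleftrightarrow> z \<^bold>\<in> y \<or> z = y))))"

text \<open>In the two schemes, the assignment \<open>env\<close> supplies the parameters.\<close>

definition separation :: "'v set \<Rightarrow> bool" where
  "separation D \<longleftrightarrow>
     (\<forall>\<phi> env. range env \<subseteq> D \<longrightarrow>
        (\<forall>a\<in>D. \<exists>b\<in>D. \<forall>z\<in>D.
           z \<^bold>\<in> b \<longleftrightarrow> z \<^bold>\<in> a \<and> sat E D (case_nat z env) \<phi>))"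

definition replacement :: "'v set \<Rightarrow> bool" where
  "replacement D \<longleftrightarrow>
     (\<forall>\<phi> env. range env \<subseteq> D \<longrightarrow>
        (\<forall>a\<in>D.
           (\<forall>x\<in>D. x \<^bold>\<in> a \<longrightarrow>
              (\<forall>y\<in>D. \<forall>y'\<in>D. sat E D (case_nat x (case_nat y env)) \<phi> \<longrightarrow>
                 sat E D (case_nat x (case_nat y' env)) \<phi> \<longrightarrow> y = y')) \<longrightarrow>
           (\<exists>b\<in>D. \<forall>y\<in>D.
              y \<^bold>\<in> b \<longleftrightarrow>
              (\<exists>x\<in>D. x \<^bold>\<in> a \<and> sat E D (case_nat x (case_nat y env)) \<phi>))))"

text \<open>Choice, in the form: every set of nonempty, pairwise disjoint sets has a transversal.\<close>

definition choice :: "'v set \<Rightarrow> bool" where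
  "choice D \<longleftrightarrow>
     (\<forall>F\<in>D.
        (\<forall>x\<in>D. x \<^bold>\<in> F \<longrightarrow> (\<exists>z\<in>D. z \<^bold>\<in> x)) \<and>
        (\<forall>x\<in>D. \<forall>y\<in>D. x \<^bold>\<in> F \<longrightarrow> y \<^bold>\<in> F \<longrightarrow> x \<noteq> y \<longrightarrow>
           \<not> (\<exists>z\<in>D. z \<^bold>\<in> x \<and> z \<^bold>\<in> y)) \<longrightarrow>
        (\<exists>c\<in>D. \<forall>x\<in>D. x \<^bold>\<in> F \<longrightarrow> (\<exists>!z. z \<in> D \<and> z \<^bold>\<in> x \<and> z \<^bold>\<in> c)))"

definition ZF :: "'v set \<Rightarrow> bool" where
  "ZF D \<longleftrightarrow>
     extensionality D \<and> foundation D \<and> pairing D \<and> union D \<and> power_set D \<and> infinity D \<and>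
     separation D \<and> replacement D"

definition ZFC :: "'v set \<Rightarrow> bool" where
  "ZFC D \<longleftrightarrow> ZF D \<and> choice D"


subsection \<open>Sets, functions and cardinals of the universe\<close>

definition subset :: "'v \<Rightarrow> 'v \<Rightarrow> bool"  (infix "\<^bold>\<subseteq>" 50) where
  "x \<^bold>\<subseteq> y \<longleftrightarrow> (\<forall>z. z \<^bold>\<in> x \<longrightarrow> z \<^bold>\<in> y)"

definition transitive :: "'v \<Rightarrow> bool" where
  "transitive x \<longleftrightarrow> (\<forall>y. y \<^bold>\<in> x \<longrightarrow> y \<^bold>\<subseteq> x)"

text \<open>By Foundation, a transitive set of transitive sets is well-ordered by membership.\<close>

definition ordinal :: "'v \<Rightarrow> bool" where
  "ordinal x \<longleftrightarrow> transitive x \<and> (\<forall>y. y \<^bold>\<in> x \<longrightarrow> transitive y)"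

definition is_upair :: "'v \<Rightarrow> 'v \<Rightarrow> 'v \<Rightarrow> bool" where
  "is_upair p a b \<longleftrightarrow> (\<forall>z. z \<^bold>\<in> p \<longleftrightarrow> z = a \<or> z = b)"

definition is_pair :: "'v \<Rightarrow> 'v \<Rightarrow> 'v \<Rightarrow> bool" where
  "is_pair p a b \<longleftrightarrow> (\<exists>u v. is_upair u a a \<and> is_upair v a b \<and> is_upair p u v)"

definition maps_to :: "'v \<Rightarrow> 'v \<Rightarrow> 'v \<Rightarrow> bool" where
  "maps_to f x y \<longleftrightarrow> (\<exists>p. p \<^bold>\<in> f \<and> is_pair p x y)"

definition is_function :: "'v \<Rightarrow> 'v \<Rightarrow> 'v \<Rightarrow> bool" where
  "is_function f a b \<longleftrightarrow>
     (\<forall>p. p \<^bold>\<in> f \<longrightarrow> (\<exists>x y. x \<^bold>\<in> a \<and> y \<^bold>\<in> b \<and> is_pair p x y)) \<and>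
     (\<forall>x. x \<^bold>\<in> a \<longrightarrow> (\<exists>!y. maps_to f x y))"

definition is_bijection :: "'v \<Rightarrow> 'v \<Rightarrow> 'v \<Rightarrow> bool" where
  "is_bijection f a b \<longleftrightarrow>
     is_function f a b \<and> (\<forall>y. y \<^bold>\<in> b \<longrightarrow> (\<exists>!x. maps_to f x y))"

definition equinumerous :: "'v \<Rightarrow> 'v \<Rightarrow> bool" where
  "equinumerous a b \<longleftrightarrow> (\<exists>f. is_bijection f a b)"

definition cardinal :: "'v \<Rightarrow> bool" where
  "cardinal \<kappa> \<longleftrightarrow> ordinal \<kappa> \<and> \<not> (\<exists>\<alpha>. \<alpha> \<^bold>\<in> \<kappa> \<and> equinumerous \<alpha> \<kappa>)"

definition smaller_than :: "'v \<Rightarrow> 'v \<Rightarrow> bool" where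
  "smaller_than x \<kappa> \<longleftrightarrow> (\<exists>\<alpha>. \<alpha> \<^bold>\<in> \<kappa> \<and> equinumerous \<alpha> x)"


subsection \<open>Complete ultrafilters and strong compactness\<close>

definition ultrafilter_over :: "'v \<Rightarrow> 'v \<Rightarrow> bool" where
  "ultrafilter_over X U \<longleftrightarrow>
     (\<forall>A. A \<^bold>\<in> U \<longrightarrow> A \<^bold>\<subseteq> X) \<and>
     X \<^bold>\<in> U \<and>
     (\<forall>A. A \<^bold>\<in> U \<longrightarrow> (\<exists>z. z \<^bold>\<in> A)) \<and>
     (\<forall>A B. A \<^bold>\<in> U \<longrightarrow> A \<^bold>\<subseteq> B \<longrightarrow> B \<^bold>\<subseteq> X \<longrightarrow> B \<^bold>\<in> U) \<and>
     (\<forall>A B C. A \<^bold>\<in> U \<longrightarrow> B \<^bold>\<in> U \<longrightarrow>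
        (\<forall>z. z \<^bold>\<in> C \<longleftrightarrow> z \<^bold>\<in> A \<and> z \<^bold>\<in> B) \<longrightarrow> C \<^bold>\<in> U) \<and>
     (\<forall>A B. A \<^bold>\<subseteq> X \<longrightarrow>
        (\<forall>z. z \<^bold>\<in> B \<longleftrightarrow> z \<^bold>\<in> X \<and> \<not> z \<^bold>\<in> A) \<longrightarrow> A \<^bold>\<in> U \<or> B \<^bold>\<in> U)"

definition complete_ultrafilter_over :: "'v \<Rightarrow> 'v \<Rightarrow> 'v \<Rightarrow> bool" where
  "complete_ultrafilter_over \<kappa> X U \<longleftrightarrow>
     ultrafilter_over X U \<and>
     (\<forall>S C. S \<^bold>\<subseteq> U \<longrightarrow> smaller_than S \<kappa> \<longrightarrow>
        (\<forall>z. z \<^bold>\<in> C \<longleftrightarrow> z \<^bold>\<in> X \<and> (\<forall>A. A \<^bold>\<in> S \<longrightarrow> z \<^bold>\<in> A)) \<longrightarrow> C \<^bold>\<in> U)"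

text \<open>\<open>P = P\<^sub>\<kappa>(\<lambda>)\<close>, the set of subsets of \<open>\<lambda>\<close> of cardinality less than \<open>\<kappa>\<close>.\<close>

definition is_Pk :: "'v \<Rightarrow> 'v \<Rightarrow> 'v \<Rightarrow> bool" where
  "is_Pk P \<kappa> l \<longleftrightarrow> (\<forall>\<sigma>. \<sigma> \<^bold>\<in> P \<longleftrightarrow> \<sigma> \<^bold>\<subseteq> l \<and> smaller_than \<sigma> \<kappa>)"

definition fine :: "'v \<Rightarrow> 'v \<Rightarrow> 'v \<Rightarrow> bool" where
  "fine P l U \<longleftrightarrow>
     (\<forall>\<alpha> A. \<alpha> \<^bold>\<in> l \<longrightarrow> (\<forall>\<sigma>. \<sigma> \<^bold>\<in> A \<longleftrightarrow> \<sigma> \<^bold>\<in> P \<and> \<alpha> \<^bold>\<in> \<sigma>) \<longrightarrow> A \<^bold>\<in> U)"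

text \<open>
  For ordinals, \<open>\<subseteq>\<close> is \<open>\<le>\<close>. No finite cardinal satisfies this definition: for finite \<open>\<kappa>\<close> there is
  no fine ultrafilter over \<open>P\<^sub>\<kappa>(\<kappa>)\<close>. It does not exclude \<open>\<kappa> = \<omega>\<close>.
\<close>

definition strongly_compact :: "'v \<Rightarrow> bool" where
  "strongly_compact \<kappa> \<longleftrightarrow>
     cardinal \<kappa> \<and>
     (\<forall>l. cardinal l \<longrightarrow> \<kappa> \<^bold>\<subseteq> l \<longrightarrow>
        (\<exists>P U. is_Pk P \<kappa> l \<and> complete_ultrafilter_over \<kappa> P U \<and> fine P l U))"


subsection \<open>Ordinal definability\<close>

text \<open>
  \<open>x\<close> is the unique set satisfying, in the universe, a formula with parameters \<open>U\<close> and the ordinals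
  \<open>a 0, a 1, \<dots>\<close>, of which the formula mentions only finitely many. The formulas are those of the
  metatheory. In a model with nonstandard natural numbers this still agrees with the
  definition formalized inside set theory (definability over some rank-initial segment), because
  the codes of internal formulas are themselves ordinals, hence available as parameters; the
  converse inclusion is the reflection theorem.
\<close>

definition OD_from :: "'v \<Rightarrow> 'v set" where
  "OD_from U =
     {x. \<exists>\<phi> a. (\<forall>n. ordinal (a n)) \<and>
           (\<forall>y. sat E UNIV (case_nat y (case_nat U a)) \<phi> \<longleftrightarrow> y = x)}"

definition kOD :: "'v \<Rightarrow> 'v set" where
  "kOD \<kappa> = {x. \<exists>\<delta> U. ordinal \<delta> \<and> complete_ultrafilter_over \<kappa> \<delta> U \<and> x \<in> OD_from U}"

definition is_transitive_closure :: "'v \<Rightarrow> 'v \<Rightarrow> bool" where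
  "is_transitive_closure t x \<longleftrightarrow>
     x \<^bold>\<subseteq> t \<and> transitive t \<and> (\<forall>s. x \<^bold>\<subseteq> s \<longrightarrow> transitive s \<longrightarrow> t \<^bold>\<subseteq> s)"

definition kHOD :: "'v \<Rightarrow> 'v set" where
  "kHOD \<kappa> =
     {x. x \<in> kOD \<kappa> \<and> (\<exists>t. is_transitive_closure t x \<and> (\<forall>y. y \<^bold>\<in> t \<longrightarrow> y \<in> kOD \<kappa>))}"


subsection \<open>Inner models\<close>

text \<open>The classes of a model of set theory are its subsets definable with parameters.\<close>

definition is_class :: "'v set \<Rightarrow> bool" where
  "is_class C \<longleftrightarrow> (\<exists>\<phi> env. C = {x. sat E UNIV (case_nat x env) \<phi>})"

definition inner_model_of_ZF :: "'v set \<Rightarrow> bool" where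
  "inner_model_of_ZF C \<longleftrightarrow>
     is_class C \<and>
     (\<forall>x y. x \<in> C \<longrightarrow> y \<^bold>\<in> x \<longrightarrow> y \<in> C) \<and>
     (\<forall>\<alpha>. ordinal \<alpha> \<longrightarrow> \<alpha> \<in> C) \<and>
     ZF C"

end

end

theory Submission
  imports Defs
begin

text \<open>
  Let \<open>U\<close> be a set. Applying Goedel operations recursively along the ordinals, starting from \<open>U\<close>, the
  ordinals and the ranks \<open>V\<^sub>\<alpha>\<close>, enumerates by reflection exactly the sets definable from \<open>U\<close> and
  ordinals; so \<open>OD\<^sub>U\<close> is uniformly a definable class with a definable well-order. The Fubini product
  of two \<open>\<kappa>\<close>-complete ultrafilters over ordinals, transported to an ordinal by a pairing function, is
  again one and defines both factors. Hence finitely many parameters in \<open>\<kappa>\<close>-OD can be replaced by a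
  single ultrafilter, and a subset of \<open>\<kappa>\<close>-HOD definable from elements of \<open>\<kappa>\<close>-OD is in \<open>\<kappa>\<close>-HOD. The
  axioms of ZF follow.

  Let \<open>\<kappa>\<close> be strongly compact. If \<open>\<kappa> > \<omega>\<close>, every \<open>\<kappa>\<close>-complete ultrafilter over an ordinal in a given
  \<open>V\<^sub>\<rho>\<close> is a projection of one fine ultrafilter \<open>W\<close>. A projection of \<open>W\<close> depends only on an ordinal of
  the ultrapower by \<open>W\<close>, which is well-founded; so it is definable from \<open>W\<close> and an ordinal. Thus every
  element of \<open>\<kappa>\<close>-HOD is contained in one \<open>OD\<^sub>W\<close>, whose well-order yields transversals. If \<open>\<kappa> \<le> \<omega>\<close>,
  the image of a fine ultrafilter over \<open>P\<^sub>\<kappa>(\<lambda>)\<close> under \<open>\<sigma> \<mapsto> \<sigma> \<inter> A\<close> defines \<open>A \<subseteq> \<lambda>\<close>, and lives on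
  finite sets of ordinals, which are ordinal definable; so every set is in \<open>\<kappa>\<close>-HOD.
\<close>

section \<open>First-order definability\<close>

text \<open>The universe is an arbitrary model, possibly ill-founded from outside, so Separation,
  Replacement, induction and recursion are available only for predicates and functions that are
  first-order definable. Every use of them carries an obligation of definability, which the rules
  collected in \<open>dfn\<close> discharge by following the shape of the HOL term. The same
  calculus, with the set of admissible parameters as an argument, later shows that sets are
  definable from elements of \<kappa>-OD. A second obstacle is that \<open>OD_from\<close>
  quantifies over formulas of the metatheory, so that neither it nor \<kappa>-HOD is visibly a
  class. No syntax is formalized inside the model: with Goedel operations the induction over
  formulas stays outside, and only a recursion along the ordinals takes place inside. The case split
  at \<omega> comes from the ultrapower, whose well-foundedness rests on countable
  completeness.\<close>

named_theorems dfn

context set_universe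
begin

text \<open>A semantic mirror of formulas: predicates on assignments instead of syntax, so that
  definability is proved by resolution. The set \<open>A\<close> lists the constants allowed:
  \<open>UNIV\<close> for Separation in the universe, \<open>kOD k\<close> for membership in
  \<kappa>-HOD, \<open>U\<close> with the ordinals for OD from \<open>U\<close>.\<close>

inductive defn :: "'v set \<Rightarrow> ((nat \<Rightarrow> 'v) \<Rightarrow> bool) \<Rightarrow> bool" for A where
  defn_mem: "defn A (\<lambda>e. e i \<^bold>\<in> e j)"
| defn_eq: "defn A (\<lambda>e. e i = e j)"
| defn_const: "a \<in> A \<Longrightarrow> defn A (\<lambda>e. e i = a)"
| defn_neg: "defn A P \<Longrightarrow> defn A (\<lambda>e. \<not> P e)"
| defn_conj: "defn A P \<Longrightarrow> defn A Q \<Longrightarrow> defn A (\<lambda>e. P e \<and> Q e)"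
| defn_ex0: "defn A P \<Longrightarrow> defn A (\<lambda>e. \<exists>x. P (case_nat x e))"

text \<open>Definability of the graph, with the value at index 0 and the arguments shifted by one;
  the language has no function symbols.\<close>

definition dterm :: "'v set \<Rightarrow> ((nat \<Rightarrow> 'v) \<Rightarrow> 'v) \<Rightarrow> bool" where
  "dterm A t \<longleftrightarrow> defn A (\<lambda>e. e 0 = t (\<lambda>n. e (Suc n)))"

lemma case_nat_rename: "(\<lambda>n. case_nat x e (case_nat 0 (\<lambda>m. Suc (f m)) n)) = case_nat x (\<lambda>n. e (f n))"
  by (auto simp: fun_eq_iff split: nat.split)

lemma defn_rename: "defn A P \<Longrightarrow> defn A (\<lambda>e. P (\<lambda>n. e (f n)))"
proof (induction arbitrary: f rule: defn.induct)
  case (defn_ex0 P)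
  have "defn A (\<lambda>e. \<exists>x. P (\<lambda>n. case_nat x e (case_nat 0 (\<lambda>m. Suc (f m)) n)))"
    by (rule defn.defn_ex0[OF defn_ex0.IH])
  then show ?case by (simp only: case_nat_rename)
qed (auto intro: defn.intros)

lemma dterm_rename: "dterm A t \<Longrightarrow> dterm A (\<lambda>e. t (\<lambda>n. e (f n)))"
  unfolding dterm_def by (drule defn_rename[where f = "case_nat 0 (\<lambda>m. Suc (f m))"]) simp

text \<open>The bound variable is a separate argument of \<open>P\<close>, a shape that higher-order
  unification finds in any HOL formula; \<open>defn_ex0\<close> speaks of the assignment as a
  whole.\<close>

lemma defn_ex [dfn]:
  assumes "defn A (\<lambda>e. P (e 0) (\<lambda>n. e (Suc n)))" shows "defn A (\<lambda>e. \<exists>x. P x e)"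
  using defn_ex0[OF assms] by simp

lemma defn_not [dfn]: "defn A P \<Longrightarrow> defn A (\<lambda>e. \<not> P e)"
  by (rule defn_neg)

lemma defn_and [dfn]: "defn A P \<Longrightarrow> defn A Q \<Longrightarrow> defn A (\<lambda>e. P e \<and> Q e)"
  by (rule defn_conj)

lemma defn_or [dfn]:
  assumes "defn A P" "defn A Q" shows "defn A (\<lambda>e. P e \<or> Q e)"
proof -
  have "defn A (\<lambda>e. \<not> (\<not> P e \<and> \<not> Q e))" by (intro defn_not defn_and assms)
  then show ?thesis by simp
qed

lemma defn_imp [dfn]:
  assumes "defn A P" "defn A Q" shows "defn A (\<lambda>e. P e \<longrightarrow> Q e)"
proof -
  have "defn A (\<lambda>e. \<not> P e \<or> Q e)" by (intro defn_not defn_or assms)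
  then show ?thesis by (simp only: imp_conv_disj)
qed

lemma defn_iff [dfn]:
  assumes "defn A P" "defn A Q" shows "defn A (\<lambda>e. P e \<longleftrightarrow> Q e)"
proof -
  have "defn A (\<lambda>e. (P e \<longrightarrow> Q e) \<and> (Q e \<longrightarrow> P e))" by (intro defn_imp defn_and assms)
  then show ?thesis by (simp only: iff_conv_conj_imp)
qed

lemma defn_all [dfn]:
  assumes "defn A (\<lambda>e. P (e 0) (\<lambda>n. e (Suc n)))" shows "defn A (\<lambda>e. \<forall>x. P x e)"
proof -
  have "defn A (\<lambda>e. \<not> (\<exists>x. \<not> P x e))" by (intro defn_not defn_ex assms)
  then show ?thesis by simp
qed

lemma defn_True [dfn]: "defn A (\<lambda>e. True)"
  using defn_eq[of A 0 0] by simp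

lemma defn_False [dfn]: "defn A (\<lambda>e. False)"
  using defn_neg[OF defn_True] by simp

lemma dterm_var [dfn]: "dterm A (\<lambda>e. e i)"
  by (simp add: dterm_def defn_eq)

lemma dterm_const: "a \<in> A \<Longrightarrow> dterm A (\<lambda>e. a)"
  by (simp add: dterm_def defn_const)

lemma dterm_UNIV [dfn]: "dterm UNIV (\<lambda>e. a)"
  by (simp add: dterm_const)

lemma defn_comp:
  assumes "defn A (\<lambda>e. P (e 0) (\<lambda>n. e (Suc n)))" "dterm A t" shows "defn A (\<lambda>e. P (t e) e)"
proof -
  have "defn A (\<lambda>e. \<exists>x. x = t e \<and> P x e)"
    using assms by (intro defn_ex defn_and) (simp_all add: dterm_def)
  then show ?thesis by simp
qed

lemma defn_mem_term [dfn]: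
  assumes "dterm A s" "dterm A t" shows "defn A (\<lambda>e. s e \<^bold>\<in> t e)"
  by (rule defn_comp[of A "\<lambda>x e. x \<^bold>\<in> t e", OF _ assms(1)],
      rule defn_comp[of A "\<lambda>y e. e 0 \<^bold>\<in> y", OF _ dterm_rename[OF assms(2)]], rule defn_mem)

lemma defn_eq_term [dfn]:
  assumes "dterm A s" "dterm A t" shows "defn A (\<lambda>e. s e = t e)"
  by (rule defn_comp[of A "\<lambda>x e. x = t e", OF _ assms(1)],
      rule defn_comp[of A "\<lambda>y e. e 0 = y", OF _ dterm_rename[OF assms(2)]], rule defn_eq)

text \<open>Renaming of variables, instantiation of parameters and passage to a larger parameter set
  are all instances of the following substitution lemma.\<close>

lemma defn_subst:
  assumes "defn A P" "\<And>a. a \<in> A \<Longrightarrow> dterm B (\<lambda>e. a)" "\<And>n. dterm B (f n)"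
  shows "defn B (\<lambda>e. P (\<lambda>n. f n e))"
  using assms(1,3)
proof (induction arbitrary: f rule: defn.induct)
  case (defn_ex0 P)
  let ?g = "\<lambda>n. case n of 0 \<Rightarrow> \<lambda>e. e 0 | Suc m \<Rightarrow> \<lambda>e. f m (\<lambda>k. e (Suc k))"
  have "dterm B (?g n)" for n
    using dterm_rename[OF defn_ex0.prems, where f = Suc] by (cases n) (simp_all add: dterm_var)
  from defn.defn_ex0[OF defn_ex0.IH[OF this]]
  have "defn B (\<lambda>e. \<exists>x. P (\<lambda>n. ?g n (case_nat x e)))" .
  moreover have "(\<lambda>n. ?g n (case_nat x e)) = case_nat x (\<lambda>n. f n e)" for x e
    by (auto simp: fun_eq_iff split: nat.split)
  ultimately show ?case by simp
next
  case (defn_mem i j)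
  show ?case by (rule defn_mem_term; rule defn_mem.prems)
next
  case (defn_eq i j)
  show ?case by (rule defn_eq_term; rule defn_eq.prems)
next
  case (defn_const a i)
  show ?case by (rule defn_eq_term[OF defn_const.prems assms(2)[OF defn_const.hyps]])
next
  case (defn_neg P)
  show ?case by (rule defn_not[OF defn_neg.IH[OF defn_neg.prems]])
next
  case (defn_conj P Q)
  show ?case by (rule defn_and[OF defn_conj.IH(1)[OF defn_conj.prems] defn_conj.IH(2)[OF defn_conj.prems]])
qed

lemma dterm_subst:
  assumes "dterm A t" "\<And>a. a \<in> A \<Longrightarrow> dterm B (\<lambda>e. a)" "\<And>n. dterm B (f n)"
  shows "dterm B (\<lambda>e. t (\<lambda>n. f n e))"
proof -
  let ?g = "\<lambda>n. case n of 0 \<Rightarrow> \<lambda>e. e 0 | Suc m \<Rightarrow> \<lambda>e. f m (\<lambda>k. e (Suc k))"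
  have "dterm B (?g n)" for n
    using dterm_rename[OF assms(3), where f = Suc] by (cases n) (simp_all add: dterm_var)
  from defn_subst[OF assms(1)[unfolded dterm_def] assms(2), where f = ?g, OF _ this] show ?thesis
    by (simp add: dterm_def)
qed

lemma defn_trans: "defn A P \<Longrightarrow> (\<And>a. a \<in> A \<Longrightarrow> dterm B (\<lambda>e. a)) \<Longrightarrow> defn B P"
  using defn_subst[of A P B "\<lambda>n e. e n"] by (simp add: dterm_var)

lemma dterm_trans: "dterm A t \<Longrightarrow> (\<And>a. a \<in> A \<Longrightarrow> dterm B (\<lambda>e. a)) \<Longrightarrow> dterm B t"
  using dterm_subst[of A t B "\<lambda>n e. e n"] by (simp add: dterm_var)

lemma defn_mono: "defn A P \<Longrightarrow> A \<subseteq> B \<Longrightarrow> defn B P"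
  by (rule defn_trans) (auto intro: dterm_const)

lemma dterm_mono: "dterm A t \<Longrightarrow> A \<subseteq> B \<Longrightarrow> dterm B t"
  by (rule dterm_trans) (auto intro: dterm_const)

lemma defn_comp1:
  assumes "defn A (\<lambda>e. P (e 0))" "A \<subseteq> B" "dterm B s" shows "defn B (\<lambda>e. P (s e))"
  using defn_subst[OF defn_mono[OF assms(1,2)], of B "\<lambda>_. s"] assms(3) by (simp add: dterm_const)

lemma dterm_comp1:
  assumes "dterm A (\<lambda>e. f (e 0))" "A \<subseteq> B" "dterm B s" shows "dterm B (\<lambda>e. f (s e))"
  using dterm_subst[OF dterm_mono[OF assms(1,2)], of B "\<lambda>_. s"] assms(3) by (simp add: dterm_const)

lemma defn_comp2:
  assumes "defn A (\<lambda>e. P (e 0) (e 1))" "A \<subseteq> B" "dterm B s" "dterm B t"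
  shows "defn B (\<lambda>e. P (s e) (t e))"
  using defn_subst[OF defn_mono[OF assms(1,2)], of B "\<lambda>n. if n = 0 then s else t"] assms(3,4)
  by (simp add: dterm_const)

lemma dterm_comp2:
  assumes "dterm A (\<lambda>e. f (e 0) (e 1))" "A \<subseteq> B" "dterm B s" "dterm B t"
  shows "dterm B (\<lambda>e. f (s e) (t e))"
  using dterm_subst[OF dterm_mono[OF assms(1,2)], of B "\<lambda>n. if n = 0 then s else t"] assms(3,4)
  by (simp add: dterm_const)

lemma defn_comp3:
  assumes "defn A (\<lambda>e. P (e 0) (e 1) (e 2))" "A \<subseteq> B" "dterm B s" "dterm B t" "dterm B u"
  shows "defn B (\<lambda>e. P (s e) (t e) (u e))"
  using defn_subst[OF defn_mono[OF assms(1,2)], of B "\<lambda>n. if n = 0 then s else if n = 1 then t else u"]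
    assms(3-5) by (simp add: dterm_const)

text \<open>For notions without parameters: a fact stated for the variables \<open>e 0\<close>,
  \<open>e 1\<close>, \<open>e 2\<close> becomes a rule for arbitrary terms over any parameter set.
  Most \<open>dfn\<close> rules about defined constants arise in this way.\<close>

lemmas defn_lift1 = defn_comp1[OF _ empty_subsetI]
  and dterm_lift1 = dterm_comp1[OF _ empty_subsetI]
  and defn_lift2 = defn_comp2[OF _ empty_subsetI]
  and dterm_lift2 = dterm_comp2[OF _ empty_subsetI]
  and defn_lift3 = defn_comp3[OF _ empty_subsetI]

text \<open>In these two rules \<open>P\<close> and \<open>f\<close> depend on a variable bound at the point where the
  assumption is stated, and are used below further binders.\<close>

lemma defn_shift:
  assumes "defn A (\<lambda>e. P (e 0) (\<lambda>n. e (Suc n)))" "dterm A s"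
  shows "defn A (\<lambda>e. P (s e) (\<lambda>n. e (k n)))"
  using defn_subst[OF assms(1), of A "case_nat s (\<lambda>n e. e (k n))"] assms(2)
  by (auto simp: dterm_const dterm_var split: nat.split)

lemma dterm_shift:
  assumes "dterm A (\<lambda>e. f (e 0) (\<lambda>n. e (Suc n)))" "dterm A s"
  shows "dterm A (\<lambda>e. f (s e) (\<lambda>n. e (k n)))"
  using dterm_subst[OF assms(1), of A "case_nat s (\<lambda>n e. e (k n))"] assms(2)
  by (auto simp: dterm_const dterm_var split: nat.split)

lemma defn_if [dfn]:
  "defn A P \<Longrightarrow> defn A Q \<Longrightarrow> defn A R \<Longrightarrow> defn A (\<lambda>e. if P e then Q e else R e)"
proof -
  assume "defn A P" "defn A Q" "defn A R"
  then have "defn A (\<lambda>e. (P e \<longrightarrow> Q e) \<and> (\<not> P e \<longrightarrow> R e))" by (intro defn_imp defn_and defn_not)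
  then show ?thesis by (simp add: if_bool_eq_conj)
qed

lemma dterm_if [dfn]:
  assumes "defn A P" "dterm A s" "dterm A t" shows "dterm A (\<lambda>e. if P e then s e else t e)"
proof -
  have "defn A (\<lambda>e. if P (\<lambda>n. e (Suc n)) then e 0 = s (\<lambda>n. e (Suc n)) else e 0 = t (\<lambda>n. e (Suc n)))"
    using assms unfolding dterm_def by (intro defn_if defn_rename[OF assms(1)])
  then show ?thesis unfolding dterm_def by (simp add: if_distrib)
qed

lemma defn_ex1 [dfn]:
  assumes "defn A (\<lambda>e. P (e 0) (\<lambda>n. e (Suc n)))" shows "defn A (\<lambda>e. \<exists>!x. P x e)"
  unfolding Ex1_def by (intro dfn defn_shift[OF assms])

subsection \<open>Definability and satisfaction\<close>

lemma defn_sat: "defn {} P \<Longrightarrow> \<exists>\<phi>. \<forall>e. P e \<longleftrightarrow> sat E UNIV e \<phi>"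
proof (induction rule: defn.induct)
  case (defn_mem i j) then show ?case by (intro exI[of _ "Mem i j"]) simp
next
  case (defn_eq i j) then show ?case by (intro exI[of _ "Eq i j"]) simp
next
  case (defn_neg P) then obtain \<phi> where "\<forall>e. P e \<longleftrightarrow> sat E UNIV e \<phi>" by blast
  then show ?case by (intro exI[of _ "Neg \<phi>"]) simp
next
  case (defn_conj P Q) then obtain \<phi> \<psi> where "\<forall>e. P e \<longleftrightarrow> sat E UNIV e \<phi>" "\<forall>e. Q e \<longleftrightarrow> sat E UNIV e \<psi>"
    by blast
  then show ?case by (intro exI[of _ "Conj \<phi> \<psi>"]) simp
next
  case (defn_ex0 P) then obtain \<phi> where "\<forall>e. P e \<longleftrightarrow> sat E UNIV e \<phi>" by blast
  then show ?case by (intro exI[of _ "Ex \<phi>"]) simp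
qed auto

text \<open>Each fixed formula of the metatheory is treated separately, by induction on its
  structure, with quantifiers relativized to \<open>D\<close>; no truth predicate is
  involved.\<close>

lemma sat_defn:
  assumes "defn A (\<lambda>e. e 0 \<in> D)" shows "defn A (\<lambda>e. sat E D e \<phi>)"
proof (induction \<phi>)
  case (Ex \<phi>)
  have "defn A (\<lambda>e. \<exists>x. x \<in> D \<and> sat E D (case_nat x e) \<phi>)"
    using defn_ex0[OF defn_and[OF assms Ex]] by simp
  then show ?case by (simp add: Bex_def)
qed (simp_all add: defn.defn_mem defn.defn_eq defn_not defn_and)

lemma sat_defn_env:
  assumes "defn A (\<lambda>e. e 0 \<in> D)" "range env \<subseteq> A"
  shows "defn A (\<lambda>e. sat E D (case_nat (e 0) env) \<phi>)"
    and "defn A (\<lambda>e. sat E D (case_nat (e 0) (case_nat (e 1) env)) \<phi>)"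
proof -
  have c: "dterm A (\<lambda>e. env n)" for n by (rule dterm_const) (use assms(2) in auto)
  have "defn A (\<lambda>e. sat E D (\<lambda>n. (case n of 0 \<Rightarrow> \<lambda>e. e 0 | Suc m \<Rightarrow> \<lambda>e. env m) e) \<phi>)"
    by (rule defn_subst[OF sat_defn[OF assms(1)]]) (auto intro: dterm_const dterm_var c split: nat.split)
  moreover have "(\<lambda>n. (case n of 0 \<Rightarrow> \<lambda>e. e 0 | Suc m \<Rightarrow> \<lambda>e. env m) e) = case_nat (e 0) env" for e :: "nat \<Rightarrow> 'v"
    by (auto simp: fun_eq_iff split: nat.split)
  ultimately show "defn A (\<lambda>e. sat E D (case_nat (e 0) env) \<phi>)" by simp
  let ?f = "\<lambda>n. case n of 0 \<Rightarrow> \<lambda>e. e 0 | Suc m \<Rightarrow> (case m of 0 \<Rightarrow> \<lambda>e. e 1 | Suc l \<Rightarrow> \<lambda>e. env l)"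
  have "defn A (\<lambda>e. sat E D (\<lambda>n. ?f n e) \<phi>)"
    by (rule defn_subst[OF sat_defn[OF assms(1)]]) (auto intro: dterm_const dterm_var c split: nat.split)
  moreover have "(\<lambda>n. ?f n e) = case_nat (e 0) (case_nat (e 1) env)" for e :: "nat \<Rightarrow> 'v"
    by (auto simp: fun_eq_iff split: nat.split)
  ultimately show "defn A (\<lambda>e. sat E D (case_nat (e 0) (case_nat (e 1) env)) \<phi>)" by simp
qed

text \<open>A derivation of \<open>defn\<close> is a finite object and mentions finitely many
  constants.\<close>

lemma defn_finite: "defn A P \<Longrightarrow> \<exists>B. finite B \<and> B \<subseteq> A \<and> defn B P"
proof (induction rule: defn.induct)
  case (defn_const a i)
  then show ?case by (intro exI[of _ "{a}"]) (auto intro: defn.intros)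
next
  case (defn_conj P Q)
  then obtain B C where "finite B" "B \<subseteq> A" "defn B P" "finite C" "C \<subseteq> A" "defn C Q" by blast
  then show ?case by (intro exI[of _ "B \<union> C"]) (auto intro: defn.intros defn_mono)
next
  case (defn_mem i j)
  show ?case by (intro exI[of _ "{}"]) (simp add: defn.defn_mem)
next
  case (defn_eq i j)
  show ?case by (intro exI[of _ "{}"]) (simp add: defn.defn_eq)
next
  case (defn_neg P)
  then show ?case by (blast intro: defn.defn_neg)
next
  case (defn_ex0 P)
  then show ?case by (blast intro: defn.defn_ex0)
qed

text \<open>A parameter is traded for a new free variable at index 0; iterated, this eliminates any
  finite set of parameters.\<close>

lemma defn_insert: "defn (insert a A) P \<Longrightarrow> \<exists>Q. defn A Q \<and> (\<forall>e. P e \<longleftrightarrow> Q (case_nat a e))"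
proof (induction rule: defn.induct)
  case (defn_mem i j)
  show ?case by (rule exI[of _ "\<lambda>e. e (Suc i) \<^bold>\<in> e (Suc j)"]) (simp add: defn.defn_mem)
next
  case (defn_eq i j)
  show ?case by (rule exI[of _ "\<lambda>e. e (Suc i) = e (Suc j)"]) (simp add: defn.defn_eq)
next
  case (defn_const b i)
  show ?case
  proof (cases "b = a")
    case True
    then show ?thesis by (intro exI[of _ "\<lambda>e. e (Suc i) = e 0"]) (simp add: defn.defn_eq)
  next
    case False
    with defn_const show ?thesis
      by (intro exI[of _ "\<lambda>e. e (Suc i) = b"]) (simp add: defn.defn_const)
  qed
next
  case (defn_neg P)
  then obtain Q where "defn A Q" "\<forall>e. P e \<longleftrightarrow> Q (case_nat a e)" by blast
  then show ?case by (intro exI[of _ "\<lambda>e. \<not> Q e"]) (simp add: defn_not)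
next
  case (defn_conj P P')
  then obtain Q Q' where "defn A Q" "\<forall>e. P e \<longleftrightarrow> Q (case_nat a e)"
    "defn A Q'" "\<forall>e. P' e \<longleftrightarrow> Q' (case_nat a e)" by blast
  then show ?case by (intro exI[of _ "\<lambda>e. Q e \<and> Q' e"]) (simp add: defn_and)
next
  case (defn_ex0 P)
  then obtain Q where Q: "defn A Q" "\<forall>e. P e \<longleftrightarrow> Q (case_nat a e)" by blast
  \<comment> \<open>The binder puts \<open>x\<close> at index 0 and moves \<open>a\<close> to index
    1, whereas \<open>Q\<close> expects them the other way round; \<open>?f\<close> exchanges the
    two.\<close>
  let ?f = "\<lambda>n. case n of 0 \<Rightarrow> 1 | Suc m \<Rightarrow> (case m of 0 \<Rightarrow> 0 | Suc k \<Rightarrow> Suc (Suc k))"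
  have "defn A (\<lambda>e. \<exists>x. Q (\<lambda>n. case_nat x e (?f n)))"
    by (rule defn.defn_ex0[OF defn_rename[OF Q(1)]])
  moreover have "(\<lambda>n. case_nat x (case_nat a e) (?f n)) = case_nat a (case_nat x e)" for x e
    by (auto simp: fun_eq_iff split: nat.split)
  ultimately show ?case using Q(2) by (intro exI[of _ "\<lambda>e. \<exists>x. Q (\<lambda>n. case_nat x e (?f n))"]) simp
qed

section \<open>Parameters as a finite block of the assignment\<close>

definition env_app :: "'v list \<Rightarrow> (nat \<Rightarrow> 'v) \<Rightarrow> nat \<Rightarrow> 'v" where
  "env_app xs e = (\<lambda>n. if n < length xs then xs ! n else e (n - length xs))"

lemma env_app_Nil [simp]: "env_app [] e = e"
  and env_app_Cons: "env_app (x # xs) e = case_nat x (env_app xs e)"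
  by (auto simp: env_app_def fun_eq_iff split: nat.split)

lemma env_app_app: "env_app (xs @ ys) e = env_app xs (env_app ys e)"
  by (auto simp: env_app_def fun_eq_iff nth_append)

lemma defn_union:
  assumes "finite B" "defn (B \<union> C) P"
  shows "\<exists>Q ps. set ps \<subseteq> B \<and> defn C Q \<and> (\<forall>e. P e \<longleftrightarrow> Q (env_app ps e))"
  using assms
proof (induction arbitrary: P rule: finite_induct)
  case empty
  then show ?case by (intro exI[of _ P] exI[of _ "[]"]) auto
next
  case (insert a B)
  then obtain Q where Q: "defn (B \<union> C) Q" "\<forall>e. P e \<longleftrightarrow> Q (case_nat a e)"
    using defn_insert[of a "B \<union> C" P] unfolding Un_insert_left by blast
  from insert.IH[OF Q(1)] obtain Q' ps where Q': "set ps \<subseteq> B" "defn C Q'" "\<forall>e. Q e \<longleftrightarrow> Q' (env_app ps e)"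
    by blast
  have "env_app (ps @ [a]) e = env_app ps (case_nat a e)" for e
    by (simp add: env_app_app env_app_Cons)
  then show ?case using Q Q' by (intro exI[of _ Q'] exI[of _ "ps @ [a]"]) auto
qed

text \<open>Exchange of adjacent blocks: \<open>Q\<close> expects \<open>l\<close> parameters
  followed by \<open>k\<close> arguments, whereas the axiom schemes and \<open>OD_from\<close> put
  the arguments in front.\<close>

lemma defn_swap:
  assumes "defn C Q"
  shows "defn C (\<lambda>e. Q (\<lambda>n. if n < l then e (n + k) else if n < l + k then e (n - l) else e n))"
proof -
  have "(\<lambda>n. if n < l then e (n + k) else if n < l + k then e (n - l) else e n) =
    (\<lambda>n. e (if n < l then n + k else if n < l + k then n - l else n))" for e :: "nat \<Rightarrow> 'v"
    by auto
  then show ?thesis using defn_rename[OF assms] by simp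
qed

lemma env_app_swap: "length xs = k \<Longrightarrow> length ps = l \<Longrightarrow>
  (\<lambda>n. if n < l then env_app (xs @ ps) e (n + k) else if n < l + k then env_app (xs @ ps) e (n - l)
       else env_app (xs @ ps) e n) = env_app (ps @ xs) e"
  by (auto simp: env_app_def fun_eq_iff nth_append add.commute[of "length ps"])

text \<open>This is the form that the schemes expect: arguments first, parameters in the rest of the
  assignment. The values of \<open>e\<close> beyond the arguments become part of
  \<open>env\<close>.\<close>

lemma defn_UNIV_sat:
  assumes "defn UNIV P"
  shows "\<exists>\<phi> env. \<forall>xs. length xs = k \<longrightarrow> (P (env_app xs e) \<longleftrightarrow> sat E UNIV (env_app xs env) \<phi>)"
proof -
  obtain B where "finite B" "defn B P" using defn_finite[OF assms] by blast
  then obtain Q ps where Q: "defn {} Q" "\<And>e. P e \<longleftrightarrow> Q (env_app ps e)"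
    using defn_union[of B "{}" P] by auto
  let ?l = "length ps"
  have "defn {} (\<lambda>e. Q (\<lambda>n. if n < ?l then e (n + k) else if n < ?l + k then e (n - ?l) else e n))"
    by (rule defn_swap[OF Q(1)])
  then obtain \<phi> where \<phi>: "\<And>e. Q (\<lambda>n. if n < ?l then e (n + k) else if n < ?l + k then e (n - ?l) else e n)
     \<longleftrightarrow> sat E UNIV e \<phi>" using defn_sat by blast
  have "P (env_app xs e) \<longleftrightarrow> sat E UNIV (env_app xs (env_app ps e)) \<phi>" if "length xs = k" for xs
    using Q(2) \<phi>[of "env_app (xs @ ps) e"] env_app_swap[of xs k ps ?l e] that
    by (simp add: env_app_app)
  then show ?thesis by blast
qed

text \<open>Links the formula and the sequence of ordinals in \<open>OD_from\<close> to the calculus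
  of definability. The sequence \<open>a\<close> fills the assignment beyond the finitely many
  ordinals in use; no axiom at this point guarantees that an ordinal exists.\<close>

lemma defn_OD_from:
  fixes a :: "nat \<Rightarrow> 'v"
  assumes "\<And>n. ordinal (a n)"
  shows "x \<in> OD_from U \<longleftrightarrow> dterm (insert U {\<alpha>. ordinal \<alpha>}) (\<lambda>e. x)"
proof
  assume "x \<in> OD_from U"
  then obtain \<phi> b where b: "\<And>n. ordinal (b n)"
    "\<And>y. sat E UNIV (case_nat y (case_nat U b)) \<phi> \<longleftrightarrow> y = x"
    unfolding OD_from_def by blast
  let ?A = "insert U {\<alpha>. ordinal \<alpha>}"
  have "defn ?A (\<lambda>e. sat E UNIV (\<lambda>n. (case n of 0 \<Rightarrow> \<lambda>e. e 0 | Suc m \<Rightarrow> \<lambda>e. case_nat U b m) e) \<phi>)"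
    by (rule defn_subst[OF sat_defn[of ?A]])
      (simp_all add: defn_True dterm_var dterm_const b(1) split: nat.split)
  moreover have "(\<lambda>n. (case n of 0 \<Rightarrow> \<lambda>e. e 0 | Suc m \<Rightarrow> \<lambda>e. case_nat U b m) e) = case_nat (e 0) (case_nat U b)"
    for e :: "nat \<Rightarrow> 'v" by (auto simp: fun_eq_iff split: nat.split)
  ultimately show "dterm ?A (\<lambda>e. x)" by (simp add: dterm_def b)
next
  assume "dterm (insert U {\<alpha>. ordinal \<alpha>}) (\<lambda>e. x)"
  then obtain B where B: "finite B" "B \<subseteq> insert U {\<alpha>. ordinal \<alpha>}" "defn B (\<lambda>e. e 0 = x)"
    unfolding dterm_def using defn_finite by blast
  \<comment> \<open>The parameter \<open>U\<close> is split off from the ordinals because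
    \<open>OD_from\<close> reserves index 1 for it, even if it is an ordinal itself or does not
    occur in \<open>B\<close>.\<close>
  have "defn ((B - {U}) \<union> {U}) (\<lambda>e. e 0 = x)" by (rule defn_mono[OF B(3)]) auto
  then obtain Q1 ps where Q1: "set ps \<subseteq> B - {U}" "defn {U} Q1" "\<And>e. e 0 = x \<longleftrightarrow> Q1 (env_app ps e)"
    using defn_union[of "B - {U}" "{U}"] B(1) by blast
  obtain Q2 where Q2: "defn {} Q2" "\<And>e. Q1 e \<longleftrightarrow> Q2 (case_nat U e)"
    using defn_insert[of U "{}"] Q1(2) by blast
  let ?ps = "U # ps"
  let ?l = "length ?ps"
  have Q: "e 0 = x \<longleftrightarrow> Q2 (env_app ?ps e)" for e by (simp add: env_app_Cons Q1 Q2)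
  obtain \<phi> where \<phi>: "\<And>e. Q2 (\<lambda>n. if n < ?l then e (n + 1) else if n < ?l + 1 then e (n - ?l) else e n)
     \<longleftrightarrow> sat E UNIV e \<phi>" using defn_sat[OF defn_swap[OF Q2(1), of ?l 1]] by blast
  have "sat E UNIV (case_nat y (case_nat U (env_app ps a))) \<phi> \<longleftrightarrow> y = x" for y
  proof -
    have "sat E UNIV (env_app ([y] @ ?ps) a) \<phi> \<longleftrightarrow> Q2 (env_app (?ps @ [y]) a)"
      unfolding \<phi>[symmetric] by (subst env_app_swap) auto
    also have "\<dots> \<longleftrightarrow> y = x" using Q[of "case_nat y a"] by (simp add: env_app_app env_app_Cons)
    finally show ?thesis by (simp add: env_app_Cons)
  qed
  moreover have "ordinal (env_app ps a n)" for n
  proof -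
    have "ps ! n \<in> B - {U}" if "n < length ps" using that Q1(1) nth_mem by blast
    then show ?thesis using B(2) assms by (auto simp: env_app_def)
  qed
  ultimately show "x \<in> OD_from U" unfolding OD_from_def by blast
qed

end

section \<open>Set theory in a model of ZF\<close>

locale zf_model = set_universe E for E :: "'v \<Rightarrow> 'v \<Rightarrow> bool" (infix "\<^bold>\<in>" 50) +
  assumes ZF: "ZF UNIV"
begin

text \<open>Definability with arbitrary parameters: the side condition for every use of Separation,
  Replacement, induction and recursion.\<close>

abbreviation dP :: "('v \<Rightarrow> bool) \<Rightarrow> bool" where "dP P \<equiv> defn UNIV (\<lambda>e. P (e 0))"
abbreviation dF :: "('v \<Rightarrow> 'v) \<Rightarrow> bool" where "dF f \<equiv> dterm UNIV (\<lambda>e. f (e 0))"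

lemma dP_comp: "dP P \<Longrightarrow> dterm UNIV t \<Longrightarrow> defn UNIV (\<lambda>e. P (t e))"
  by (rule defn_comp1) auto

lemma dF_comp: "dF f \<Longrightarrow> dterm UNIV t \<Longrightarrow> dterm UNIV (\<lambda>e. f (t e))"
  by (rule dterm_comp1) auto

lemma ext: "(\<And>z. z \<^bold>\<in> x \<longleftrightarrow> z \<^bold>\<in> y) \<Longrightarrow> x = y"
  using ZF unfolding ZF_def extensionality_def by auto

lemma ex_empty: "\<exists>x. \<forall>z. \<not> z \<^bold>\<in> x"
  using ZF unfolding ZF_def infinity_def by auto

definition emp :: 'v where "emp = (THE x. \<forall>z. \<not> z \<^bold>\<in> x)"

lemma mem_emp [simp]: "\<not> z \<^bold>\<in> emp"
proof -
  have "\<exists>!x. \<forall>z. \<not> z \<^bold>\<in> x" using ex_empty ext by blast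
  from theI'[OF this] show ?thesis by (simp add: emp_def)
qed

lemma sub_antisym: "x \<^bold>\<subseteq> y \<Longrightarrow> y \<^bold>\<subseteq> x \<Longrightarrow> x = y"
  unfolding subset_def by (rule ext) blast

lemma eq_emp: "x = emp \<longleftrightarrow> (\<forall>z. \<not> z \<^bold>\<in> x)"
  using ext by auto

text \<open>Unlike \<open>THE\<close>, this operator has a definable value even where \<open>P\<close> does not single out a set,
  so that everything defined by means of it is definable without side conditions.\<close>

definition iota :: "('v \<Rightarrow> bool) \<Rightarrow> 'v" where
  "iota P = (if \<exists>!y. P y then THE y. P y else emp)"

lemma iota_eq: "P a \<Longrightarrow> (\<And>y. P y \<Longrightarrow> y = a) \<Longrightarrow> iota P = a"
  unfolding iota_def by (metis the_equality)

lemma iota_iff: "(\<And>y. P y \<longleftrightarrow> y = a) \<Longrightarrow> iota P = a"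
  by (rule iota_eq) auto

lemma iotaI: "P a \<Longrightarrow> (\<And>y. P y \<Longrightarrow> y = a) \<Longrightarrow> P (iota P)"
  using iota_eq by metis

lemma eq_iota: "x = iota P \<longleftrightarrow> ((\<exists>!y. P y) \<and> P x) \<or> (\<not> (\<exists>!y. P y) \<and> (\<forall>z. \<not> z \<^bold>\<in> x))"
  unfolding iota_def eq_emp[symmetric] by (auto intro: theI2 the_equality[symmetric])

lemma iota_dfn [dfn]:
  assumes "defn A (\<lambda>e. P (e 0) (\<lambda>n. e (Suc n)))" shows "dterm A (\<lambda>e. iota (\<lambda>y. P y e))"
  unfolding dterm_def eq_iota by (intro dfn defn_shift[OF assms])

lemma emp_dfn [dfn]: "dterm A (\<lambda>e. emp)"
  unfolding dterm_def eq_emp by (intro dfn)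

lemma separation_set:
  assumes "dP P" shows "\<exists>b. \<forall>z. z \<^bold>\<in> b \<longleftrightarrow> z \<^bold>\<in> a \<and> P z"
proof -
  obtain \<phi> env where "\<forall>xs. length xs = 1 \<longrightarrow> (P (env_app xs (\<lambda>_. emp) 0) \<longleftrightarrow> sat E UNIV (env_app xs env) \<phi>)"
    using defn_UNIV_sat[OF assms, of 1] by blast
  from this[THEN spec, of "[_]"] have "P x \<longleftrightarrow> sat E UNIV (case_nat x env) \<phi>" for x
    by (simp add: env_app_Cons)
  moreover have "\<exists>b. \<forall>z. z \<^bold>\<in> b \<longleftrightarrow> z \<^bold>\<in> a \<and> sat E UNIV (case_nat z env) \<phi>"
    using ZF unfolding ZF_def separation_def by simp
  ultimately show ?thesis by simp
qed

lemma replacement_set: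
  assumes "dF f" shows "\<exists>b. \<forall>y. y \<^bold>\<in> b \<longleftrightarrow> (\<exists>x. x \<^bold>\<in> a \<and> y = f x)"
proof -
  have "defn UNIV (\<lambda>e. e 1 = f (e 0))"
    by (intro dfn dF_comp[OF assms])
  from defn_UNIV_sat[OF this, of 2 "\<lambda>_. emp"] obtain \<phi> env where
    "\<forall>xs. length xs = 2 \<longrightarrow> (env_app xs (\<lambda>_. emp) 1 = f (env_app xs (\<lambda>_. emp) 0) \<longleftrightarrow> sat E UNIV (env_app xs env) \<phi>)"
    by blast
  from this[THEN spec, of "[_, _]"] have *: "y = f x \<longleftrightarrow> sat E UNIV (case_nat x (case_nat y env)) \<phi>" for x y
    by (simp add: env_app_Cons)
  have "(\<forall>x. x \<^bold>\<in> a \<longrightarrow> (\<forall>y y'. sat E UNIV (case_nat x (case_nat y env)) \<phi> \<longrightarrow>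
                 sat E UNIV (case_nat x (case_nat y' env)) \<phi> \<longrightarrow> y = y')) \<longrightarrow>
           (\<exists>b. \<forall>y. y \<^bold>\<in> b \<longleftrightarrow> (\<exists>x. x \<^bold>\<in> a \<and> sat E UNIV (case_nat x (case_nat y env)) \<phi>))"
    using ZF unfolding ZF_def replacement_def by simp
  then show ?thesis unfolding *[symmetric] by simp
qed

lemma foundation_set: "y \<^bold>\<in> x \<Longrightarrow> \<exists>y. y \<^bold>\<in> x \<and> (\<forall>z. z \<^bold>\<in> x \<longrightarrow> \<not> z \<^bold>\<in> y)"
  using ZF unfolding ZF_def foundation_def by auto

subsection \<open>Basic operations\<close>

lemma iota_set:
  assumes "\<exists>b. \<forall>z. z \<^bold>\<in> b \<longleftrightarrow> P z" shows "z \<^bold>\<in> iota (\<lambda>b. \<forall>z. z \<^bold>\<in> b \<longleftrightarrow> P z) \<longleftrightarrow> P z"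
proof -
  obtain b where b: "\<forall>z. z \<^bold>\<in> b \<longleftrightarrow> P z" using assms by blast
  have "iota (\<lambda>b. \<forall>z. z \<^bold>\<in> b \<longleftrightarrow> P z) = b" 
  proof (rule iota_eq)
    show "y = b" if "\<forall>z. z \<^bold>\<in> y \<longleftrightarrow> P z" for y by (rule ext) (use b that in auto)
  qed (rule b)
  with b show ?thesis by simp
qed

definition upr :: "'v \<Rightarrow> 'v \<Rightarrow> 'v" where "upr a b = iota (\<lambda>p. \<forall>z. z \<^bold>\<in> p \<longleftrightarrow> z = a \<or> z = b)"
definition Uni :: "'v \<Rightarrow> 'v" where "Uni x = iota (\<lambda>u. \<forall>z. z \<^bold>\<in> u \<longleftrightarrow> (\<exists>y. y \<^bold>\<in> x \<and> z \<^bold>\<in> y))"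
definition Pw :: "'v \<Rightarrow> 'v" where "Pw x = iota (\<lambda>p. \<forall>z. z \<^bold>\<in> p \<longleftrightarrow> z \<^bold>\<subseteq> x)"
text \<open>For this operator and \<open>img\<close> the value is \<open>emp\<close> if no set has
  the required elements; the rules for membership therefore ask for definability of \<open>P\<close>
  and of \<open>f\<close>.\<close>

definition sep :: "'v \<Rightarrow> ('v \<Rightarrow> bool) \<Rightarrow> 'v" where "sep a P = iota (\<lambda>b. \<forall>z. z \<^bold>\<in> b \<longleftrightarrow> z \<^bold>\<in> a \<and> P z)"
definition img :: "'v \<Rightarrow> ('v \<Rightarrow> 'v) \<Rightarrow> 'v" where "img a f = iota (\<lambda>b. \<forall>y. y \<^bold>\<in> b \<longleftrightarrow> (\<exists>x. x \<^bold>\<in> a \<and> y = f x))"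

lemma mem_upr [simp]: "z \<^bold>\<in> upr a b \<longleftrightarrow> z = a \<or> z = b"
  unfolding upr_def by (rule iota_set) (use ZF in \<open>auto simp: ZF_def pairing_def\<close>)

lemma mem_Uni [simp]: "z \<^bold>\<in> Uni x \<longleftrightarrow> (\<exists>y. y \<^bold>\<in> x \<and> z \<^bold>\<in> y)"
  unfolding Uni_def by (rule iota_set) (use ZF in \<open>auto simp: ZF_def union_def\<close>)

lemma mem_Pw [simp]: "z \<^bold>\<in> Pw x \<longleftrightarrow> z \<^bold>\<subseteq> x"
  unfolding Pw_def by (rule iota_set) (use ZF in \<open>auto simp: ZF_def power_set_def subset_def\<close>)

lemma mem_sep: "dP P \<Longrightarrow> z \<^bold>\<in> sep a P \<longleftrightarrow> z \<^bold>\<in> a \<and> P z"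
  unfolding sep_def by (rule iota_set) (rule separation_set)

lemma mem_img: "dF f \<Longrightarrow> y \<^bold>\<in> img a f \<longleftrightarrow> (\<exists>x. x \<^bold>\<in> a \<and> y = f x)"
  unfolding img_def by (rule iota_set) (rule replacement_set)

lemma subset_dfn [THEN defn_lift2, dfn]:
  "defn {} (\<lambda>e. e 0 \<^bold>\<subseteq> e 1)"
  unfolding subset_def by (intro dfn)

lemma upr_dfn [THEN dterm_lift2, dfn]:
  "dterm {} (\<lambda>e. upr (e 0) (e 1))"
  unfolding upr_def by (intro dfn)

lemma Uni_dfn [THEN dterm_lift1, dfn]:
  "dterm {} (\<lambda>e. Uni (e 0))"
  unfolding Uni_def by (intro dfn)

lemma Pw_dfn [THEN dterm_lift1, dfn]:
  "dterm {} (\<lambda>e. Pw (e 0))"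
  unfolding Pw_def by (intro dfn)

lemma sep_dfn [dfn]:
  assumes "dterm A a" "defn A (\<lambda>e. P (e 0) (\<lambda>n. e (Suc n)))"
  shows "dterm A (\<lambda>e. sep (a e) (\<lambda>x. P x e))"
  unfolding sep_def by (intro dfn dterm_rename[OF assms(1)] defn_shift[OF assms(2)])

lemma img_dfn [dfn]:
  assumes "dterm A a" "dterm A (\<lambda>e. f (e 0) (\<lambda>n. e (Suc n)))"
  shows "dterm A (\<lambda>e. img (a e) (\<lambda>x. f x e))"
  unfolding img_def by (intro dfn dterm_rename[OF assms(1)] dterm_shift[OF assms(2)])

definition un :: "'v \<Rightarrow> 'v \<Rightarrow> 'v" where "un x y = Uni (upr x y)"
definition ins :: "'v \<Rightarrow> 'v \<Rightarrow> 'v" where "ins x y = un y (upr x x)"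
definition pr :: "'v \<Rightarrow> 'v \<Rightarrow> 'v" where "pr a b = upr (upr a a) (upr a b)"
definition ap :: "'v \<Rightarrow> 'v \<Rightarrow> 'v" where "ap f x = iota (\<lambda>y. pr x y \<^bold>\<in> f)"
definition fs :: "'v \<Rightarrow> 'v" where "fs p = iota (\<lambda>a. \<exists>b. p = pr a b)"
definition sn :: "'v \<Rightarrow> 'v" where "sn p = iota (\<lambda>b. \<exists>a. p = pr a b)"
definition lam :: "'v \<Rightarrow> ('v \<Rightarrow> 'v) \<Rightarrow> 'v" where "lam a f = img a (\<lambda>x. pr x (f x))"
definition UNI :: "'v \<Rightarrow> ('v \<Rightarrow> 'v) \<Rightarrow> 'v" where "UNI a f = Uni (img a f)"

lemma mem_un [simp]: "z \<^bold>\<in> un x y \<longleftrightarrow> z \<^bold>\<in> x \<or> z \<^bold>\<in> y"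
  unfolding un_def by auto

lemma mem_ins [simp]: "z \<^bold>\<in> ins x y \<longleftrightarrow> z = x \<or> z \<^bold>\<in> y"
  unfolding ins_def by auto

lemma pr_inject [simp]: "pr a b = pr c d \<longleftrightarrow> a = c \<and> b = d"
proof
  assume *: "pr a b = pr c d"
  have "z \<^bold>\<in> pr a b \<longleftrightarrow> z = upr a a \<or> z = upr a b" for a b z unfolding pr_def by simp
  then have 1: "upr a a = upr c c \<or> upr a a = upr c d" "upr a b = upr c c \<or> upr a b = upr c d"
    "upr c c = upr a a \<or> upr c c = upr a b" "upr c d = upr a a \<or> upr c d = upr a b"
    using * by metis+
  have 2: "upr a b = upr c d \<longleftrightarrow> (a = c \<and> b = d) \<or> (a = d \<and> b = c)" for a b c d
    using mem_upr by (metis ext)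
  show "a = c \<and> b = d" using 1 unfolding 2 by auto
qed simp

lemma un_dfn [THEN dterm_lift2, dfn]:
  "dterm {} (\<lambda>e. un (e 0) (e 1))"
  unfolding un_def by (intro dfn)
lemma ins_dfn [THEN dterm_lift2, dfn]:
  "dterm {} (\<lambda>e. ins (e 0) (e 1))"
  unfolding ins_def by (intro dfn)
lemma pr_dfn [THEN dterm_lift2, dfn]:
  "dterm {} (\<lambda>e. pr (e 0) (e 1))"
  unfolding pr_def by (intro dfn)
lemma ap_dfn [THEN dterm_lift2, dfn]:
  "dterm {} (\<lambda>e. ap (e 0) (e 1))"
  unfolding ap_def by (intro dfn)

lemma fs_dfn [THEN dterm_lift1, dfn]:
  "dterm {} (\<lambda>e. fs (e 0))"
  unfolding fs_def by (intro dfn)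
lemma sn_dfn [THEN dterm_lift1, dfn]:
  "dterm {} (\<lambda>e. sn (e 0))"
  unfolding sn_def by (intro dfn)

lemma fs_pr [simp]: "fs (pr a b) = a"
  unfolding fs_def by (rule iota_iff) auto

lemma sn_pr [simp]: "sn (pr a b) = b"
  unfolding sn_def by (rule iota_iff) auto

lemma lam_dfn [dfn]:
  assumes "dterm A a" "dterm A (\<lambda>e. f (e 0) (\<lambda>n. e (Suc n)))"
  shows "dterm A (\<lambda>e. lam (a e) (\<lambda>x. f x e))"
  unfolding lam_def by (intro dfn assms)

lemma UNI_dfn [dfn]:
  assumes "dterm A a" "dterm A (\<lambda>e. f (e 0) (\<lambda>n. e (Suc n)))"
  shows "dterm A (\<lambda>e. UNI (a e) (\<lambda>x. f x e))"
  unfolding UNI_def by (intro dfn assms)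

lemma mem_lam: assumes "dF f" shows "p \<^bold>\<in> lam a f \<longleftrightarrow> (\<exists>x. x \<^bold>\<in> a \<and> p = pr x (f x))"
  unfolding lam_def by (rule mem_img) (intro dfn dF_comp[OF assms])

lemma ap_lam: "dF f \<Longrightarrow> x \<^bold>\<in> a \<Longrightarrow> ap (lam a f) x = f x"
  unfolding ap_def by (rule iota_iff) (auto simp: mem_lam)

lemma mem_UNI: "dF f \<Longrightarrow> z \<^bold>\<in> UNI a f \<longleftrightarrow> (\<exists>x. x \<^bold>\<in> a \<and> z \<^bold>\<in> f x)"
  unfolding UNI_def by (auto simp: mem_img)

lemma mem_UNI_lam: "dF g \<Longrightarrow> dF f \<Longrightarrow> z \<^bold>\<in> UNI (lam a f) g \<longleftrightarrow> (\<exists>x. x \<^bold>\<in> a \<and> z \<^bold>\<in> g (pr x (f x)))"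
  by (subst mem_UNI, assumption, subst mem_lam, assumption) blast

lemma is_upair_iff: "is_upair p a b \<longleftrightarrow> p = upr a b"
  unfolding is_upair_def using ext[of p "upr a b"] by auto

lemma is_pair_iff: "is_pair p a b \<longleftrightarrow> p = pr a b"
  unfolding is_pair_def is_upair_iff pr_def by simp

lemma maps_to_iff: "maps_to f x y \<longleftrightarrow> pr x y \<^bold>\<in> f"
  unfolding maps_to_def is_pair_iff by simp

subsection \<open>Ordinals\<close>

lemma transitive_dfn [THEN defn_lift1, dfn]:
  "defn {} (\<lambda>e. transitive (e 0))"
  unfolding transitive_def by (intro dfn)

lemma ordinal_dfn [THEN defn_lift1, dfn]:
  "defn {} (\<lambda>e. ordinal (e 0))"
  unfolding ordinal_def by (intro dfn)

lemma mem_irrefl: "\<not> x \<^bold>\<in> x"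
  using foundation_set[of x "upr x x"] by auto

lemma mem_asym: "x \<^bold>\<in> y \<Longrightarrow> \<not> y \<^bold>\<in> x"
  using foundation_set[of x "upr x y"] by auto

lemma ord_mem: "ordinal a \<Longrightarrow> b \<^bold>\<in> a \<Longrightarrow> ordinal b"
  unfolding ordinal_def transitive_def subset_def by blast

lemma ord_trans: "ordinal a \<Longrightarrow> b \<^bold>\<in> a \<Longrightarrow> c \<^bold>\<in> b \<Longrightarrow> c \<^bold>\<in> a"
  unfolding ordinal_def transitive_def subset_def by blast

text \<open>Foundation, applied to the set of those ordinals up to and including \<open>a\<close>
  that satisfy \<open>P\<close>; the class \<open>P\<close> itself may be proper.\<close>

lemma ord_minimal:
  assumes "dP P" "ordinal a" "P a"
  shows "\<exists>b. ordinal b \<and> P b \<and> (\<forall>c. c \<^bold>\<in> b \<longrightarrow> \<not> P c) \<and> (b \<^bold>\<in> a \<or> b = a)"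
proof -
  have *: "z \<^bold>\<in> sep (ins a a) P \<longleftrightarrow> (z = a \<or> z \<^bold>\<in> a) \<and> P z" for z
    using assms(1) by (simp add: mem_sep)
  then obtain b where b: "b \<^bold>\<in> sep (ins a a) P" "\<And>z. z \<^bold>\<in> sep (ins a a) P \<Longrightarrow> \<not> z \<^bold>\<in> b"
    using foundation_set[of a] assms(3) by blast
  then show ?thesis unfolding * using ord_mem[OF assms(2)] ord_trans[OF assms(2)] assms(2) by blast
qed

text \<open>A failure would have a least instance. The restriction to definable \<open>P\<close>
  reflects that the ordinals of the model need not be well-ordered from outside.\<close>

lemma ord_induct:
  assumes "dP P" "\<And>a. ordinal a \<Longrightarrow> (\<And>b. b \<^bold>\<in> a \<Longrightarrow> P b) \<Longrightarrow> P a" "ordinal a"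
  shows "P a"
proof (rule ccontr)
  assume "\<not> P a"
  from ord_minimal[of "\<lambda>x. \<not> P x", OF defn_not[OF assms(1)] assms(3) this] assms(2) show False
    by blast
qed

text \<open>Nested induction on \<open>a\<close> and \<open>b\<close>: if neither is an element of
  the other, the two induction hypotheses make their elements agree, and extensionality gives
  equality.\<close>

lemma ord_linear:
  assumes "ordinal a" "ordinal b" shows "a \<^bold>\<in> b \<or> a = b \<or> b \<^bold>\<in> a"
proof -
  let ?C = "\<lambda>a b. a \<^bold>\<in> b \<or> a = b \<or> b \<^bold>\<in> a"
  have "\<forall>b. ordinal b \<longrightarrow> ?C a b"
  proof (rule ord_induct[OF _ _ assms(1)])
    fix a assume a: "ordinal a" "\<And>c. c \<^bold>\<in> a \<Longrightarrow> \<forall>b. ordinal b \<longrightarrow> ?C c b"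
    show "\<forall>b. ordinal b \<longrightarrow> ?C a b"
    proof (intro allI impI)
      fix b assume "ordinal b"
      then show "?C a b"
      proof (rule ord_induct[rotated 2])
        fix b assume b: "ordinal b" "\<And>c. c \<^bold>\<in> b \<Longrightarrow> ?C a c"
        have "a = b" if "\<not> a \<^bold>\<in> b" "\<not> b \<^bold>\<in> a"
        proof (rule ext)
          fix z show "z \<^bold>\<in> a \<longleftrightarrow> z \<^bold>\<in> b"
            using a b that ord_trans by blast
        qed
        then show "?C a b" by blast
      qed (intro dfn)
    qed
  qed (intro dfn)
  then show ?thesis using assms(2) by blast
qed

lemma ord_subset: "ordinal a \<Longrightarrow> ordinal b \<Longrightarrow> a \<^bold>\<subseteq> b \<longleftrightarrow> a \<^bold>\<in> b \<or> a = b"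
  unfolding subset_def using ord_linear mem_irrefl ord_trans by metis

lemma ordI: "transitive a \<Longrightarrow> (\<And>b. b \<^bold>\<in> a \<Longrightarrow> ordinal b) \<Longrightarrow> ordinal a"
  unfolding ordinal_def by blast

lemma ord_emp [simp]: "ordinal emp"
  by (simp add: ordinal_def transitive_def)

lemma ord_succ [simp]: "ordinal a \<Longrightarrow> ordinal (ins a a)"
  by (rule ordI) (auto simp: transitive_def subset_def intro: ord_mem ord_trans)

lemma ord_Uni: "(\<And>x. x \<^bold>\<in> a \<Longrightarrow> ordinal x) \<Longrightarrow> ordinal (Uni a)"
  by (rule ordI) (auto simp: transitive_def subset_def intro: ord_mem dest: ord_trans)

lemma ord_UNI: "dF f \<Longrightarrow> (\<And>x. x \<^bold>\<in> a \<Longrightarrow> ordinal (f x)) \<Longrightarrow> ordinal (UNI a f)"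
  unfolding UNI_def by (rule ord_Uni) (auto simp: mem_img)

lemma ord_un: "ordinal a \<Longrightarrow> ordinal b \<Longrightarrow> ordinal (un a b)"
  unfolding un_def by (rule ord_Uni) auto

text \<open>The Burali-Forti argument: otherwise the ordinals would form a set, which would be an
  ordinal and hence its own element.\<close>

lemma no_ord_set: "\<exists>a. ordinal a \<and> \<not> a \<^bold>\<in> x"
proof (rule ccontr)
  assume *: "\<not> ?thesis"
  have "z \<^bold>\<in> sep x ordinal \<longleftrightarrow> ordinal z" for z
    using * by (subst mem_sep) (auto intro: dfn)
  then have "ordinal (sep x ordinal)" "sep x ordinal \<^bold>\<in> sep x ordinal"
    by (metis ordI transitive_def subset_def ord_mem)+
  then show False using mem_irrefl by blast
qed

lemma ord_bound:
  assumes "dF f" "\<And>x. x \<^bold>\<in> a \<Longrightarrow> ordinal (f x)"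
  shows "\<exists>b. ordinal b \<and> (\<forall>x. x \<^bold>\<in> a \<longrightarrow> f x \<^bold>\<in> b)"
proof (intro exI conjI allI impI)
  show "ordinal (ins (UNI a f) (UNI a f))" using assms by (simp add: ord_UNI)
  fix x assume x: "x \<^bold>\<in> a"
  then have "f x \<^bold>\<subseteq> UNI a f" using assms(1) by (auto simp: subset_def mem_UNI)
  then show "f x \<^bold>\<in> ins (UNI a f) (UNI a f)" using assms x by (auto simp: ord_subset ord_UNI)
qed

definition least :: "('v \<Rightarrow> bool) \<Rightarrow> 'v" where
  "least P = iota (\<lambda>a. ordinal a \<and> P a \<and> (\<forall>b. b \<^bold>\<in> a \<longrightarrow> \<not> P b))"

lemma least_dfn [dfn]:
  assumes "defn A (\<lambda>e. P (e 0) (\<lambda>n. e (Suc n)))" shows "dterm A (\<lambda>e. least (\<lambda>x. P x e))"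
  unfolding least_def by (intro dfn defn_shift[OF assms])

lemma least_eq: "ordinal a \<Longrightarrow> P a \<Longrightarrow> (\<And>b. b \<^bold>\<in> a \<Longrightarrow> \<not> P b) \<Longrightarrow> least P = a"
  unfolding least_def by (rule iota_eq) (use ord_linear in blast)+

lemma least:
  assumes "dP P" "ordinal a" "P a"
  shows "ordinal (least P)" "P (least P)" "\<And>b. b \<^bold>\<in> least P \<Longrightarrow> \<not> P b" "least P \<^bold>\<in> a \<or> least P = a"
proof -
  obtain b where b: "ordinal b" "P b" "\<And>c. c \<^bold>\<in> b \<Longrightarrow> \<not> P c" "b \<^bold>\<in> a \<or> b = a"
    using ord_minimal[OF assms] by blast
  then have "least P = b" by (intro least_eq) auto
  with b show "ordinal (least P)" "P (least P)" "\<And>b. b \<^bold>\<in> least P \<Longrightarrow> \<not> P b" "least P \<^bold>\<in> a \<or> least P = a" by auto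
qed

subsection \<open>Recursion on ordinals\<close>

text \<open>A set that solves the recursion below \<open>a\<close>; the first conjunct makes it a
  function with domain exactly \<open>a\<close>. The step function \<open>G\<close> receives the
  restriction to \<open>b\<close> as a set of pairs, hence the stage together with the earlier
  values.\<close>

definition approx :: "('v \<Rightarrow> 'v) \<Rightarrow> 'v \<Rightarrow> 'v \<Rightarrow> bool" where
  "approx G f a \<longleftrightarrow> f = lam a (ap f) \<and> (\<forall>b. b \<^bold>\<in> a \<longrightarrow> ap f b = G (lam b (ap f)))"

definition rec :: "('v \<Rightarrow> 'v) \<Rightarrow> 'v \<Rightarrow> 'v" where
  "rec G a = iota (\<lambda>y. \<exists>f. approx G f a \<and> y = G f)"

lemma rec_dfn [dfn]:
  assumes "dterm A (\<lambda>e. G (e 0) (\<lambda>n. e (Suc n)))" "dterm A a"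
  shows "dterm A (\<lambda>e. rec (\<lambda>f. G f e) (a e))"
  unfolding rec_def approx_def by (intro dfn dterm_rename[OF assms(2)] dterm_shift[OF assms(1)])

lemma lam_cong: "(\<And>x. x \<^bold>\<in> a \<Longrightarrow> f x = g x) \<Longrightarrow> lam a f = lam a g"
proof -
  assume *: "\<And>x. x \<^bold>\<in> a \<Longrightarrow> f x = g x"
  have "(\<lambda>b. \<forall>y. y \<^bold>\<in> b \<longleftrightarrow> (\<exists>x. x \<^bold>\<in> a \<and> y = pr x (f x))) = (\<lambda>b. \<forall>y. y \<^bold>\<in> b \<longleftrightarrow> (\<exists>x. x \<^bold>\<in> a \<and> y = pr x (g x)))"
    using * by (metis (no_types, lifting))
  then show ?thesis unfolding lam_def img_def by simp
qed

text \<open>By induction there is exactly one approximation with domain \<open>a\<close>, namely the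
  graph of \<open>rec G\<close> itself; so the description in the definition of \<open>rec\<close>
  denotes.\<close>

lemma rec:
  assumes G: "dF G" and "ordinal a"
  shows "rec G a = G (lam a (rec G))"
proof -
  note Gc = dF_comp[OF G]
  have ap: "ap (lam b (ap f)) c = ap f c" if "c \<^bold>\<in> b" for b f c
    using that by (intro ap_lam) (intro dfn)
  have rc: "ap (lam b (rec G)) c = rec G c" if "c \<^bold>\<in> b" for b c
    using that by (intro ap_lam) (intro dfn Gc)
  have key: "approx G (lam a (rec G)) a \<and> (\<forall>f. approx G f a \<longrightarrow> f = lam a (rec G))" (is "?P a")
    if "ordinal a" for a
  proof (rule ord_induct[OF _ _ that])
    show "dP ?P" unfolding approx_def by (intro dfn Gc)
    fix a assume a: "ordinal a" and IH: "\<And>b. b \<^bold>\<in> a \<Longrightarrow> ?P b"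
    have rec: "rec G b = G (lam b (rec G))" if "b \<^bold>\<in> a" for b
      unfolding rec_def[of G b] by (rule iota_iff) (use IH[OF that] in blast)
    have 1: "approx G (lam a (rec G)) a" unfolding approx_def
    proof (intro conjI allI impI)
      show "lam a (rec G) = lam a (ap (lam a (rec G)))" by (rule lam_cong) (simp add: rc)
      fix b assume b: "b \<^bold>\<in> a"
      have "lam b (ap (lam a (rec G))) = lam b (rec G)"
        by (rule lam_cong, rule rc) (rule ord_trans[OF a b])
      then show "ap (lam a (rec G)) b = G (lam b (ap (lam a (rec G))))"
        using b by (simp add: rc rec)
    qed
    have 2: "f = lam a (rec G)" if f: "approx G f a" for f
    proof -
      have "ap f b = rec G b" if b: "b \<^bold>\<in> a" for b
      proof -
        \<comment> \<open>An approximation restricts to an approximation with domain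
          \<open>b\<close>, where uniqueness is known by induction.\<close>
        have "approx G (lam b (ap f)) b" unfolding approx_def
        proof (intro conjI allI impI)
          show "lam b (ap f) = lam b (ap (lam b (ap f)))" by (rule lam_cong) (simp add: ap)
          fix c assume c: "c \<^bold>\<in> b"
          have "lam c (ap (lam b (ap f))) = lam c (ap f)"
            by (rule lam_cong, rule ap) (rule ord_trans[OF ord_mem[OF a b] c])
          then show "ap (lam b (ap f)) c = G (lam c (ap (lam b (ap f))))"
            using f c ord_trans[OF a b c] by (simp add: ap approx_def)
        qed
        then have "lam b (ap f) = lam b (rec G)" using IH[OF b] by blast
        then show ?thesis using f b rec[OF b] by (simp add: approx_def)
      qed
      then have "lam a (ap f) = lam a (rec G)" by (rule lam_cong)
      with f show ?thesis by (simp add: approx_def)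
    qed
    show "?P a" using 1 2 by blast
  qed
  show ?thesis
    unfolding rec_def[of G a] by (rule iota_iff) (use key[OF assms(2)] in blast)
qed

lemma recD: assumes "dF G" shows "dF (rec G)"
  by (intro dfn dF_comp[OF assms])

subsection \<open>Natural numbers\<close>

definition limit :: "'v \<Rightarrow> bool" where
  "limit a \<longleftrightarrow> ordinal a \<and> emp \<^bold>\<in> a \<and> (\<forall>b. b \<^bold>\<in> a \<longrightarrow> ins b b \<^bold>\<in> a)"

lemma limit_dfn [THEN defn_lift1, dfn]:
  "defn {} (\<lambda>e. limit (e 0))"
  unfolding limit_def by (intro dfn)

lemma ex_limit: "\<exists>a. limit a"
proof -
  obtain x where x: "emp \<^bold>\<in> x" "\<And>y. y \<^bold>\<in> x \<Longrightarrow> ins y y \<^bold>\<in> x"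
  proof -
    have "\<exists>x. (\<exists>e. e \<^bold>\<in> x \<and> (\<forall>z. \<not> z \<^bold>\<in> e)) \<and> (\<forall>y. y \<^bold>\<in> x \<longrightarrow> (\<exists>s. s \<^bold>\<in> x \<and> (\<forall>z. z \<^bold>\<in> s \<longleftrightarrow> z \<^bold>\<in> y \<or> z = y)))"
      using ZF unfolding ZF_def infinity_def by simp
    then obtain x where x: "\<exists>e. e \<^bold>\<in> x \<and> (\<forall>z. \<not> z \<^bold>\<in> e)"
      "\<And>y. y \<^bold>\<in> x \<Longrightarrow> \<exists>s. s \<^bold>\<in> x \<and> (\<forall>z. z \<^bold>\<in> s \<longleftrightarrow> z \<^bold>\<in> y \<or> z = y)" by blast
    have "emp \<^bold>\<in> x" using x(1) eq_emp by metis
    moreover have "ins y y \<^bold>\<in> x" if y: "y \<^bold>\<in> x" for y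
    proof -
      obtain s where s: "s \<^bold>\<in> x" "\<forall>z. z \<^bold>\<in> s \<longleftrightarrow> z \<^bold>\<in> y \<or> z = y" using x(2)[OF y] by blast
      have "s = ins y y" by (rule ext) (use s(2) in auto)
      with s(1) show ?thesis by simp
    qed
    ultimately show thesis by (rule that)
  qed
  \<comment> \<open>The inductive set \<open>x\<close> need not consist of ordinals; its ordinal
    elements that are also subsets of \<open>x\<close> form a limit ordinal.\<close>
  define a where "a = sep x (\<lambda>b. ordinal b \<and> b \<^bold>\<subseteq> x)"
  have a: "z \<^bold>\<in> a \<longleftrightarrow> z \<^bold>\<in> x \<and> ordinal z \<and> z \<^bold>\<subseteq> x" for z
    unfolding a_def by (rule mem_sep) (intro dfn)
  have "ordinal a"
  proof (rule ordI)
    show "transitive a" unfolding transitive_def subset_def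
      using a ord_mem ord_trans unfolding subset_def by blast
  qed (simp add: a)
  then have "limit a" unfolding limit_def using x by (auto simp: a subset_def)
  then show ?thesis by blast
qed

definition omega :: 'v where "omega = least limit"

lemma omega: "limit omega" "\<And>a. a \<^bold>\<in> omega \<Longrightarrow> \<not> limit a"
proof -
  obtain a where a: "limit a" using ex_limit by blast
  then have o: "ordinal a" by (simp add: limit_def)
  have d: "dP limit" by (intro dfn)
  show "limit omega" "\<And>a. a \<^bold>\<in> omega \<Longrightarrow> \<not> limit a" unfolding omega_def using least[OF d o a] by auto
qed

lemma ord_omega: "ordinal omega" and emp_omega: "emp \<^bold>\<in> omega" and succ_omega: "n \<^bold>\<in> omega \<Longrightarrow> ins n n \<^bold>\<in> omega"
  using omega(1) by (auto simp: limit_def)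

text \<open>Minimality of \<open>omega\<close>: a nonzero \<open>n\<close> below it is not a limit,
  so the successor of some element of \<open>n\<close> falls outside \<open>n\<close> and can only
  be \<open>n\<close> itself.\<close>

lemma omega_cases:
  assumes "n \<^bold>\<in> omega" "n \<noteq> emp" obtains m where "m \<^bold>\<in> omega" "n = ins m m"
proof -
  have n: "ordinal n" using ord_mem[OF ord_omega assms(1)] .
  have "\<not> emp = n" "\<not> n \<^bold>\<in> emp" using assms(2) by auto
  then have "emp \<^bold>\<in> n" using ord_linear[OF ord_emp n] by blast
  then obtain m where m: "m \<^bold>\<in> n" "\<not> ins m m \<^bold>\<in> n"
    using omega(2)[OF assms(1)] n unfolding limit_def by blast
  have om: "ordinal m" using ord_mem[OF n m(1)] .
  then have "n = ins m m" using m ord_linear[OF ord_succ[OF om] n] ord_trans[OF ord_succ[OF om]]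
    mem_irrefl mem_asym by (metis mem_ins)
  then show thesis using that ord_trans[OF ord_omega assms(1) m(1)] by blast
qed

lemma omega_induct:
  assumes "dP P" "P emp" "\<And>n. n \<^bold>\<in> omega \<Longrightarrow> P n \<Longrightarrow> P (ins n n)" "n \<^bold>\<in> omega"
  shows "P n"
proof -
  have "n \<^bold>\<in> omega \<longrightarrow> P n"
  proof (rule ord_induct[OF _ _ ord_mem[OF ord_omega assms(4)]])
    show "dP (\<lambda>n. n \<^bold>\<in> omega \<longrightarrow> P n)" by (intro dfn dP_comp[OF assms(1)])
    fix a assume a: "ordinal a" "\<And>b. b \<^bold>\<in> a \<Longrightarrow> b \<^bold>\<in> omega \<longrightarrow> P b"
    show "a \<^bold>\<in> omega \<longrightarrow> P a"
      using a(2) assms(2,3) omega_cases by (metis mem_ins)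
  qed
  then show ?thesis using assms(4) by blast
qed

lemma subset_omega: "k \<^bold>\<subseteq> omega \<Longrightarrow> n \<^bold>\<in> k \<Longrightarrow> n \<^bold>\<in> omega"
  unfolding subset_def by blast

subsection \<open>Epsilon induction and the cumulative hierarchy\<close>

text \<open>The union operation is iterated along \<open>omega\<close>, starting from
  \<open>x\<close>, and all stages are collected.\<close>

lemma ex_transitive: "\<exists>t. transitive t \<and> x \<^bold>\<subseteq> t"
proof -
  \<comment> \<open>The argument \<open>f\<close> is the set of pairs of earlier stages with their
    values, so \<open>sn\<close> runs through the values. The recursions for \<open>Vs\<close> and
    \<open>enum\<close> follow the same pattern.\<close>
  let ?G = "\<lambda>f. un x (UNI f (\<lambda>p. Uni (sn p)))"
  have dG: "dF ?G" by (intro dfn)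
  have T: "z \<^bold>\<in> rec ?G a \<longleftrightarrow> z \<^bold>\<in> x \<or> (\<exists>b. b \<^bold>\<in> a \<and> z \<^bold>\<in> Uni (rec ?G b))" if "ordinal a" for a z
  proof -
    have "dF (\<lambda>p. Uni (sn p))" by (intro dfn)
    note U = mem_UNI_lam[OF this recD[OF dG]]
    show ?thesis unfolding rec[OF dG that] mem_un U by simp
  qed
  have "transitive (rec ?G omega)" unfolding transitive_def subset_def
  proof (intro allI impI)
    fix y z assume y: "y \<^bold>\<in> rec ?G omega" and z: "z \<^bold>\<in> y"
    have "\<exists>n. n \<^bold>\<in> omega \<and> y \<^bold>\<in> rec ?G n"
    proof (cases "y \<^bold>\<in> x")
      case True
      then show ?thesis using emp_omega T[OF ord_emp] by blast
    next
      case False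
      then obtain n where n: "n \<^bold>\<in> omega" "y \<^bold>\<in> Uni (rec ?G n)" using y T[OF ord_omega] by blast
      have "y \<^bold>\<in> rec ?G (ins n n)" using T[of "ins n n" y] n ord_mem[OF ord_omega n(1)] by auto
      then show ?thesis using succ_omega[OF n(1)] by blast
    qed
    then show "z \<^bold>\<in> rec ?G omega" using z T[OF ord_omega] by auto
  qed
  moreover have "x \<^bold>\<subseteq> rec ?G omega" unfolding subset_def using T[OF ord_omega] by blast
  ultimately show ?thesis by blast
qed

text \<open>Foundation for a class: a counterexample lies in a transitive set, whose counterexamples
  form a set with a minimal element; by transitivity all elements of that one satisfy
  \<open>P\<close>.\<close>

lemma eps_induct:
  assumes "dP P" "\<And>x. (\<And>y. y \<^bold>\<in> x \<Longrightarrow> P y) \<Longrightarrow> P x" shows "P x"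
proof (rule ccontr)
  assume n: "\<not> P x"
  obtain t where t: "transitive t" "upr x x \<^bold>\<subseteq> t" using ex_transitive by blast
  have *: "z \<^bold>\<in> sep t (\<lambda>y. \<not> P y) \<longleftrightarrow> z \<^bold>\<in> t \<and> \<not> P z" for z
    by (rule mem_sep) (intro dfn assms(1))
  have "x \<^bold>\<in> sep t (\<lambda>y. \<not> P y)" using n t(2) by (simp add: * subset_def)
  from foundation_set[OF this] show False
    using assms(2) t(1) unfolding * transitive_def subset_def by blast
qed

text \<open>One clause, the union of the power sets of the earlier stages, covers zero, successors
  and limits.\<close>

definition Vs :: "'v \<Rightarrow> 'v" where
  "Vs a = rec (\<lambda>f. UNI f (\<lambda>p. Pw (sn p))) a"

lemma Vs_dfn [THEN dterm_lift1, dfn]: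
  "dterm {} (\<lambda>e. Vs (e 0))"
  unfolding Vs_def by (intro dfn)

lemma mem_Vs: "ordinal a \<Longrightarrow> z \<^bold>\<in> Vs a \<longleftrightarrow> (\<exists>b. b \<^bold>\<in> a \<and> z \<^bold>\<subseteq> Vs b)"
proof -
  assume a: "ordinal a"
  let ?h = "\<lambda>p. Pw (sn p)"
  let ?G = "\<lambda>f. UNI f ?h"
  have dG: "dF ?G" by (intro dfn)
  have "dF ?h" by (intro dfn)
  note U = mem_UNI_lam[OF this recD[OF dG]]
  show ?thesis unfolding Vs_def rec[OF dG a] U by simp
qed

lemma Vs_trans: "ordinal a \<Longrightarrow> transitive (Vs a)"
proof (rule ord_induct[where P = "\<lambda>a. transitive (Vs a)"])
  fix a assume a: "ordinal a" "\<And>b. b \<^bold>\<in> a \<Longrightarrow> transitive (Vs b)"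
  then show "transitive (Vs a)"
    unfolding transitive_def subset_def mem_Vs[OF a(1)] by blast
qed (intro dfn)

lemma Vs_mono: "ordinal a \<Longrightarrow> b \<^bold>\<in> a \<Longrightarrow> Vs b \<^bold>\<subseteq> Vs a"
  using Vs_trans[of b] ord_mem[of a b] unfolding transitive_def subset_def by (metis mem_Vs subset_def)

lemma ex_Vs: "\<exists>a. ordinal a \<and> x \<^bold>\<in> Vs a"
proof (rule eps_induct[where P = "\<lambda>x. \<exists>a. ordinal a \<and> x \<^bold>\<in> Vs a"])
  fix x assume *: "\<And>y. y \<^bold>\<in> x \<Longrightarrow> \<exists>a. ordinal a \<and> y \<^bold>\<in> Vs a"
  have r: "ordinal (least (\<lambda>a. y \<^bold>\<in> Vs a)) \<and> y \<^bold>\<in> Vs (least (\<lambda>a. y \<^bold>\<in> Vs a))" if y: "y \<^bold>\<in> x" for y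
  proof -
    obtain a where a: "ordinal a" "y \<^bold>\<in> Vs a" using *[OF y] by blast
    have "dP (\<lambda>a. y \<^bold>\<in> Vs a)" by (intro dfn)
    from least[OF this, OF a] show ?thesis by blast
  qed
  have "dF (\<lambda>y. least (\<lambda>a. y \<^bold>\<in> Vs a))" by (intro dfn)
  from ord_bound[OF this] r obtain b where b: "ordinal b" "\<And>y. y \<^bold>\<in> x \<Longrightarrow> least (\<lambda>a. y \<^bold>\<in> Vs a) \<^bold>\<in> b"
    by blast
  have "x \<^bold>\<subseteq> Vs b" unfolding subset_def using r b Vs_mono[OF b(1)] by (meson subset_def)
  then have "x \<^bold>\<in> Vs (ins b b)" using b(1) by (subst mem_Vs) auto
  then show "\<exists>a. ordinal a \<and> x \<^bold>\<in> Vs a" using b(1) by (meson ord_succ)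
qed (intro dfn)

text \<open>Scott's device: a witness cannot be chosen, but the least rank at which one appears is a
  definable function of \<open>x\<close>, and these ranks are bounded.\<close>

lemma collection:
  assumes "defn UNIV (\<lambda>e. R (e 0) (e 1))" "\<And>x. x \<^bold>\<in> a \<Longrightarrow> \<exists>y. R x y"
  shows "\<exists>b. ordinal b \<and> (\<forall>x. x \<^bold>\<in> a \<longrightarrow> (\<exists>y. y \<^bold>\<in> Vs b \<and> R x y))"
proof -
  note R = defn_comp2[OF assms(1) subset_UNIV]
  define f where "f x = least (\<lambda>b. \<exists>y. y \<^bold>\<in> Vs b \<and> R x y)" for x
  have f: "ordinal (f x) \<and> (\<exists>y. y \<^bold>\<in> Vs (f x) \<and> R x y)" if x: "x \<^bold>\<in> a" for x
  proof -
    obtain y b where a: "ordinal b" "\<exists>y. y \<^bold>\<in> Vs b \<and> R x y" using assms(2)[OF x] ex_Vs by blast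
    have "dP (\<lambda>b. \<exists>y. y \<^bold>\<in> Vs b \<and> R x y)" by (intro dfn R)
    from least[OF this, OF a] show ?thesis unfolding f_def by blast
  qed
  have "dF f" unfolding f_def by (intro dfn R)
  from ord_bound[OF this] f obtain b where b: "ordinal b" "\<And>x. x \<^bold>\<in> a \<Longrightarrow> f x \<^bold>\<in> b" by blast
  have "\<exists>y. y \<^bold>\<in> Vs b \<and> R x y" if "x \<^bold>\<in> a" for x
    using f[OF that] Vs_mono[OF b(1) b(2)[OF that]] unfolding subset_def by blast
  with b(1) show ?thesis by blast
qed

definition tcl :: "'v \<Rightarrow> 'v" where "tcl x = iota (\<lambda>t. is_transitive_closure t x)"

lemma tcl: "is_transitive_closure (tcl x) x"
proof -
  obtain t where t: "transitive t" "x \<^bold>\<subseteq> t" using ex_transitive by blast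
  \<comment> \<open>The transitive supersets of \<open>x\<close> form a proper class; their
    intersection is cut out of one of them.\<close>
  define u where "u = sep t (\<lambda>z. \<forall>s. x \<^bold>\<subseteq> s \<longrightarrow> transitive s \<longrightarrow> z \<^bold>\<in> s)"
  have *: "z \<^bold>\<in> u \<longleftrightarrow> z \<^bold>\<in> t \<and> (\<forall>s. x \<^bold>\<subseteq> s \<longrightarrow> transitive s \<longrightarrow> z \<^bold>\<in> s)" for z
    unfolding u_def by (rule mem_sep) (intro dfn)
  have **: "is_transitive_closure u x"
    unfolding is_transitive_closure_def
  proof (intro conjI allI impI)
    show "x \<^bold>\<subseteq> u" using t(2) unfolding subset_def * by blast
    show "transitive u" unfolding transitive_def subset_def
    proof (intro allI impI)
      fix y z assume y: "y \<^bold>\<in> u" and z: "z \<^bold>\<in> y"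
      have "z \<^bold>\<in> s" if "y \<^bold>\<in> s" "transitive s" for s
        using that z unfolding transitive_def subset_def by blast
      then show "z \<^bold>\<in> u" using y t(1) unfolding * by blast
    qed
    show "u \<^bold>\<subseteq> s" if "x \<^bold>\<subseteq> s" "transitive s" for s
      using that unfolding subset_def[of u] * by blast
  qed
  have "t' = u" if "is_transitive_closure t' x" for t'
    by (rule sub_antisym) (use that ** in \<open>unfold is_transitive_closure_def, blast\<close>)+
  with ** show ?thesis unfolding tcl_def by (metis iotaI)
qed

lemma is_transitive_closure_iff: "is_transitive_closure t x \<longleftrightarrow> t = tcl x"
proof
  assume "is_transitive_closure t x"
  then show "t = tcl x"
    by (intro sub_antisym) (use tcl[of x] in \<open>unfold is_transitive_closure_def, blast\<close>)+
qed (simp add: tcl)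

lemma tcl_dfn [THEN dterm_lift1, dfn]:
  "dterm {} (\<lambda>e. tcl (e 0))"
  unfolding tcl_def is_transitive_closure_def by (intro dfn)

section \<open>Enumerations by ordinals\<close>

lemma iota_cases: "P (iota P) \<or> iota P = emp"
  unfolding iota_def by (cases "\<exists>!y. P y") (simp_all only: if_True if_False theI' simp_thms)

lemma ord_least [simp]: "ordinal (least P)"
  unfolding least_def
  by (rule disjE[OF iota_cases[of "\<lambda>a. ordinal a \<and> P a \<and> (\<forall>b. b \<^bold>\<in> a \<longrightarrow> \<not> P b)"]])
    (elim conjE, assumption, simp only: ord_emp)

lemma img_lam_sn: assumes "dF f" shows "img (lam a f) sn = img a f"
proof (rule ext)
  have d: "dF sn" by (intro dfn)
  show "z \<^bold>\<in> img (lam a f) sn \<longleftrightarrow> z \<^bold>\<in> img a f" for z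
    unfolding mem_img[OF d] mem_img[OF assms] mem_lam[OF assms] by (metis sn_pr)
qed

lemma img_lam_fs: assumes "dF f" shows "img (lam a f) fs = a"
proof (rule ext)
  have d: "dF fs" by (intro dfn)
  show "z \<^bold>\<in> img (lam a f) fs \<longleftrightarrow> z \<^bold>\<in> a" for z
    unfolding mem_img[OF d] mem_lam[OF assms] by (metis fs_pr)
qed

section \<open>Exhausting a class by a selection function\<close>

definition enum :: "('v \<Rightarrow> 'v) \<Rightarrow> 'v \<Rightarrow> 'v" where
  "enum s a = rec (\<lambda>f. s (img f sn)) a"

definition idx :: "('v \<Rightarrow> 'v) \<Rightarrow> 'v \<Rightarrow> 'v" where
  "idx s x = least (\<lambda>a. enum s a = x)"

lemma enum_dfn [dfn]:
  assumes "dterm A (\<lambda>e. s (e 0) (\<lambda>n. e (Suc n)))" "dterm A a"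
  shows "dterm A (\<lambda>e. enum (\<lambda>x. s x e) (a e))"
  unfolding enum_def by (intro dfn dterm_shift[OF assms(1)] assms)

lemma idx_dfn [dfn]:
  assumes "dterm A (\<lambda>e. s (e 0) (\<lambda>n. e (Suc n)))" "dterm A a"
  shows "dterm A (\<lambda>e. idx (\<lambda>x. s x e) (a e))"
  unfolding idx_def by (intro dfn dterm_shift[OF assms(1)] dterm_rename[OF assms(2)])

lemma ord_idx [simp]: "ordinal (idx s x)"
  by (simp add: idx_def)

lemma enum_eq:
  assumes "dF s" "ordinal a" shows "enum s a = s (img a (enum s))"
proof -
  have d: "dF (\<lambda>f. s (img f sn))" by (intro dfn dF_comp[OF assms(1)])
  have de: "dF (enum s)" unfolding enum_def by (rule recD[OF d])
  have "img (lam a (enum s)) sn = img a (enum s)" by (rule img_lam_sn[OF de])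
  then show ?thesis using rec[OF d assms(2)] unfolding enum_def by simp
qed

text \<open>The selection function \<open>s\<close> picks an element of the class \<open>X\<close> outside any given set that does
  not exhaust \<open>X\<close>. The hypothesis on \<open>B\<close> replaces the requirement that \<open>X\<close> be a set.\<close>

lemma enum_idx:
  assumes s: "dF s" and sel: "\<And>S. (\<exists>x. X x \<and> \<not> x \<^bold>\<in> S) \<Longrightarrow> X (s S) \<and> \<not> s S \<^bold>\<in> S"
    and bnd: "X x \<Longrightarrow> \<exists>B. \<forall>S. \<not> x \<^bold>\<in> S \<longrightarrow> s S \<^bold>\<in> B" and x: "X x"
  shows "enum s (idx s x) = x"
proof -
  have de: "dF (enum s)" by (intro dfn dF_comp[OF s])
  have dx: "dP (\<lambda>a. enum s a = x)" for x by (intro dfn dF_comp[OF s])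
  have "\<exists>a. ordinal a \<and> enum s a = x"
  proof (rule ccontr)
    assume n: "\<not> ?thesis"
    then have live: "\<not> x \<^bold>\<in> img a (enum s)" if "ordinal a" for a
      using that ord_mem by (auto simp: mem_img[OF de])
    obtain B where B: "\<And>S. \<not> x \<^bold>\<in> S \<Longrightarrow> s S \<^bold>\<in> B" using bnd[OF x] by blast
    have inB: "enum s a \<^bold>\<in> B" if "ordinal a" for a
      using B live[OF that] enum_eq[OF s that] by simp
    have inj: "enum s b \<noteq> enum s a" if "ordinal a" "b \<^bold>\<in> a" for a b
    proof -
      have "\<not> enum s a \<^bold>\<in> img a (enum s)"
        using sel live[OF that(1)] x enum_eq[OF s that(1)] by auto
      then show ?thesis using that(2) by (auto simp: mem_img[OF de])
    qed
    have "dF (idx s)" by (intro dfn dF_comp[OF s])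
    \<comment> \<open>If \<open>x\<close> were never reached, \<open>enum s\<close> would inject all
      ordinals into the set \<open>B\<close>. The indices of elements of \<open>B\<close> are below
      some \<open>c\<close>, yet the value at \<open>c\<close> lies in \<open>B\<close> and has
      index \<open>c\<close>.\<close>
    from ord_bound[OF this, of B] obtain c where c: "ordinal c" "\<And>y. y \<^bold>\<in> B \<Longrightarrow> idx s y \<^bold>\<in> c" by auto
    have "idx s (enum s c) = c"
      unfolding idx_def by (rule least_eq) (use inj c(1) in auto)
    with c inB[OF c(1)] show False using mem_irrefl by metis
  qed
  then show ?thesis using least(2)[OF dx] unfolding idx_def by blast
qed

text \<open>For a set \<open>A\<close> the enumeration is cut off at the least stage
  \<open>t\<close> whose earlier values exhaust \<open>A\<close>; below \<open>t\<close> each value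
  is new because \<open>s\<close> avoids the previous ones.\<close>

lemma enum_set:
  assumes s: "dF s" and sel: "\<And>S. (\<exists>x. x \<^bold>\<in> A \<and> \<not> x \<^bold>\<in> S) \<Longrightarrow> s S \<^bold>\<in> A \<and> \<not> s S \<^bold>\<in> S"
  shows "\<exists>t. ordinal t \<and> (\<forall>a. a \<^bold>\<in> t \<longrightarrow> enum s a \<^bold>\<in> A \<and> (\<forall>b. b \<^bold>\<in> a \<longrightarrow> enum s b \<noteq> enum s a) \<and>
           (\<exists>x. x \<^bold>\<in> A \<and> \<not> x \<^bold>\<in> img a (enum s)))
         \<and> (\<forall>x. x \<^bold>\<in> A \<longrightarrow> idx s x \<^bold>\<in> t \<and> enum s (idx s x) = x)"
proof -
  have de: "dF (enum s)" by (intro dfn dF_comp[OF s])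
  have ei: "enum s (idx s x) = x" if x: "x \<^bold>\<in> A" for x
    by (rule enum_idx[OF s, of "\<lambda>x. x \<^bold>\<in> A"]) (use sel x in blast)+
  let ?dead = "\<lambda>a. \<forall>x. x \<^bold>\<in> A \<longrightarrow> x \<^bold>\<in> img a (enum s)"
  have dd: "dP ?dead" by (intro dfn dF_comp[OF s])
  have "dF (idx s)" by (intro dfn dF_comp[OF s])
  from ord_bound[OF this, of A] obtain c where c: "ordinal c" "\<And>y. y \<^bold>\<in> A \<Longrightarrow> idx s y \<^bold>\<in> c" by auto
  then have "?dead c" using ei by (auto simp: mem_img[OF de]) metis
  note t = least[OF dd c(1) this]
  have 1: "enum s a \<^bold>\<in> A \<and> (\<forall>b. b \<^bold>\<in> a \<longrightarrow> enum s b \<noteq> enum s a) \<and> (\<exists>x. x \<^bold>\<in> A \<and> \<not> x \<^bold>\<in> img a (enum s))"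
    if a: "a \<^bold>\<in> least ?dead" for a
  proof -
    have oa: "ordinal a" using ord_mem[OF t(1) a] .
    have "\<exists>x. x \<^bold>\<in> A \<and> \<not> x \<^bold>\<in> img a (enum s)" using t(3)[OF a] by blast
    with sel[OF this] enum_eq[OF s oa] show ?thesis by (auto simp: mem_img[OF de])
  qed
  have 2: "idx s x \<^bold>\<in> least ?dead" if x: "x \<^bold>\<in> A" for x
  proof -
    obtain a where a: "a \<^bold>\<in> least ?dead" "enum s a = x" using t(2) x by (auto simp: mem_img[OF de])
    have "idx s x = a" unfolding idx_def
      by (rule least_eq) (use a 1[OF a(1)] ord_mem[OF t(1) a(1)] in auto)
    with a show ?thesis by simp
  qed
  show ?thesis using 1 2 ei t(1) by blast
qed

subsection \<open>Pairs of ordinals\<close>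

definition prod :: "'v \<Rightarrow> 'v \<Rightarrow> 'v" where "prod a b = UNI a (\<lambda>x. img b (\<lambda>y. pr x y))"

lemma prod_dfn [THEN dterm_lift2, dfn]:
  "dterm {} (\<lambda>e. prod (e 0) (e 1))"
  unfolding prod_def by (intro dfn)

lemma mem_prod: "p \<^bold>\<in> prod a b \<longleftrightarrow> (\<exists>x y. x \<^bold>\<in> a \<and> y \<^bold>\<in> b \<and> p = pr x y)"
proof -
  have 1: "dF (\<lambda>y. pr x y)" for x by (intro dfn)
  have 2: "dF (\<lambda>x. img b (\<lambda>y. pr x y))" by (intro dfn)
  show ?thesis unfolding prod_def mem_UNI[OF 2] mem_img[OF 1] by blast
qed

text \<open>Goedel's canonical order of pairs without an explicit order relation: among the pairs
  outside \<open>S\<close> take the least maximum, then the least first and the least second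
  coordinate.\<close>

definition next1 :: "'v \<Rightarrow> 'v" where
  "next1 S = least (\<lambda>m. \<exists>b c. b \<^bold>\<in> ins m m \<and> c \<^bold>\<in> ins m m \<and> \<not> pr b c \<^bold>\<in> S)"
definition next2 :: "'v \<Rightarrow> 'v" where
  "next2 S = least (\<lambda>b. b \<^bold>\<in> ins (next1 S) (next1 S) \<and> (\<exists>c. c \<^bold>\<in> ins (next1 S) (next1 S) \<and> \<not> pr b c \<^bold>\<in> S))"
definition next3 :: "'v \<Rightarrow> 'v" where
  "next3 S = least (\<lambda>c. c \<^bold>\<in> ins (next1 S) (next1 S) \<and> \<not> pr (next2 S) c \<^bold>\<in> S)"
definition next_pair :: "'v \<Rightarrow> 'v" where "next_pair S = pr (next2 S) (next3 S)"

lemma next1_dfn [THEN dterm_lift1, dfn]: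
  "dterm {} (\<lambda>e. next1 (e 0))"
  unfolding next1_def by (intro dfn)
lemma next2_dfn [THEN dterm_lift1, dfn]:
  "dterm {} (\<lambda>e. next2 (e 0))"
  unfolding next2_def by (intro dfn)
lemma next3_dfn [THEN dterm_lift1, dfn]:
  "dterm {} (\<lambda>e. next3 (e 0))"
  unfolding next3_def by (intro dfn)
lemma next_pair_dfn [THEN dterm_lift1, dfn]:
  "dterm {} (\<lambda>e. next_pair (e 0))"
  unfolding next_pair_def by (intro dfn)

text \<open>While the pair of \<open>b\<close> and \<open>c\<close> is missing from
  \<open>S\<close>, the selected pair has coordinates at most the larger of the two. This is the set
  bound that \<open>enum_idx\<close> demands, the pairs of ordinals being a proper class.\<close>

lemma next_pair:
  assumes "ordinal b" "ordinal c" "\<not> pr b c \<^bold>\<in> S"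
  shows "\<not> next_pair S \<^bold>\<in> S" "next2 S \<^bold>\<in> ins (un b c) (un b c)" "next3 S \<^bold>\<in> ins (un b c) (un b c)"
proof -
  let ?m = "un b c"
  have m: "ordinal ?m" by (rule ord_un[OF assms(1,2)])
  have "b \<^bold>\<subseteq> ?m" "c \<^bold>\<subseteq> ?m" by (auto simp: subset_def)
  then have bm: "b \<^bold>\<in> ins ?m ?m" "c \<^bold>\<in> ins ?m ?m" using ord_subset m assms(1,2) by auto
  let ?P = "\<lambda>m. \<exists>b c. b \<^bold>\<in> ins m m \<and> c \<^bold>\<in> ins m m \<and> \<not> pr b c \<^bold>\<in> S"
  have d1: "dP ?P" by (intro dfn)
  have "?P ?m" using bm assms(3) by blast
  note n1 = least[where P = ?P, OF d1 m this, folded next1_def]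
  let ?P2 = "\<lambda>b. b \<^bold>\<in> ins (next1 S) (next1 S) \<and> (\<exists>c. c \<^bold>\<in> ins (next1 S) (next1 S) \<and> \<not> pr b c \<^bold>\<in> S)"
  have d2: "dP ?P2" by (intro dfn)
  obtain b' where b': "b' \<^bold>\<in> ins (next1 S) (next1 S)"
    "\<exists>c. c \<^bold>\<in> ins (next1 S) (next1 S) \<and> \<not> pr b' c \<^bold>\<in> S" using n1(2) by blast
  have "ordinal b'" using ord_mem[OF ord_succ[OF n1(1)] b'(1)] .
  note n2 = least[where P = ?P2, OF d2 this, folded next2_def, OF conjI[OF b']]
  let ?P3 = "\<lambda>c. c \<^bold>\<in> ins (next1 S) (next1 S) \<and> \<not> pr (next2 S) c \<^bold>\<in> S"
  have d3: "dP ?P3" by (intro dfn)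
  obtain c' where c': "c' \<^bold>\<in> ins (next1 S) (next1 S) \<and> \<not> pr (next2 S) c' \<^bold>\<in> S" using n2(2) by blast
  then have "ordinal c'" using ord_mem[OF ord_succ[OF n1(1)]] by blast
  note n3 = least[where P = ?P3, OF d3 this c', folded next3_def]
  show "\<not> next_pair S \<^bold>\<in> S" using n3(2) unfolding next_pair_def by blast
  have *: "z \<^bold>\<in> ins ?m ?m" if "z \<^bold>\<in> ins (next1 S) (next1 S)" for z
    using that n1(4) ord_trans[OF m] by auto
  show "next2 S \<^bold>\<in> ins ?m ?m" "next3 S \<^bold>\<in> ins ?m ?m" using * n2(2) n3(2) by blast+
qed

definition unpair :: "'v \<Rightarrow> 'v" where "unpair a = enum next_pair a"
definition cod :: "'v \<Rightarrow> 'v \<Rightarrow> 'v" where "cod b c = idx next_pair (pr b c)"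

lemma unpair_dfn [THEN dterm_lift1, dfn]:
  "dterm {} (\<lambda>e. unpair (e 0))"
  unfolding unpair_def by (intro dfn)
lemma cod_dfn [THEN dterm_lift2, dfn]:
  "dterm {} (\<lambda>e. cod (e 0) (e 1))"
  unfolding cod_def by (intro dfn)

lemma ord_cod [simp]: "ordinal (cod b c)"
  by (simp add: cod_def)

lemma unpair_cod [simp]:
  assumes "ordinal b" "ordinal c" shows "unpair (cod b c) = pr b c"
  unfolding unpair_def cod_def
proof (rule enum_idx[where X = "\<lambda>p. \<exists>b c. ordinal b \<and> ordinal c \<and> p = pr b c"])
  show "dF next_pair" by (intro dfn)
  fix S assume "\<exists>x. (\<exists>b c. ordinal b \<and> ordinal c \<and> x = pr b c) \<and> \<not> x \<^bold>\<in> S"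
  then obtain b c where "ordinal b" "ordinal c" "\<not> pr b c \<^bold>\<in> S" by blast
  from next_pair(1)[OF this]
  show "(\<exists>b c. ordinal b \<and> ordinal c \<and> next_pair S = pr b c) \<and> \<not> next_pair S \<^bold>\<in> S"
    unfolding next_pair_def next2_def next3_def by auto
next
  show "\<exists>B. \<forall>S. \<not> pr b c \<^bold>\<in> S \<longrightarrow> next_pair S \<^bold>\<in> B"
    by (rule exI[of _ "prod (ins (un b c) (un b c)) (ins (un b c) (un b c))"])
      (use next_pair(2,3)[OF assms] in \<open>auto simp: mem_prod next_pair_def simp del: mem_ins\<close>)
qed (use assms in auto)

lemma cod_inject: "ordinal a \<Longrightarrow> ordinal b \<Longrightarrow> ordinal c \<Longrightarrow> ordinal d \<Longrightarrow> cod a b = cod c d \<longleftrightarrow> a = c \<and> b = d"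
  using unpair_cod by (metis pr_inject)

section \<open>An enumeration of the sets definable from a set and ordinals\<close>

primrec num :: "nat \<Rightarrow> 'v" where
  "num 0 = emp"
| "num (Suc n) = ins (num n) (num n)"

lemma num_dfn [dfn]: "dterm A (\<lambda>e. num n)"
  by (induction n) (simp_all add: emp_dfn ins_dfn)

lemma ord_num [simp]: "ordinal (num n)"
  by (induction n) simp_all

lemma num_less: "m < n \<Longrightarrow> num m \<^bold>\<in> num n"
  by (induction n) (auto simp: less_Suc_eq)

lemma num_inject [simp]: "num m = num n \<longleftrightarrow> m = n"
  using num_less mem_irrefl by (metis nat_neq_iff)

section \<open>Goedel operations on relations coded as sets of nested pairs\<close>

definition diff :: "'v \<Rightarrow> 'v \<Rightarrow> 'v" where "diff x y = sep x (\<lambda>z. \<not> z \<^bold>\<in> y)"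
definition sec :: "'v \<Rightarrow> 'v \<Rightarrow> 'v" where "sec x y = img (sep x (\<lambda>p. sn p = y)) fs"
text \<open>A dummy coordinate in the second place, which keeps the first one in front: it turns a
  comparison of neighbouring coordinates into one of coordinates further apart.\<close>

definition ins2 :: "'v \<Rightarrow> 'v \<Rightarrow> 'v" where
  "ins2 x y = UNI x (\<lambda>b. img y (\<lambda>p. pr (fs p) (pr b (sn p))))"
text \<open>An atomic relation between the two front coordinates, the tail ranging over
  \<open>y\<close>. Having the converse \<open>op_ni\<close> as well replaces an operation that
  permutes coordinates.\<close>

definition op_mem :: "'v \<Rightarrow> 'v \<Rightarrow> 'v" where
  "op_mem x y = sep (prod x (prod x y)) (\<lambda>p. fs p \<^bold>\<in> fs (sn p))"
definition op_ni :: "'v \<Rightarrow> 'v \<Rightarrow> 'v" where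
  "op_ni x y = sep (prod x (prod x y)) (\<lambda>p. fs (sn p) \<^bold>\<in> fs p)"
definition op_eq :: "'v \<Rightarrow> 'v \<Rightarrow> 'v" where
  "op_eq x y = sep (prod x (prod x y)) (\<lambda>p. fs p = fs (sn p))"

lemma diff_dfn [THEN dterm_lift2, dfn]:
  "dterm {} (\<lambda>e. diff (e 0) (e 1))"
  unfolding diff_def by (intro dfn)
lemma sec_dfn [THEN dterm_lift2, dfn]:
  "dterm {} (\<lambda>e. sec (e 0) (e 1))"
  unfolding sec_def by (intro dfn)
lemma ins2_dfn [THEN dterm_lift2, dfn]:
  "dterm {} (\<lambda>e. ins2 (e 0) (e 1))"
  unfolding ins2_def by (intro dfn)
lemma op_mem_dfn [THEN dterm_lift2, dfn]:
  "dterm {} (\<lambda>e. op_mem (e 0) (e 1))"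
  unfolding op_mem_def by (intro dfn)
lemma op_ni_dfn [THEN dterm_lift2, dfn]:
  "dterm {} (\<lambda>e. op_ni (e 0) (e 1))"
  unfolding op_ni_def by (intro dfn)
lemma op_eq_dfn [THEN dterm_lift2, dfn]:
  "dterm {} (\<lambda>e. op_eq (e 0) (e 1))"
  unfolding op_eq_def by (intro dfn)

lemma mem_diff: "z \<^bold>\<in> diff x y \<longleftrightarrow> z \<^bold>\<in> x \<and> \<not> z \<^bold>\<in> y"
  unfolding diff_def by (rule mem_sep) (intro dfn)

lemma mem_ins2: "z \<^bold>\<in> ins2 x y \<longleftrightarrow> (\<exists>b p. b \<^bold>\<in> x \<and> p \<^bold>\<in> y \<and> z = pr (fs p) (pr b (sn p)))"
proof -
  have 1: "dF (\<lambda>p. pr (fs p) (pr b (sn p)))" for b by (intro dfn)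
  have 2: "dF (\<lambda>b. img y (\<lambda>p. pr (fs p) (pr b (sn p))))" by (intro dfn)
  show ?thesis unfolding ins2_def mem_UNI[OF 2] mem_img[OF 1] by blast
qed

lemma mem_sec: "z \<^bold>\<in> sec x y \<longleftrightarrow> (\<exists>p. p \<^bold>\<in> x \<and> sn p = y \<and> z = fs p)"
proof -
  have 1: "dF fs" by (intro dfn)
  have 2: "dP (\<lambda>p. sn p = y)" by (intro dfn)
  show ?thesis unfolding sec_def mem_img[OF 1] mem_sep[OF 2] by blast
qed

lemma mem_ops:
  "z \<^bold>\<in> op_mem x y \<longleftrightarrow> (\<exists>a b t. a \<^bold>\<in> x \<and> b \<^bold>\<in> x \<and> t \<^bold>\<in> y \<and> a \<^bold>\<in> b \<and> z = pr a (pr b t))"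
  "z \<^bold>\<in> op_ni x y \<longleftrightarrow> (\<exists>a b t. a \<^bold>\<in> x \<and> b \<^bold>\<in> x \<and> t \<^bold>\<in> y \<and> b \<^bold>\<in> a \<and> z = pr a (pr b t))"
  "z \<^bold>\<in> op_eq x y \<longleftrightarrow> (\<exists>a b t. a \<^bold>\<in> x \<and> b \<^bold>\<in> x \<and> t \<^bold>\<in> y \<and> a = b \<and> z = pr a (pr b t))"
proof -
  have 1: "dP (\<lambda>p. fs p \<^bold>\<in> fs (sn p))" by (intro dfn)
  have 2: "dP (\<lambda>p. fs (sn p) \<^bold>\<in> fs p)" by (intro dfn)
  have 3: "dP (\<lambda>p. fs p = fs (sn p))" by (intro dfn)
  show "z \<^bold>\<in> op_mem x y \<longleftrightarrow> (\<exists>a b t. a \<^bold>\<in> x \<and> b \<^bold>\<in> x \<and> t \<^bold>\<in> y \<and> a \<^bold>\<in> b \<and> z = pr a (pr b t))"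
    unfolding op_mem_def mem_sep[OF 1] mem_prod by fastforce
  show "z \<^bold>\<in> op_ni x y \<longleftrightarrow> (\<exists>a b t. a \<^bold>\<in> x \<and> b \<^bold>\<in> x \<and> t \<^bold>\<in> y \<and> b \<^bold>\<in> a \<and> z = pr a (pr b t))"
    unfolding op_ni_def mem_sep[OF 2] mem_prod by fastforce
  show "z \<^bold>\<in> op_eq x y \<longleftrightarrow> (\<exists>a b t. a \<^bold>\<in> x \<and> b \<^bold>\<in> x \<and> t \<^bold>\<in> y \<and> a = b \<and> z = pr a (pr b t))"
    unfolding op_eq_def mem_sep[OF 3] mem_prod by fastforce
qed

text \<open>The numbers 0, 1, 2 give the generators, which alone use \<open>b\<close>; the others
  are the operations, equality being the default case that 13 selects.\<close>

definition oper :: "'v \<Rightarrow> 'v \<Rightarrow> 'v \<Rightarrow> 'v \<Rightarrow> 'v \<Rightarrow> 'v" where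
  "oper U k x y b =
    (if k = num 0 then b else if k = num 1 then Vs b else if k = num 2 then U
     else if k = num 3 then pr x y else if k = num 4 then Uni x else if k = num 5 then ins x y
     else if k = num 6 then prod x y else if k = num 7 then diff x y else if k = num 8 then img x sn
     else if k = num 9 then sec x y else if k = num 10 then ins2 x y
     else if k = num 11 then op_mem x y else if k = num 12 then op_ni x y else op_eq x y)"

lemma oper_dfn [dfn]:
  assumes "dterm A U" "dterm A k" "dterm A x" "dterm A y" "dterm A b"
  shows "dterm A (\<lambda>e. oper (U e) (k e) (x e) (y e) (b e))"
  unfolding oper_def by (intro dfn assms)

definition code_op :: "'v \<Rightarrow> 'v" where "code_op a = fs (unpair (fs (unpair a)))"
definition code_left :: "'v \<Rightarrow> 'v" where "code_left a = fs (unpair (sn (unpair a)))"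
definition code_right :: "'v \<Rightarrow> 'v" where "code_right a = sn (unpair (sn (unpair a)))"

lemma code_op_dfn [THEN dterm_lift1, dfn]:
  "dterm {} (\<lambda>e. code_op (e 0))"
  unfolding code_op_def by (intro dfn)
lemma code_left_dfn [THEN dterm_lift1, dfn]:
  "dterm {} (\<lambda>e. code_left (e 0))"
  unfolding code_left_def by (intro dfn)
lemma code_right_dfn [THEN dterm_lift1, dfn]:
  "dterm {} (\<lambda>e. code_right (e 0))"
  unfolding code_right_def by (intro dfn)

text \<open>At stage \<open>a\<close> the recursion applies the operation with number \<open>code_op a\<close> to the values at \<open>code_left a\<close>
  and \<open>code_right a\<close>; \<open>img f fs\<close> recovers \<open>a\<close> as the domain of \<open>f\<close>.\<close>

definition od_enum :: "'v \<Rightarrow> 'v \<Rightarrow> 'v" where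
  "od_enum U a = rec (\<lambda>f. oper U (code_op (img f fs)) (ap f (code_left (img f fs))) (ap f (code_right (img f fs))) (code_left (img f fs))) a"

lemma od_enum_dfn [THEN dterm_lift2, dfn]:
  "dterm {} (\<lambda>e. od_enum (e 0) (e 1))"
  unfolding od_enum_def by (intro dfn)

text \<open>Stage \<open>a\<close> sees only values at smaller stages, so a code must exceed both
  \<open>b\<close> and \<open>c\<close>. As \<open>cod\<close> is not shown to be increasing, the
  code carries a dummy ordinal \<open>z\<close> that can be chosen to make it large.\<close>

lemma od_enum_oper:
  assumes o: "ordinal k" "ordinal b" "ordinal c"
  shows "\<exists>a. ordinal a \<and> od_enum U a = oper U k (od_enum U b) (od_enum U c) b"
proof -
  let ?a = "\<lambda>z. cod (cod k z) (cod b c)"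
  let ?m = "ins (un b c) (un b c)"
  have m: "ordinal ?m" by (rule ord_succ[OF ord_un[OF o(2,3)]])
  have "\<exists>z. ordinal z \<and> \<not> ?a z \<^bold>\<in> ?m"
  proof (rule ccontr)
    assume n: "\<not> ?thesis"
    \<comment> \<open>The dummy can be read off the code, so if all these codes lay in the set
      \<open>?m\<close>, the ordinals would be contained in a set.\<close>
    have d: "dF (\<lambda>a. sn (unpair (fs (unpair a))))" by (intro dfn)
    have "z \<^bold>\<in> img ?m (\<lambda>a. sn (unpair (fs (unpair a))))" if z: "ordinal z" for z
      unfolding mem_img[OF d] by (rule exI[of _ "?a z"]) (use n z o in simp)
    then show False using no_ord_set by blast
  qed
  then obtain z where z: "ordinal z" "\<not> ?a z \<^bold>\<in> ?m" by blast
  let ?c = "?a z"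
  have "b \<^bold>\<subseteq> un b c" "c \<^bold>\<subseteq> un b c" by (auto simp: subset_def)
  then have "b \<^bold>\<in> ?m" "c \<^bold>\<in> ?m" using ord_subset ord_un o by auto
  moreover have "?m \<^bold>\<in> ?c \<or> ?m = ?c" using ord_linear[OF m ord_cod] z(2) by blast
  ultimately have bc: "b \<^bold>\<in> ?c" "c \<^bold>\<in> ?c" using ord_trans[OF ord_cod] by metis+
  let ?G = "\<lambda>f. oper U (code_op (img f fs)) (ap f (code_left (img f fs))) (ap f (code_right (img f fs))) (code_left (img f fs))"
  have dG: "dF ?G" by (intro dfn)
  have do: "dF (od_enum U)" by (intro dfn)
  have dm: "img (lam ?c (od_enum U)) fs = ?c" by (rule img_lam_fs[OF do])
  have dec: "code_op ?c = k" "code_left ?c = b" "code_right ?c = c"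
    using o z(1) by (simp_all add: code_op_def code_left_def code_right_def)
  have "od_enum U ?c = ?G (lam ?c (od_enum U))"
    using rec[OF dG ord_cod[of "cod k z" "cod b c"]] unfolding od_enum_def .
  also have "\<dots> = oper U k (od_enum U b) (od_enum U c) b"
    unfolding dm dec by (simp add: ap_lam[OF do] bc)
  finally show ?thesis using ord_cod by blast
qed

definition od :: "'v \<Rightarrow> 'v \<Rightarrow> bool" where "od U x \<longleftrightarrow> (\<exists>a. ordinal a \<and> od_enum U a = x)"

lemma od_dfn [THEN defn_lift2, dfn]:
  "defn {} (\<lambda>e. od (e 0) (e 1))"
  unfolding od_def by (intro dfn)

lemma od_oper: "ordinal k \<Longrightarrow> ordinal b \<Longrightarrow> ordinal c \<Longrightarrow> od U (oper U k (od_enum U b) (od_enum U c) b)"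
  unfolding od_def using od_enum_oper by blast

lemma od_basic:
  assumes "ordinal b" shows "od U b" "od U (Vs b)" "od U U"
  using od_oper[of "num 0" b b U] od_oper[of "num 1" b b U] od_oper[of "num 2" b b U] assms
  by (simp_all add: oper_def del: num.simps)

lemma od_oper': "od U x \<Longrightarrow> od U y \<Longrightarrow> ordinal k \<Longrightarrow> \<exists>b. od U (oper U k x y b)"
  unfolding od_def[of U x] od_def[of U y] using od_oper by blast

lemma od_ops:
  assumes "od U x" "od U y"
  shows "od U (pr x y)" "od U (Uni x)" "od U (ins x y)" "od U (prod x y)" "od U (diff x y)"
    "od U (img x sn)" "od U (sec x y)" "od U (ins2 x y)" "od U (op_mem x y)" "od U (op_ni x y)"
    "od U (op_eq x y)"
  using od_oper'[OF assms ord_num[of 3]] od_oper'[OF assms ord_num[of 4]] od_oper'[OF assms ord_num[of 5]]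
    od_oper'[OF assms ord_num[of 6]] od_oper'[OF assms ord_num[of 7]] od_oper'[OF assms ord_num[of 8]]
    od_oper'[OF assms ord_num[of 9]] od_oper'[OF assms ord_num[of 10]] od_oper'[OF assms ord_num[of 11]]
    od_oper'[OF assms ord_num[of 12]] od_oper'[OF assms ord_num[of 13]]
  unfolding oper_def num_inject by simp_all

lemma od_dterm: "od U x \<Longrightarrow> dterm (insert U {a. ordinal a}) (\<lambda>e. x)"
proof -
  assume "od U x"
  then obtain a where a: "ordinal a" "x = od_enum U a" unfolding od_def by blast
  show ?thesis unfolding a(2) by (intro od_enum_dfn dterm_const) (use a(1) in auto)
qed

subsection \<open>Definable relations over a set\<close>

text \<open>Nested to the right and closed by \<open>emp\<close>, so that \<open>fs\<close> and
  \<open>sn\<close> are head and tail at every positive length.\<close>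

primrec tup :: "'v list \<Rightarrow> 'v" where
  "tup [] = emp"
| "tup (x # xs) = pr x (tup xs)"

lemma tup_inject: "length xs = length ys \<Longrightarrow> tup xs = tup ys \<longleftrightarrow> xs = ys"
proof (induction xs arbitrary: ys)
  case (Cons x xs)
  then show ?case by (cases ys) auto
qed simp

text \<open>The arity is a natural number of the metatheory, and \<open>Q\<close> lives outside the
  model; \<open>S\<close> is its extension over \<open>A\<close>.\<close>

definition represents :: "'v \<Rightarrow> nat \<Rightarrow> ('v list \<Rightarrow> bool) \<Rightarrow> 'v \<Rightarrow> bool" where
  "represents A n Q S \<longleftrightarrow> (\<forall>z. z \<^bold>\<in> S \<longleftrightarrow> (\<exists>xs. length xs = n \<and> (\<forall>x\<in>set xs. x \<^bold>\<in> A) \<and> Q xs \<and> z = tup xs))"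

definition od_rel :: "'v \<Rightarrow> 'v \<Rightarrow> nat \<Rightarrow> ('v list \<Rightarrow> bool) \<Rightarrow> bool" where
  "od_rel U A n Q \<longleftrightarrow> (\<exists>S. od U S \<and> represents A n Q S)"

lemma represents_iff: "represents A n Q S \<Longrightarrow>
    z \<^bold>\<in> S \<longleftrightarrow> (\<exists>xs. length xs = n \<and> (\<forall>x\<in>set xs. x \<^bold>\<in> A) \<and> Q xs \<and> z = tup xs)"
  unfolding represents_def by (elim allE)

lemma represents_tup: "represents A n Q S \<Longrightarrow> length xs = n \<Longrightarrow> (\<And>x. x \<in> set xs \<Longrightarrow> x \<^bold>\<in> A) \<Longrightarrow> tup xs \<^bold>\<in> S \<longleftrightarrow> Q xs"
  using tup_inject[of xs] unfolding represents_iff[of A n Q S "tup xs"] by metis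

lemma od_relI: "od U S \<Longrightarrow> represents A n Q S \<Longrightarrow> od_rel U A n Q"
  unfolding od_rel_def by blast

lemma od_relE:
  assumes "od_rel U A n Q" obtains S where "od U S" "represents A n Q S"
  using assms unfolding od_rel_def by (elim exE conjE)

lemma od_rel_cong: "(\<And>xs. length xs = n \<Longrightarrow> Q xs \<longleftrightarrow> R xs) \<Longrightarrow> od_rel U A n Q \<longleftrightarrow> od_rel U A n R"
proof -
  assume *: "\<And>xs. length xs = n \<Longrightarrow> Q xs \<longleftrightarrow> R xs"
  have "represents A n Q S \<longleftrightarrow> represents A n R S" for S unfolding represents_def using * by (simp cong: conj_cong)
  then show ?thesis unfolding od_rel_def by simp
qed

text \<open>A product with \<open>A\<close> adds an unconstrained coordinate in front.\<close>

lemma od_rel_tl: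
  assumes "od U A" "od_rel U A n Q" shows "od_rel U A (Suc n) (\<lambda>xs. Q (tl xs))"
proof -
  obtain S where S: "od U S" "represents A n Q S" by (rule od_relE[OF assms(2)])
  have "represents A (Suc n) (\<lambda>xs. Q (tl xs)) (prod A S)" unfolding represents_def
  proof
    fix z
    show "z \<^bold>\<in> prod A S \<longleftrightarrow> (\<exists>xs. length xs = Suc n \<and> (\<forall>x\<in>set xs. x \<^bold>\<in> A) \<and> Q (tl xs) \<and> z = tup xs)"
      (is "?l \<longleftrightarrow> ?r")
    proof
      assume ?l
      then obtain x t where x: "x \<^bold>\<in> A" "t \<^bold>\<in> S" "z = pr x t" unfolding mem_prod by blast
      from x(2) obtain xs where "length xs = n" "\<forall>x\<in>set xs. x \<^bold>\<in> A" "Q xs" "t = tup xs"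
        unfolding represents_iff[OF S(2)] by blast
      with x have "x \<^bold>\<in> A" "length xs = n" "\<forall>x\<in>set xs. x \<^bold>\<in> A" "Q xs" "z = pr x (tup xs)" by simp_all
      then show ?r by (intro exI[of _ "x # xs"]) simp
    next
      assume ?r
      then obtain x xs where "length xs = n" "x \<^bold>\<in> A" "\<forall>x\<in>set xs. x \<^bold>\<in> A" "Q xs" "z = pr x (tup xs)"
        by (auto simp: length_Suc_conv)
      moreover from this have "tup xs \<^bold>\<in> S" using represents_tup[OF S(2)] by blast
      ultimately show ?l unfolding mem_prod by blast
    qed
  qed
  then show ?thesis using od_relI od_ops(4)[OF assms(1) S(1)] by blast
qed

lemma od_rel_True: "od U A \<Longrightarrow> od_rel U A n (\<lambda>_. True)"
proof (induction n)
  case 0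
  have "od U (num 1)" by (rule od_basic) simp
  moreover have "represents A 0 (\<lambda>_. True) (num 1)" by (auto simp: represents_def)
  ultimately show ?case by (rule od_relI)
next
  case (Suc n)
  then show ?case using od_rel_tl[of U A n "\<lambda>_. True"] by simp
qed

lemma od_rel_diff:
  assumes "od_rel U A n Q" "od_rel U A n R" shows "od_rel U A n (\<lambda>xs. Q xs \<and> \<not> R xs)"
proof -
  obtain S where "od U S" "represents A n Q S" by (rule od_relE[OF assms(1)])
  moreover obtain T where "od U T" "represents A n R T" by (rule od_relE[OF assms(2)])
  ultimately have S: "od U S" "represents A n Q S" "od U T" "represents A n R T" by simp_all
  have "represents A n (\<lambda>xs. Q xs \<and> \<not> R xs) (diff S T)"
    unfolding represents_def mem_diff represents_iff[OF S(2)] represents_iff[OF S(4)]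
    by (intro allI iffI; elim conjE exE) (use tup_inject in metis)+
  then show ?thesis using od_relI od_ops(5)[OF S(1,3)] by blast
qed

lemma od_rel_not:
  assumes "od U A" "od_rel U A n R" shows "od_rel U A n (\<lambda>xs. \<not> R xs)"
  using od_rel_diff[OF od_rel_True[OF assms(1)] assms(2)] by simp

lemma od_rel_and:
  assumes "od U A" "od_rel U A n Q" "od_rel U A n R" shows "od_rel U A n (\<lambda>xs. Q xs \<and> R xs)"
  using od_rel_diff[OF assms(2) od_rel_not[OF assms(1,3)]] by simp

text \<open>The bound variable stands in front, so quantification is the projection to the
  tail.\<close>

lemma od_rel_ex:
  assumes "od U A" "od_rel U A (Suc n) Q" shows "od_rel U A n (\<lambda>xs. \<exists>x. x \<^bold>\<in> A \<and> Q (x # xs))"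
proof -
  obtain S where S: "od U S" "represents A (Suc n) Q S" by (rule od_relE[OF assms(2)])
  have d: "dF sn" by (intro dfn)
  have "represents A n (\<lambda>xs. \<exists>x. x \<^bold>\<in> A \<and> Q (x # xs)) (img S sn)" unfolding represents_def mem_img[OF d]
  proof
    fix z
    show "(\<exists>p. p \<^bold>\<in> S \<and> z = sn p) \<longleftrightarrow>
      (\<exists>xs. length xs = n \<and> (\<forall>x\<in>set xs. x \<^bold>\<in> A) \<and> (\<exists>x. x \<^bold>\<in> A \<and> Q (x # xs)) \<and> z = tup xs)" (is "?l \<longleftrightarrow> ?r")
    proof
      assume ?l
      then obtain p where p: "p \<^bold>\<in> S" "z = sn p" by blast
      then obtain xs where "length xs = Suc n" "\<forall>x\<in>set xs. x \<^bold>\<in> A" "Q xs" "z = sn (tup xs)"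
        unfolding represents_iff[OF S(2)] by blast
      then show ?r by (cases xs) auto
    next
      assume ?r
      then obtain x xs where x: "length xs = n" "\<forall>x\<in>set xs. x \<^bold>\<in> A" "x \<^bold>\<in> A" "Q (x # xs)" "z = tup xs" by blast
      then have "tup (x # xs) \<^bold>\<in> S" using represents_tup[OF S(2), of "x # xs"] by auto
      then show ?l using x(5) by (intro exI[of _ "tup (x # xs)"]) simp
    qed
  qed
  then show ?thesis using od_relI od_ops(6)[OF S(1) S(1)] by blast
qed

text \<open>For \<open>j\<close> = 0 the two coordinates are adjacent and the operation applies
  directly; each further step inserts a dummy right after the first coordinate.\<close>

lemma od_rel_hd:
  assumes "od U A" "r = (\<lambda>a b. a \<^bold>\<in> b) \<or> r = (\<lambda>a b. b \<^bold>\<in> a) \<or> r = (\<lambda>a b. a = b)" "j < n"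
  shows "od_rel U A (Suc n) (\<lambda>xs. r (hd xs) (xs ! Suc j))"
  using assms(3)
proof (induction j arbitrary: n)
  case 0
  then obtain k where n: "n = Suc k" by (cases n) auto
  obtain T where T: "od U T" "represents A k (\<lambda>_. True) T" by (rule od_relE[OF od_rel_True[OF assms(1)]])
  have rT: "t \<^bold>\<in> T \<longleftrightarrow> (\<exists>xs. length xs = k \<and> (\<forall>x\<in>set xs. x \<^bold>\<in> A) \<and> t = tup xs)" for t
    using represents_iff[OF T(2)] by simp
  have *: "(\<exists>a b t. a \<^bold>\<in> A \<and> b \<^bold>\<in> A \<and> t \<^bold>\<in> T \<and> r a b \<and> z = pr a (pr b t)) \<longleftrightarrow>
    (\<exists>xs. length xs = Suc n \<and> (\<forall>x\<in>set xs. x \<^bold>\<in> A) \<and> r (hd xs) (xs ! Suc 0) \<and> z = tup xs)" (is "?l \<longleftrightarrow> ?r") for z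
  proof
    assume ?l
    then obtain a b xs where "a \<^bold>\<in> A" "b \<^bold>\<in> A" "r a b" "length xs = k" "\<forall>x\<in>set xs. x \<^bold>\<in> A" "z = pr a (pr b (tup xs))"
      unfolding rT by blast
    then show ?r by (intro exI[of _ "a # b # xs"]) (simp add: n)
  next
    assume ?r
    then obtain a b xs where "a \<^bold>\<in> A" "b \<^bold>\<in> A" "r a b" "length xs = k" "\<forall>x\<in>set xs. x \<^bold>\<in> A" "z = pr a (pr b (tup xs))"
      unfolding n by (auto simp: length_Suc_conv)
    then show ?l unfolding rT by blast
  qed
  from assms(2) show ?case
  proof (elim disjE)
    assume r: "r = (\<lambda>a b. a \<^bold>\<in> b)"
    show ?thesis by (rule od_relI[OF od_ops(9)[OF assms(1) T(1)]]) (use * in \<open>simp only: represents_def mem_ops r simp_thms\<close>)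
  next
    assume r: "r = (\<lambda>a b. b \<^bold>\<in> a)"
    show ?thesis by (rule od_relI[OF od_ops(10)[OF assms(1) T(1)]]) (use * in \<open>simp only: represents_def mem_ops r simp_thms\<close>)
  next
    assume r: "r = (\<lambda>a b. a = b)"
    show ?thesis by (rule od_relI[OF od_ops(11)[OF assms(1) T(1)]]) (use * in \<open>simp only: represents_def mem_ops r simp_thms\<close>)
  qed
next
  case (Suc j)
  then obtain k where n: "n = Suc k" "j < k" by (cases n) auto
  obtain S where S: "od U S" "represents A (Suc k) (\<lambda>xs. r (hd xs) (xs ! Suc j)) S"
    by (rule od_relE[OF Suc.IH[OF n(2)]])
  have rS: "t \<^bold>\<in> S \<longleftrightarrow> (\<exists>x xs. length xs = k \<and> x \<^bold>\<in> A \<and> (\<forall>x\<in>set xs. x \<^bold>\<in> A) \<and> r x (xs ! j) \<and> t = pr x (tup xs))" for t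
  proof -
    have "t \<^bold>\<in> S \<longleftrightarrow> (\<exists>xs. length xs = Suc k \<and> (\<forall>x\<in>set xs. x \<^bold>\<in> A) \<and> r (hd xs) (xs ! Suc j) \<and> t = tup xs)"
      by (rule represents_iff[OF S(2)])
    then show ?thesis by (auto simp: length_Suc_conv) force
  qed
  have "represents A (Suc n) (\<lambda>xs. r (hd xs) (xs ! Suc (Suc j))) (ins2 A S)" unfolding represents_def mem_ins2
  proof
    fix z
    show "(\<exists>b p. b \<^bold>\<in> A \<and> p \<^bold>\<in> S \<and> z = pr (fs p) (pr b (sn p))) \<longleftrightarrow>
      (\<exists>xs. length xs = Suc n \<and> (\<forall>x\<in>set xs. x \<^bold>\<in> A) \<and> r (hd xs) (xs ! Suc (Suc j)) \<and> z = tup xs)" (is "?l \<longleftrightarrow> ?r")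
    proof
      assume ?l
      then obtain b p where "b \<^bold>\<in> A" "p \<^bold>\<in> S" "z = pr (fs p) (pr b (sn p))" by blast
      then obtain x xs where "length xs = k" "x \<^bold>\<in> A" "\<forall>x\<in>set xs. x \<^bold>\<in> A" "r x (xs ! j)" "z = pr x (pr b (tup xs))" "b \<^bold>\<in> A"
        unfolding rS by auto
      then show ?r by (intro exI[of _ "x # b # xs"]) (simp add: n)
    next
      assume ?r
      then obtain xs where "length xs = Suc (Suc k)" "\<forall>x\<in>set xs. x \<^bold>\<in> A" "r (hd xs) (xs ! Suc (Suc j))" "z = tup xs"
        unfolding n by blast
      then obtain x b ys where *: "length ys = k" "x \<^bold>\<in> A" "b \<^bold>\<in> A" "\<forall>x\<in>set ys. x \<^bold>\<in> A" "r x (ys ! j)" "z = pr x (pr b (tup ys))"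
        by (auto simp: length_Suc_conv)
      then have "pr x (tup ys) \<^bold>\<in> S" unfolding rS by blast
      then show ?l using * by (intro exI[of _ b] exI[of _ "pr x (tup ys)"]) simp
    qed
  qed
  then show ?case using od_relI od_ops(8)[OF assms(1) S(1)] by blast
qed

text \<open>Dummies in front reduce the claim to \<open>i\<close> = 0. As the converse of membership
  is among the relations, both orders of two indices are covered.\<close>

lemma od_rel_nth:
  assumes "od U A" "r = (\<lambda>a b. a \<^bold>\<in> b) \<or> r = (\<lambda>a b. b \<^bold>\<in> a) \<or> r = (\<lambda>a b. a = b)" "i \<le> j" "j < n"
  shows "od_rel U A n (\<lambda>xs. r (xs ! i) (xs ! j))"
  using assms(3,4)
proof (induction i arbitrary: j n)
  case 0
  then obtain k where n: "n = Suc k" by (cases n) auto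
  show ?case
  proof (cases j)
    case 0
    \<comment> \<open>On the diagonal the relation is constant: equality always holds, membership
      never, by Foundation.\<close>
    consider "\<And>a. r a a" | "\<And>a. \<not> r a a" using assms(2) mem_irrefl by blast
    then show ?thesis
    proof cases
      case 1
      then show ?thesis using od_rel_True[OF assms(1)] 0 by simp
    next
      case 2
      then show ?thesis using od_rel_not[OF assms(1) od_rel_True[OF assms(1)]] 0 by simp
    qed
  next
    case (Suc j')
    then have "od_rel U A n (\<lambda>xs. r (hd xs) (xs ! Suc j'))"
      using od_rel_hd[OF assms(1,2), of j' k] "0.prems" n by simp
    moreover have "od_rel U A n (\<lambda>xs. r (hd xs) (xs ! Suc j')) \<longleftrightarrow> od_rel U A n (\<lambda>xs. r (xs ! 0) (xs ! j))"
      by (rule od_rel_cong) (auto simp: hd_conv_nth n Suc simp flip: length_greater_0_conv)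
    ultimately show ?thesis by simp
  qed
next
  case (Suc i)
  then obtain j' k where n: "n = Suc k" "j = Suc j'" by (cases n; cases j) auto
  have "od_rel U A n (\<lambda>xs. r (tl xs ! i) (tl xs ! j'))"
    unfolding n by (rule od_rel_tl[OF assms(1) Suc.IH]) (use Suc.prems n in auto)
  moreover have "od_rel U A n (\<lambda>xs. r (tl xs ! i) (tl xs ! j')) \<longleftrightarrow> od_rel U A n (\<lambda>xs. r (xs ! Suc i) (xs ! j))"
    by (rule od_rel_cong) (use Suc.prems n in \<open>auto simp: nth_tl\<close>)
  ultimately show ?case by simp
qed

primrec fv_bound :: "fm \<Rightarrow> nat" where
  "fv_bound (Mem i j) = Suc (max i j)"
| "fv_bound (Eq i j) = Suc (max i j)"
| "fv_bound (Neg \<phi>) = fv_bound \<phi>"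
| "fv_bound (Conj \<phi> \<psi>) = max (fv_bound \<phi>) (fv_bound \<psi>)"
| "fv_bound (Ex \<phi>) = fv_bound \<phi> - 1"

lemma sat_cong: "(\<And>i. i < fv_bound \<phi> \<Longrightarrow> e i = e' i) \<Longrightarrow> sat E D e \<phi> \<longleftrightarrow> sat E D e' \<phi>"
proof (induction \<phi> arbitrary: e e')
  case (Ex \<phi>)
  have "sat E D (case_nat x e) \<phi> \<longleftrightarrow> sat E D (case_nat x e') \<phi>" for x
    by (rule Ex.IH) (use Ex.prems in \<open>auto split: nat.split\<close>)
  then show ?case by simp
next
  case (Neg \<phi>)
  from Neg.IH[of e e'] Neg.prems show ?case by simp
next
  case (Conj \<phi> \<psi>)
  from Conj.IH(1)[of e e'] Conj.IH(2)[of e e'] Conj.prems show ?case by simp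
qed simp_all

text \<open>Goedel's normal form theorem, by induction on formulas outside the model: the
  connectives become differences and the quantifier a projection.\<close>

lemma od_rel_sat:
  assumes "od U A" "fv_bound \<phi> \<le> n" shows "od_rel U A n (\<lambda>xs. sat E {x. x \<^bold>\<in> A} (\<lambda>i. xs ! i) \<phi>)"
  using assms(2)
proof (induction \<phi> arbitrary: n)
  case (Mem i j)
  show ?case
  proof (cases "i \<le> j")
    case True
    then show ?thesis using od_rel_nth[OF assms(1), of "\<lambda>a b. a \<^bold>\<in> b" i j n] Mem by simp
  next
    case False
    then show ?thesis using od_rel_nth[OF assms(1), of "\<lambda>a b. b \<^bold>\<in> a" j i n] Mem by simp
  qed
next
  case (Eq i j)
  show ?case
  proof (cases "i \<le> j")
    case True
    then show ?thesis using od_rel_nth[OF assms(1), of "\<lambda>a b. a = b" i j n] Eq by simp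
  next
    case False
    then show ?thesis using od_rel_nth[OF assms(1), of "\<lambda>a b. a = b" j i n] Eq by (simp add: eq_commute)
  qed
next
  case (Neg \<phi>)
  then show ?case using od_rel_not[OF assms(1) Neg.IH[of n]] by simp
next
  case (Conj \<phi> \<psi>)
  then show ?case using od_rel_and[OF assms(1) Conj.IH(1)[of n] Conj.IH(2)[of n]] by simp
next
  case (Ex \<phi>)
  have eq: "(\<lambda>i. (x # xs) ! i) = case_nat x (\<lambda>i. xs ! i)" for x :: 'v and xs
    by (auto simp: fun_eq_iff split: nat.split)
  have "fv_bound \<phi> \<le> Suc n" using Ex.prems by simp
  from od_rel_ex[OF assms(1) Ex.IH[OF this]] show ?case by (simp add: Bex_def eq)
qed

subsection \<open>Reflection\<close>

primrec tuples :: "nat \<Rightarrow> 'v \<Rightarrow> 'v" where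
  "tuples 0 A = upr emp emp"
| "tuples (Suc n) A = prod A (tuples n A)"

lemma tuples_dfn [dfn]: "dterm B A \<Longrightarrow> dterm B (\<lambda>e. tuples n (A e))"
  by (induction n) (simp_all add: emp_dfn upr_dfn prod_dfn)

lemma tup_tuples: "(\<And>x. x \<in> set xs \<Longrightarrow> x \<^bold>\<in> A) \<Longrightarrow> tup xs \<^bold>\<in> tuples (length xs) A"
  by (induction xs) (auto simp: mem_prod)

lemma nth_tup: "n < length xs \<Longrightarrow> fs ((sn ^^ n) (tup xs)) = xs ! n"
proof (induction xs arbitrary: n)
  case (Cons x xs)
  then show ?case by (cases n) (auto simp: funpow_swap1)
qed simp

lemma snpow_dfn: "dterm A t \<Longrightarrow> dterm A (\<lambda>e. (sn ^^ n) (t e))"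
  by (induction n) (simp_all add: sn_dfn)

text \<open>The function \<open>h\<close> bounds the ranks of witnesses, so that limit ordinals
  closed under it reflect the formula. Bounds combine easily: for a conjunction the larger of the
  two serves.\<close>

lemma reflection_function:
  "\<exists>h. dF h \<and> (\<forall>c. ordinal (h c)) \<and>
     (\<forall>b (env :: nat \<Rightarrow> 'v). limit b \<longrightarrow> (\<forall>c. c \<^bold>\<in> b \<longrightarrow> h c \<^bold>\<in> b) \<longrightarrow> (\<forall>n. env n \<^bold>\<in> Vs b) \<longrightarrow>
        (sat E {x. x \<^bold>\<in> Vs b} env \<phi> \<longleftrightarrow> sat E UNIV env \<phi>))"
proof (induction \<phi>)
  case (Mem i j)
  show ?case by (rule exI[of _ "\<lambda>_. emp"]) (auto intro: emp_dfn)
next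
  case (Eq i j)
  show ?case by (rule exI[of _ "\<lambda>_. emp"]) (auto intro: emp_dfn)
next
  case (Neg \<phi>)
  then show ?case by simp
next
  case (Conj \<phi> \<psi>)
  then obtain h h' where h: "dF h" "\<And>c. ordinal (h c)"
    "\<And>b (env :: nat \<Rightarrow> 'v). limit b \<Longrightarrow> (\<And>c. c \<^bold>\<in> b \<Longrightarrow> h c \<^bold>\<in> b) \<Longrightarrow> (\<And>n. env n \<^bold>\<in> Vs b) \<Longrightarrow>
        sat E {x. x \<^bold>\<in> Vs b} env \<phi> \<longleftrightarrow> sat E UNIV env \<phi>"
    and h': "dF h'" "\<And>c. ordinal (h' c)"
    "\<And>b (env :: nat \<Rightarrow> 'v). limit b \<Longrightarrow> (\<And>c. c \<^bold>\<in> b \<Longrightarrow> h' c \<^bold>\<in> b) \<Longrightarrow> (\<And>n. env n \<^bold>\<in> Vs b) \<Longrightarrow>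
        sat E {x. x \<^bold>\<in> Vs b} env \<psi> \<longleftrightarrow> sat E UNIV env \<psi>" by blast
  show ?case
  proof (intro exI[of _ "\<lambda>c. un (h c) (h' c)"] conjI allI impI)
    show "dF (\<lambda>c. un (h c) (h' c))" by (intro dfn dF_comp[OF h(1)] dF_comp[OF h'(1)])
    show "ordinal (un (h c) (h' c))" for c by (intro ord_un h h')
    fix b and env :: "nat \<Rightarrow> 'v" assume b: "limit b" "\<forall>c. c \<^bold>\<in> b \<longrightarrow> un (h c) (h' c) \<^bold>\<in> b" "\<forall>n. env n \<^bold>\<in> Vs b"
    have ob: "ordinal b" using b(1) by (simp add: limit_def)
    have "h c \<^bold>\<in> b" "h' c \<^bold>\<in> b" if "c \<^bold>\<in> b" for c
    proof -
      have u: "un (h c) (h' c) \<^bold>\<in> b" using b(2) that by blast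
      have "h c \<^bold>\<subseteq> un (h c) (h' c)" "h' c \<^bold>\<subseteq> un (h c) (h' c)" by (auto simp: subset_def)
      then show "h c \<^bold>\<in> b" "h' c \<^bold>\<in> b" using ord_subset[OF h(2) ord_un[OF h(2) h'(2)]]
          ord_subset[OF h'(2) ord_un[OF h(2) h'(2)]] u ord_trans[OF ob u] by metis+
    qed
    then show "sat E {x. x \<^bold>\<in> Vs b} env (Conj \<phi> \<psi>) \<longleftrightarrow> sat E UNIV env (Conj \<phi> \<psi>)"
      using h(3)[OF b(1)] h'(3)[OF b(1)] b(3) by simp
  qed
next
  case (Ex \<phi>)
  then obtain h where h: "dF h" "\<And>c. ordinal (h c)"
    "\<And>b (env :: nat \<Rightarrow> 'v). limit b \<Longrightarrow> (\<And>c. c \<^bold>\<in> b \<Longrightarrow> h c \<^bold>\<in> b) \<Longrightarrow> (\<And>n. env n \<^bold>\<in> Vs b) \<Longrightarrow>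
        sat E {x. x \<^bold>\<in> Vs b} env \<phi> \<longleftrightarrow> sat E UNIV env \<phi>" by blast
  \<comment> \<open>The least rank at which a witness appears, and \<open>emp\<close> if there is
    none.\<close>
  define w where "w env = least (\<lambda>d. \<exists>x. x \<^bold>\<in> Vs d \<and> sat E UNIV (case_nat x env) \<phi>)" for env
  have dw: "dP (\<lambda>d. \<exists>x. x \<^bold>\<in> Vs d \<and> sat E UNIV (case_nat x env) \<phi>)" for env
    by (intro dfn sat_defn_env) (simp_all add: defn_True)
  let ?k = "fv_bound \<phi>"
  \<comment> \<open>An assignment is an external sequence and cannot range over a set of the model.
    Only its first \<open>?k\<close> values matter, and these are coded by the tuple
    \<open>z\<close>.\<close>
  define v where "v z = w (\<lambda>n. fs ((sn ^^ n) z))" for z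
  have dv: "dF v" unfolding v_def w_def
  proof (intro dfn)
    have "defn UNIV (\<lambda>e. sat E UNIV (\<lambda>n. (case n of 0 \<Rightarrow> \<lambda>e. e 0 | Suc m \<Rightarrow> \<lambda>e. fs ((sn ^^ m) (e (Suc (Suc 0))))) e) \<phi>)"
      by (rule defn_subst[OF sat_defn]) (auto intro!: dfn snpow_dfn split: nat.split)
    moreover have "(\<lambda>n. (case n of 0 \<Rightarrow> \<lambda>e. e 0 | Suc m \<Rightarrow> \<lambda>e. fs ((sn ^^ m) (e (Suc (Suc 0))))) e)
        = case_nat (e 0) (\<lambda>n. fs ((sn ^^ n) (e (Suc (Suc 0)))))" for e :: "nat \<Rightarrow> 'v"
      by (auto simp: fun_eq_iff split: nat.split)
    ultimately show "defn UNIV (\<lambda>e. sat E UNIV (case_nat (e 0) (\<lambda>n. fs ((sn ^^ n) (e (Suc (Suc 0)))))) \<phi>)"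
      by simp
  qed
  let ?u = "\<lambda>c. UNI (tuples ?k (Vs c)) v"
  let ?g = "\<lambda>c. ins (?u c) (?u c)"
  have kuf_on_ord: "ordinal (?u c)" for c by (rule ord_UNI[OF dv]) (simp add: v_def w_def)
  have vg: "v z \<^bold>\<in> ?g c" if "z \<^bold>\<in> tuples ?k (Vs c)" for z c
  proof -
    have "v z \<^bold>\<subseteq> ?u c" using that by (auto simp: subset_def mem_UNI[OF dv])
    moreover have "ordinal (v z)" by (simp add: v_def w_def)
    ultimately show ?thesis using ord_subset kuf_on_ord by auto
  qed
  show ?case
  proof (intro exI[of _ "\<lambda>c. un (h c) (?g c)"] conjI allI impI)
    show "dF (\<lambda>c. un (h c) (?g c))" by (intro dfn dF_comp[OF h(1)] dF_comp[OF dv])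
    have og: "ordinal (?g c)" for c by (rule ord_succ[OF kuf_on_ord])
    show "ordinal (un (h c) (?g c))" for c by (intro ord_un h og)
    fix b and env :: "nat \<Rightarrow> 'v" assume b: "limit b" "\<forall>c. c \<^bold>\<in> b \<longrightarrow> un (h c) (?g c) \<^bold>\<in> b" "\<forall>n. env n \<^bold>\<in> Vs b"
    have ob: "ordinal b" using b(1) by (simp add: limit_def)
    have hb: "h c \<^bold>\<in> b" and gb: "?g c \<^bold>\<in> b" if "c \<^bold>\<in> b" for c
    proof -
      have u: "un (h c) (?g c) \<^bold>\<in> b" using b(2) that by blast
      have "h c \<^bold>\<subseteq> un (h c) (?g c)" "?g c \<^bold>\<subseteq> un (h c) (?g c)" by (auto simp: subset_def)
      then show "h c \<^bold>\<in> b" "?g c \<^bold>\<in> b" using ord_subset[OF h(2) ord_un[OF h(2) og]]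
          ord_subset[OF og ord_un[OF h(2) og]] u ord_trans[OF ob u] by metis+
    qed
    have IH: "sat E {x. x \<^bold>\<in> Vs b} (case_nat x env) \<phi> \<longleftrightarrow> sat E UNIV (case_nat x env) \<phi>" if "x \<^bold>\<in> Vs b" for x
      by (rule h(3)[OF b(1) hb]) (use that b(3) in \<open>auto split: nat.split\<close>)
    have "\<exists>x. x \<^bold>\<in> Vs b \<and> sat E UNIV (case_nat x env) \<phi>" if x: "sat E UNIV (case_nat x env) \<phi>" for x
    proof -
      \<comment> \<open>The relevant values lie in a common \<open>Vs c\<close> with
        \<open>c\<close> below \<open>b\<close>: there are finitely many of them in the sense of the
        metatheory, and \<open>b\<close> is a limit.\<close>
      have "\<exists>c. c \<^bold>\<in> b \<and> (\<forall>n<m. env n \<^bold>\<in> Vs c)" for m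
      proof (induction m)
        case 0
        then show ?case using b(1) by (auto simp: limit_def)
      next
        case (Suc m)
        then obtain c where c: "c \<^bold>\<in> b" "\<forall>n<m. env n \<^bold>\<in> Vs c" by blast
        obtain d where d: "d \<^bold>\<in> b" "env m \<^bold>\<subseteq> Vs d" using b(3) mem_Vs[OF ob] by blast
        have o: "ordinal c" "ordinal d" using ord_mem[OF ob] c(1) d(1) by auto
        obtain f where f: "f \<^bold>\<in> b" "c \<^bold>\<subseteq> f" "d \<^bold>\<subseteq> f"
          using ord_linear[OF o] c(1) d(1) ord_subset[OF o] ord_subset[OF o(2,1)] by (metis subset_def)
        have of: "ordinal f" using ord_mem[OF ob f(1)] .
        have "d \<^bold>\<in> ins f f" using f(3) ord_subset[OF o(2) of] by auto
        then have "env m \<^bold>\<in> Vs (ins f f)" using d(2) mem_Vs[OF ord_succ[OF of]] by blast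
        moreover have "c \<^bold>\<in> ins f f" using f(2) ord_subset[OF o(1) of] by auto
        then have "\<forall>n<m. env n \<^bold>\<in> Vs (ins f f)" using c(2) Vs_mono[OF ord_succ[OF of]] unfolding subset_def by blast
        moreover have "ins f f \<^bold>\<in> b" using b(1) f(1) by (simp add: limit_def)
        ultimately show ?case by (metis less_Suc_eq)
      qed
      then obtain c where c: "c \<^bold>\<in> b" "\<forall>n<?k. env n \<^bold>\<in> Vs c" by blast
      let ?xs = "map env [0..<?k]"
      have "tup ?xs \<^bold>\<in> tuples (length ?xs) (Vs c)" by (rule tup_tuples) (use c(2) in auto)
      then have vb: "v (tup ?xs) \<^bold>\<in> ?g c" by (intro vg) simp
      have vw: "v (tup ?xs) = w env"
      proof -
        have "sat E UNIV (case_nat x (\<lambda>n. fs ((sn ^^ n) (tup ?xs)))) \<phi> \<longleftrightarrow> sat E UNIV (case_nat x env) \<phi>" for x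
          by (rule sat_cong) (auto simp: nth_tup split: nat.split)
        then show ?thesis unfolding v_def w_def by simp
      qed
      obtain d where "ordinal d" "x \<^bold>\<in> Vs d" using ex_Vs by blast
      then have "\<exists>x. x \<^bold>\<in> Vs (w env) \<and> sat E UNIV (case_nat x env) \<phi>"
        unfolding w_def using least(2)[OF dw, of d env] x by blast
      moreover have "w env \<^bold>\<in> b" using vb gb[OF c(1)] ord_trans[OF ob] vw by metis
      ultimately show ?thesis using Vs_mono[OF ob] unfolding subset_def by blast
    qed
    then show "sat E {x. x \<^bold>\<in> Vs b} env (Ex \<phi>) \<longleftrightarrow> sat E UNIV env (Ex \<phi>)"
      using IH by auto
  qed
qed

text \<open>The supremum of a sequence of length \<open>omega\<close> that starts above
  \<open>a\<close>; each term exceeds the earlier terms and the values of \<open>h\<close> on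
  them.\<close>

lemma ex_closed_limit:
  assumes h: "dF h" "\<And>c. ordinal (h c)" and a: "ordinal a"
  shows "\<exists>b. limit b \<and> a \<^bold>\<in> b \<and> (\<forall>c. c \<^bold>\<in> b \<longrightarrow> h c \<^bold>\<in> b)"
proof -
  define H where "H x = un x (UNI x (\<lambda>c. ins (h c) (h c)))" for x
  have dh: "dF (\<lambda>c. ins (h c) (h c))" by (intro dfn dF_comp[OF h(1)])
  have dH: "dF H" unfolding H_def by (intro dfn dF_comp[OF h(1)])
  have H: "z \<^bold>\<in> H x \<longleftrightarrow> z \<^bold>\<in> x \<or> (\<exists>c. c \<^bold>\<in> x \<and> z \<^bold>\<in> ins (h c) (h c))" for x z
    unfolding H_def by (simp add: mem_UNI[OF dh] del: mem_ins)
  have oH: "ordinal (H x)" if "ordinal x" for x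
    unfolding H_def by (intro ord_un that ord_UNI[OF dh] ord_succ h(2))
  let ?y = "\<lambda>f. un (ins a a) (UNI f (\<lambda>p. H (sn p)))"
  \<comment> \<open>The successor makes the sequence strictly increasing, which gives closure of the
    supremum under successors.\<close>
  let ?G = "\<lambda>f. ins (?y f) (?y f)"
  have dG: "dF ?G" by (intro dfn dF_comp[OF dH])
  define s where "s = rec ?G"
  have ds: "dF s" unfolding s_def by (rule recD[OF dG])
  have dHs: "dF (\<lambda>p. H (sn p))" by (intro dfn dF_comp[OF dH])
  define y where "y n = ?y (lam n s)" for n
  have s: "s n = ins (y n) (y n)" if "ordinal n" for n
    using rec[OF dG that] unfolding s_def y_def .
  have y: "z \<^bold>\<in> y n \<longleftrightarrow> z \<^bold>\<in> ins a a \<or> (\<exists>m. m \<^bold>\<in> n \<and> z \<^bold>\<in> H (s m))" for z n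
    unfolding y_def by (simp add: mem_UNI_lam[OF dHs ds] del: mem_ins)
  have dy: "dF y" unfolding y_def by (intro dfn dF_comp[OF dH] dF_comp[OF ds])
  have oy: "ordinal (y n) \<and> ordinal (s n)" if "ordinal n" for n
  proof (rule ord_induct[where P = "\<lambda>n. ordinal (y n) \<and> ordinal (s n)", OF _ _ that])
    show "dP (\<lambda>n. ordinal (y n) \<and> ordinal (s n))" by (intro dfn dF_comp[OF dy] dF_comp[OF ds])
    fix n assume n: "ordinal n" "\<And>m. m \<^bold>\<in> n \<Longrightarrow> ordinal (y m) \<and> ordinal (s m)"
    have "ordinal (y n)" unfolding y_def
      by (intro ord_un ord_succ a ord_UNI[OF dHs]) (use n oH in \<open>auto simp: mem_lam[OF ds]\<close>)
    then show "ordinal (y n) \<and> ordinal (s n)" using s[OF n(1)] by simp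
  qed
  have step: "s m \<^bold>\<in> s n \<and> (\<forall>c. c \<^bold>\<in> s m \<longrightarrow> h c \<^bold>\<in> s n \<and> ins c c \<^bold>\<in> s n)" if n: "ordinal n" "m \<^bold>\<in> n" for m n
  proof -
    have m: "ordinal m" using ord_mem n by blast
    have os: "ordinal (s m)" "ordinal (y n)" "ordinal (s n)" using oy m n by auto
    have "s m \<^bold>\<subseteq> y n" unfolding subset_def y H using n(2) by blast
    then have sm: "s m \<^bold>\<in> s n" using ord_subset[OF os(1,2)] s[OF n(1)] by auto
    have "h c \<^bold>\<in> s n \<and> ins c c \<^bold>\<in> s n" if c: "c \<^bold>\<in> s m" for c
    proof
      have "h c \<^bold>\<in> y n" unfolding y H using n(2) c by auto
      then show "h c \<^bold>\<in> s n" using s[OF n(1)] by simp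
      have oc: "ordinal c" using ord_mem[OF os(1) c] .
      have "ins c c \<^bold>\<subseteq> s m" unfolding subset_def using c ord_trans[OF os(1) c] by auto
      then show "ins c c \<^bold>\<in> s n" using ord_subset[OF ord_succ[OF oc] os(1)] sm ord_trans[OF os(3) sm] by metis
    qed
    with sm show ?thesis by blast
  qed
  let ?b = "UNI omega s"
  have b: "z \<^bold>\<in> ?b \<longleftrightarrow> (\<exists>n. n \<^bold>\<in> omega \<and> z \<^bold>\<in> s n)" for z by (simp add: mem_UNI[OF ds])
  have on: "ordinal n" if "n \<^bold>\<in> omega" for n using ord_mem[OF ord_omega that] .
  have ob: "ordinal ?b" by (rule ord_UNI[OF ds]) (use on oy in blast)
  have succ: "h c \<^bold>\<in> ?b \<and> ins c c \<^bold>\<in> ?b" if c: "c \<^bold>\<in> ?b" for c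
  proof -
    obtain n where n: "n \<^bold>\<in> omega" "c \<^bold>\<in> s n" using c b by blast
    from step[of "ins n n" n] on[OF n(1)] n(2) have "h c \<^bold>\<in> s (ins n n)" "ins c c \<^bold>\<in> s (ins n n)" by auto
    then show ?thesis using b succ_omega[OF n(1)] by blast
  qed
  have ab: "a \<^bold>\<in> ?b" using b[of a] emp_omega s[OF ord_emp] y[of a emp] by auto
  have "emp \<^bold>\<in> ?b"
  proof -
    have "emp \<^bold>\<in> a \<or> emp = a" using ord_linear[OF ord_emp a] by auto
    then show ?thesis using ab ord_trans[OF ob ab] by blast
  qed
  then have "limit ?b" unfolding limit_def using ob succ by blast
  then show ?thesis using ab succ by blast
qed

lemma od_tup: "(\<And>x. x \<in> set xs \<Longrightarrow> od U x) \<Longrightarrow> od U (tup xs)"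
  by (induction xs) (auto intro: od_ops od_basic)

text \<open>Reflection moves the definition from the universe to some \<open>Vs b\<close>. There it
  becomes a relation built by Goedel operations, whose section at the tuple of parameters is the
  singleton of \<open>x\<close>.\<close>

lemma dterm_od:
  assumes "dterm (insert U {a. ordinal a}) (\<lambda>e. x)" shows "od U x"
proof -
  have "x \<in> OD_from U" using assms defn_OD_from[of "\<lambda>_. emp"] by simp
  then obtain \<phi> a where a: "\<And>n. ordinal (a n)"
    "\<And>y. sat E UNIV (case_nat y (case_nat U a)) \<phi> \<longleftrightarrow> y = x" unfolding OD_from_def by blast
  let ?k = "fv_bound \<phi>"
  \<comment> \<open>Only finitely many of the ordinals matter; the others are reset to
    \<open>emp\<close>, so that all parameters fit into one \<open>Vs b\<close>.\<close>
  let ?a = "\<lambda>n. if n < ?k then a n else emp"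
  have a': "sat E UNIV (case_nat y (case_nat U ?a)) \<phi> \<longleftrightarrow> y = x" for y
    unfolding a(2)[symmetric] by (rule sat_cong) (auto split: nat.split)
  obtain h where h: "dF h" "\<And>c. ordinal (h c)"
    "\<And>b (env :: nat \<Rightarrow> 'v). limit b \<Longrightarrow> (\<And>c. c \<^bold>\<in> b \<Longrightarrow> h c \<^bold>\<in> b) \<Longrightarrow> (\<And>n. env n \<^bold>\<in> Vs b) \<Longrightarrow>
        sat E {x. x \<^bold>\<in> Vs b} env \<phi> \<longleftrightarrow> sat E UNIV env \<phi>" using reflection_function[of \<phi>] by blast
  define r where "r x = least (\<lambda>b. x \<^bold>\<in> Vs b)" for x
  have r: "ordinal (r x)" "x \<^bold>\<in> Vs (r x)" for x
  proof -
    show "ordinal (r x)" by (simp add: r_def)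
    have d: "dP (\<lambda>b. x \<^bold>\<in> Vs b)" by (intro dfn)
    show "x \<^bold>\<in> Vs (r x)" unfolding r_def using least(2)[OF d] ex_Vs by blast
  qed
  have "\<exists>c. ordinal c \<and> (\<forall>y\<in>set ys. r y \<^bold>\<in> c)" for ys
  proof (induction ys)
    case Nil
    show ?case by (rule exI[of _ emp]) simp
  next
    case (Cons y ys)
    then obtain c where c: "ordinal c" "\<forall>y\<in>set ys. r y \<^bold>\<in> c" by blast
    let ?c = "un c (ins (r y) (r y))"
    have "ordinal ?c" by (intro ord_un ord_succ c r)
    then show ?case using c by (intro exI[of _ ?c]) auto
  qed
  then obtain c where c: "ordinal c" "\<And>y. y \<in> set (x # U # emp # map a [0..<?k]) \<Longrightarrow> r y \<^bold>\<in> c" by meson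
  obtain b where b: "limit b" "c \<^bold>\<in> b" "\<And>d. d \<^bold>\<in> b \<Longrightarrow> h d \<^bold>\<in> b" using ex_closed_limit[OF h(1,2) c(1)] by blast
  have ob: "ordinal b" using b(1) by (simp add: limit_def)
  have inV: "y \<^bold>\<in> Vs b" if "y \<in> set (x # U # emp # map a [0..<?k])" for y
    using r(2)[of y] Vs_mono[OF ob ord_trans[OF ob b(2) c(2)[OF that]]] unfolding subset_def by blast
  have a'': "sat E {x. x \<^bold>\<in> Vs b} (case_nat y (case_nat U ?a)) \<phi> \<longleftrightarrow> y = x" if y: "y \<^bold>\<in> Vs b" for y
  proof -
    have "sat E {x. x \<^bold>\<in> Vs b} (case_nat y (case_nat U ?a)) \<phi> \<longleftrightarrow> sat E UNIV (case_nat y (case_nat U ?a)) \<phi>"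
      by (rule h(3)[OF b(1) b(3)]) (use y inV in \<open>auto split: nat.split\<close>)
    then show ?thesis using a' by simp
  qed
  let ?ps = "U # map a [0..<?k]"
  have odV: "od U (Vs b)" by (rule od_basic[OF ob])
  obtain S where S: "od U S" "represents (Vs b) (Suc (Suc ?k)) (\<lambda>xs. sat E {x. x \<^bold>\<in> Vs b} (\<lambda>i. xs ! i) \<phi>) S"
    using od_rel_sat[OF odV, of \<phi> "Suc (Suc ?k)"] unfolding od_rel_def by auto
  have sat: "sat E {x. x \<^bold>\<in> Vs b} (\<lambda>i. (y # ?ps) ! i) \<phi> \<longleftrightarrow> y = x" if "y \<^bold>\<in> Vs b" for y
    unfolding a''[OF that, symmetric] by (rule sat_cong) (auto split: nat.split)
  have odt: "od U (tup ?ps)"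
    by (rule od_tup) (use a(1) od_basic(1) od_basic(3)[OF ord_emp] in auto)
  have "Uni (sec S (tup ?ps)) = x"
  proof (rule ext)
    have "y \<^bold>\<in> sec S (tup ?ps) \<longleftrightarrow> y = x" for y
    proof
      assume "y \<^bold>\<in> sec S (tup ?ps)"
      then obtain p where p: "p \<^bold>\<in> S" "sn p = tup ?ps" "y = fs p" unfolding mem_sec by blast
      then obtain xs where xs: "length xs = Suc (Suc ?k)" "\<forall>x\<in>set xs. x \<^bold>\<in> Vs b"
        "sat E {x. x \<^bold>\<in> Vs b} (\<lambda>i. xs ! i) \<phi>" "p = tup xs" unfolding represents_iff[OF S(2)] by blast
      then obtain z zs where z: "xs = z # zs" "length zs = Suc ?k" by (cases xs) auto
      have "tup zs = tup ?ps" "y = z" using p xs(4) z by auto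
      then have "zs = ?ps" using tup_inject[of zs ?ps] z(2) by simp
      then show "y = x" using sat[of z] xs z \<open>y = z\<close> by simp
    next
      assume y: "y = x"
      have "sat E {x. x \<^bold>\<in> Vs b} (\<lambda>i. (y # ?ps) ! i) \<phi>" using sat[of y] inV y by simp
      moreover have "length (y # ?ps) = Suc (Suc ?k)" by simp
      moreover have "z \<^bold>\<in> Vs b" if "z \<in> set (y # ?ps)" for z using inV y that by auto
      ultimately have "tup (y # ?ps) \<^bold>\<in> S" using represents_tup[OF S(2)] by blast
      then show "y \<^bold>\<in> sec S (tup ?ps)" unfolding mem_sec by (intro exI[of _ "tup (y # ?ps)"]) simp
    qed
    then show "z \<^bold>\<in> Uni (sec S (tup ?ps)) \<longleftrightarrow> z \<^bold>\<in> x" for z by auto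
  qed
  moreover have "od U (Uni (sec S (tup ?ps)))"
    by (rule od_ops(2)[OF od_ops(7)[OF S(1) odt] odV])
  ultimately show ?thesis by simp
qed

text \<open>The notion with its external quantifier over formulas agrees with a single formula; this
  is what makes \<kappa>-OD and \<kappa>-HOD classes of the model.\<close>

lemma OD_from_iff: "x \<in> OD_from U \<longleftrightarrow> od U x"
  using defn_OD_from[of "\<lambda>_. emp"] od_dterm dterm_od by auto

lemma od_iff: "od U x \<longleftrightarrow> dterm (insert U {a. ordinal a}) (\<lambda>e. x)"
  using od_dterm dterm_od by auto

section \<open>Cardinality\<close>

lemma is_pair_dfn [THEN defn_lift3, dfn]:
  "defn {} (\<lambda>e. is_pair (e 0) (e 1) (e 2))"
  unfolding is_pair_iff by (intro dfn)

lemma maps_to_dfn [THEN defn_lift3, dfn]: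
  "defn {} (\<lambda>e. maps_to (e 0) (e 1) (e 2))"
  unfolding maps_to_def by (intro dfn)

lemma is_function_dfn [THEN defn_lift3, dfn]:
  "defn {} (\<lambda>e. is_function (e 0) (e 1) (e 2))"
  unfolding is_function_def by (intro dfn)

lemma is_bijection_dfn [THEN defn_lift3, dfn]:
  "defn {} (\<lambda>e. is_bijection (e 0) (e 1) (e 2))"
  unfolding is_bijection_def by (intro dfn)

lemma equinumerous_dfn [THEN defn_lift2, dfn]:
  "defn {} (\<lambda>e. equinumerous (e 0) (e 1))"
  unfolding equinumerous_def by (intro dfn)

lemma smaller_than_dfn [THEN defn_lift2, dfn]:
  "defn {} (\<lambda>e. smaller_than (e 0) (e 1))"
  unfolding smaller_than_def by (intro dfn)

definition bij :: "('v \<Rightarrow> 'v) \<Rightarrow> 'v \<Rightarrow> 'v \<Rightarrow> bool" where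
  "bij f a b \<longleftrightarrow> (\<forall>x. x \<^bold>\<in> a \<longrightarrow> f x \<^bold>\<in> b) \<and> (\<forall>x y. x \<^bold>\<in> a \<longrightarrow> y \<^bold>\<in> a \<longrightarrow> f x = f y \<longrightarrow> x = y)
     \<and> (\<forall>y. y \<^bold>\<in> b \<longrightarrow> (\<exists>x. x \<^bold>\<in> a \<and> f x = y))"

lemma is_function_ap:
  assumes "is_function g a b" "x \<^bold>\<in> a" shows "ap g x \<^bold>\<in> b" "pr x y \<^bold>\<in> g \<longleftrightarrow> y = ap g x"
proof -
  obtain y' where y': "pr x y' \<^bold>\<in> g" "\<And>z. pr x z \<^bold>\<in> g \<Longrightarrow> z = y'"
    using assms unfolding is_function_def maps_to_iff by blast
  have "ap g x = y'" unfolding ap_def by (rule iota_eq) (fact y')+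
  with y' show "pr x y \<^bold>\<in> g \<longleftrightarrow> y = ap g x" by blast
  have "\<exists>x' z. z \<^bold>\<in> b \<and> pr x y' = pr x' z" using assms(1) y'(1) unfolding is_function_def is_pair_iff by blast
  then show "ap g x \<^bold>\<in> b" using \<open>ap g x = y'\<close> by simp
qed

lemma is_function_lam:
  assumes "dF f" "\<And>x. x \<^bold>\<in> a \<Longrightarrow> f x \<^bold>\<in> b" shows "is_function (lam a f) a b"
  unfolding is_function_def maps_to_iff is_pair_iff mem_lam[OF assms(1)] using assms(2) by auto

lemma equinumerous_iff: "equinumerous a b \<longleftrightarrow> (\<exists>f. dF f \<and> bij f a b)"
proof
  assume "equinumerous a b"
  then obtain g where g: "is_function g a b" "\<And>y. y \<^bold>\<in> b \<Longrightarrow> \<exists>!x. pr x y \<^bold>\<in> g"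
    unfolding equinumerous_def is_bijection_def maps_to_iff by blast
  have p: "p \<^bold>\<in> g \<Longrightarrow> \<exists>x y. x \<^bold>\<in> a \<and> p = pr x y" for p
    using g(1) unfolding is_function_def is_pair_iff by blast
  have "bij (ap g) a b" unfolding bij_def
  proof (intro conjI allI impI)
    show "ap g x \<^bold>\<in> b" if "x \<^bold>\<in> a" for x by (rule is_function_ap(1)[OF g(1) that])
    show "x = y" if "x \<^bold>\<in> a" "y \<^bold>\<in> a" "ap g x = ap g y" for x y
      using that g(2)[of "ap g x"] is_function_ap[OF g(1)] by metis
    show "\<exists>x. x \<^bold>\<in> a \<and> ap g x = y" if y: "y \<^bold>\<in> b" for y
    proof -
      obtain x where x: "pr x y \<^bold>\<in> g" using g(2)[OF y] by blast
      then have "x \<^bold>\<in> a" using p[OF x] by auto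
      then show ?thesis using is_function_ap(2)[OF g(1), of x y] x by auto
    qed
  qed
  moreover have "dF (ap g)" by (intro dfn)
  ultimately show "\<exists>f. dF f \<and> bij f a b" by blast
next
  assume "\<exists>f. dF f \<and> bij f a b"
  then obtain f where f: "dF f" "bij f a b" by blast
  have "is_bijection (lam a f) a b" unfolding is_bijection_def maps_to_iff mem_lam[OF f(1)]
    using f(2) is_function_lam[OF f(1), of a b] unfolding bij_def pr_inject by blast
  then show "equinumerous a b" unfolding equinumerous_def by blast
qed

lemma bij_inverse:
  assumes "dF f" "bij f a b"
  shows "\<exists>g. dF g \<and> bij g b a \<and> (\<forall>x. x \<^bold>\<in> a \<longrightarrow> g (f x) = x) \<and> (\<forall>y. y \<^bold>\<in> b \<longrightarrow> f (g y) = y)"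
proof -
  define g where "g y = iota (\<lambda>x. x \<^bold>\<in> a \<and> f x = y)" for y
  have "dF g" unfolding g_def by (intro dfn dF_comp[OF assms(1)])
  moreover have gf: "g (f x) = x" if "x \<^bold>\<in> a" for x
    unfolding g_def by (rule iota_eq) (use that assms(2) in \<open>auto simp: bij_def\<close>)
  moreover have "f (g y) = y \<and> g y \<^bold>\<in> a" if y: "y \<^bold>\<in> b" for y
  proof -
    obtain x where "x \<^bold>\<in> a" "f x = y" using assms(2) y unfolding bij_def by blast
    then show ?thesis using gf by auto
  qed
  moreover from calculation have "bij g b a" using assms(2) unfolding bij_def by metis
  ultimately show ?thesis by blast
qed

lemma equinumerous_trans: "equinumerous a b \<Longrightarrow> equinumerous b c \<Longrightarrow> equinumerous a c"
proof -
  assume "equinumerous a b" "equinumerous b c"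
  then obtain f g where fg: "dF f" "bij f a b" "dF g" "bij g b c" unfolding equinumerous_iff by blast
  have "dF (\<lambda>x. g (f x))" by (intro dF_comp[OF fg(3)] fg(1))
  moreover have "bij (\<lambda>x. g (f x)) a c" using fg(2,4) unfolding bij_def by metis
  ultimately show ?thesis unfolding equinumerous_iff by (intro exI[of _ "\<lambda>x. g (f x)"] conjI)
qed

lemma enum_bij:
  assumes s: "dF s" and sel: "\<And>S. (\<exists>x. x \<^bold>\<in> A \<and> \<not> x \<^bold>\<in> S) \<Longrightarrow> s S \<^bold>\<in> A \<and> \<not> s S \<^bold>\<in> S"
  shows "\<exists>t. ordinal t \<and> bij (enum s) t A \<and> (\<forall>a. a \<^bold>\<in> t \<longrightarrow> (\<exists>x. x \<^bold>\<in> A \<and> \<not> x \<^bold>\<in> img a (enum s)))"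
proof -
  obtain t where t: "ordinal t"
    "\<And>a. a \<^bold>\<in> t \<Longrightarrow> enum s a \<^bold>\<in> A" "\<And>a b. a \<^bold>\<in> t \<Longrightarrow> b \<^bold>\<in> a \<Longrightarrow> enum s b \<noteq> enum s a"
    "\<And>a. a \<^bold>\<in> t \<Longrightarrow> \<exists>x. x \<^bold>\<in> A \<and> \<not> x \<^bold>\<in> img a (enum s)"
    "\<And>x. x \<^bold>\<in> A \<Longrightarrow> idx s x \<^bold>\<in> t \<and> enum s (idx s x) = x"
    using enum_set[OF s sel] by blast
  have "a = b" if "a \<^bold>\<in> t" "b \<^bold>\<in> t" "enum s a = enum s b" for a b
    using ord_linear[OF ord_mem[OF t(1) that(1)] ord_mem[OF t(1) that(2)]] t(3) that by metis
  then have "bij (enum s) t A" unfolding bij_def using t(2,5) by blast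
  then show ?thesis using t(1,4) by blast
qed

text \<open>Listing \<open>t\<close> in increasing order of \<open>k\<close> yields an ordinal
  \<open>b\<close>; the element listed at \<open>c\<close> has \<open>k\<close>-value at least
  \<open>c\<close>, so \<open>b\<close> cannot exceed \<open>a\<close>.\<close>

lemma order_type:
  assumes k: "dF k" "ordinal a" "\<And>y. y \<^bold>\<in> t \<Longrightarrow> k y \<^bold>\<in> a" "\<And>y z. y \<^bold>\<in> t \<Longrightarrow> z \<^bold>\<in> t \<Longrightarrow> k y = k z \<Longrightarrow> y = z"
  shows "\<exists>b. ordinal b \<and> b \<^bold>\<subseteq> a \<and> equinumerous b t"
proof -
  define s where "s S = iota (\<lambda>y. y \<^bold>\<in> t \<and> \<not> y \<^bold>\<in> S \<and> (\<forall>z. z \<^bold>\<in> t \<longrightarrow> \<not> z \<^bold>\<in> S \<longrightarrow> \<not> k z \<^bold>\<in> k y))" for S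
  note kc = dF_comp[OF k(1)]
  have ds: "dF s" unfolding s_def by (intro dfn kc)
  have ok: "ordinal (k y)" if "y \<^bold>\<in> t" for y using ord_mem[OF k(2) k(3)[OF that]] .
  have sel: "s S \<^bold>\<in> t \<and> \<not> s S \<^bold>\<in> S \<and> (\<forall>z. z \<^bold>\<in> t \<longrightarrow> \<not> z \<^bold>\<in> S \<longrightarrow> \<not> k z \<^bold>\<in> k (s S))"
    if ex: "\<exists>x. x \<^bold>\<in> t \<and> \<not> x \<^bold>\<in> S" for S
  proof -
    let ?P = "\<lambda>c. \<exists>x. x \<^bold>\<in> t \<and> \<not> x \<^bold>\<in> S \<and> k x = c"
    have "dP ?P" by (intro dfn kc)
    moreover obtain x where "x \<^bold>\<in> t" "\<not> x \<^bold>\<in> S" using ex by blast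
    ultimately obtain c where c: "?P c" "\<And>d. d \<^bold>\<in> c \<Longrightarrow> \<not> ?P d"
      using ord_minimal[of ?P "k x"] ok by blast
    then obtain y where y: "y \<^bold>\<in> t" "\<not> y \<^bold>\<in> S" "k y = c" by blast
    show ?thesis unfolding s_def
    proof (rule iotaI)
      show "y \<^bold>\<in> t \<and> \<not> y \<^bold>\<in> S \<and> (\<forall>z. z \<^bold>\<in> t \<longrightarrow> \<not> z \<^bold>\<in> S \<longrightarrow> \<not> k z \<^bold>\<in> k y)" using y c(2) by blast
      fix y' assume y': "y' \<^bold>\<in> t \<and> \<not> y' \<^bold>\<in> S \<and> (\<forall>z. z \<^bold>\<in> t \<longrightarrow> \<not> z \<^bold>\<in> S \<longrightarrow> \<not> k z \<^bold>\<in> k y')"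
      then have "k y' = k y" using ord_linear[OF ok ok, of y' y] y c(2) by blast
      then show "y' = y" using k(4) y(1) y' by blast
    qed
  qed
  then have "s S \<^bold>\<in> t \<and> \<not> s S \<^bold>\<in> S" if "\<exists>x. x \<^bold>\<in> t \<and> \<not> x \<^bold>\<in> S" for S using that by blast
  from enum_bij[OF ds this] obtain b where b: "ordinal b" "bij (enum s) b t"
    "\<And>c. c \<^bold>\<in> b \<Longrightarrow> \<exists>x. x \<^bold>\<in> t \<and> \<not> x \<^bold>\<in> img c (enum s)" by blast
  have de: "dF (enum s)" by (intro dfn dF_comp[OF ds])
  have en: "enum s c \<^bold>\<in> t" if "c \<^bold>\<in> b" for c using b(2) that unfolding bij_def by blast
  have inj: "c = d" if "c \<^bold>\<in> b" "d \<^bold>\<in> b" "enum s c = enum s d" for c d using b(2) that unfolding bij_def by blast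
  have le: "c \<^bold>\<in> b \<longrightarrow> \<not> k (enum s c) \<^bold>\<in> c" if "ordinal c" for c
  proof (rule ord_induct[where P = "\<lambda>c. c \<^bold>\<in> b \<longrightarrow> \<not> k (enum s c) \<^bold>\<in> c", OF _ _ that])
    show "dP (\<lambda>c. c \<^bold>\<in> b \<longrightarrow> \<not> k (enum s c) \<^bold>\<in> c)" by (intro dfn kc dF_comp[OF ds])
    fix c assume c: "ordinal c" "\<And>d. d \<^bold>\<in> c \<Longrightarrow> d \<^bold>\<in> b \<longrightarrow> \<not> k (enum s d) \<^bold>\<in> d"
    show "c \<^bold>\<in> b \<longrightarrow> \<not> k (enum s c) \<^bold>\<in> c"
    proof (intro impI notI)
      assume cb: "c \<^bold>\<in> b" and d: "k (enum s c) \<^bold>\<in> c"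
      \<comment> \<open>At a counterexample \<open>c\<close>, monotonicity makes \<open>?d\<close> a
        smaller counterexample.\<close>
      let ?d = "k (enum s c)"
      have db: "?d \<^bold>\<in> b" using ord_trans[OF b(1) cb d] .
      have "\<not> enum s c \<^bold>\<in> img ?d (enum s)"
      proof
        assume "enum s c \<^bold>\<in> img ?d (enum s)"
        then obtain e where e: "e \<^bold>\<in> ?d" "enum s c = enum s e" unfolding mem_img[OF de] by blast
        then have "c = e" using inj[OF cb ord_trans[OF b(1) db e(1)]] by blast
        then show False using e(1) d mem_asym by blast
      qed
      then have "\<not> k (enum s c) \<^bold>\<in> k (enum s ?d)"
        using sel[of "img ?d (enum s)"] b(3)[OF db] en[OF cb] enum_eq[OF ds ord_mem[OF b(1) db]] by simp
      moreover have "k (enum s ?d) \<noteq> k (enum s c)"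
        using k(4)[OF en[OF db] en[OF cb]] inj[OF db cb] d mem_irrefl by metis
      ultimately have "k (enum s ?d) \<^bold>\<in> ?d" using ord_linear[OF ok[OF en[OF db]] ok[OF en[OF cb]]] by blast
      then show False using c(2)[OF d] db by blast
    qed
  qed
  have "b \<^bold>\<subseteq> a" unfolding subset_def
  proof (intro allI impI)
    fix c assume c: "c \<^bold>\<in> b"
    have oc: "ordinal c" using ord_mem[OF b(1) c] .
    have "c \<^bold>\<in> k (enum s c) \<or> c = k (enum s c)" using le[OF oc] c ord_linear[OF ok[OF en[OF c]] oc] by auto
    then show "c \<^bold>\<in> a" using k(3)[OF en[OF c]] ord_trans[OF k(2)] by metis
  qed
  then show ?thesis using b(1,2) de unfolding equinumerous_iff by blast
qed

text \<open>Each element of \<open>t\<close> is indexed by the least ordinal naming a preimage; the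
  order type of these indices replaces an appeal to choice.\<close>

lemma smaller_than_image:
  assumes "smaller_than s c" "ordinal c" "dF h" "\<And>y. y \<^bold>\<in> t \<Longrightarrow> \<exists>x. x \<^bold>\<in> s \<and> h x = y"
  shows "smaller_than t c"
proof -
  obtain a f where a: "a \<^bold>\<in> c" "dF f" "bij f a s"
    using assms(1) unfolding smaller_than_def equinumerous_iff by blast
  have oa: "ordinal a" using ord_mem[OF assms(2) a(1)] .
  define k where "k y = least (\<lambda>x. x \<^bold>\<in> a \<and> h (f x) = y)" for y
  have dk: "dF k" unfolding k_def by (intro dfn dF_comp[OF assms(3)] dF_comp[OF a(2)])
  have k: "k y \<^bold>\<in> a \<and> h (f (k y)) = y" if y: "y \<^bold>\<in> t" for y
  proof -
    have d: "dP (\<lambda>x. x \<^bold>\<in> a \<and> h (f x) = y)" by (intro dfn dF_comp[OF assms(3)] dF_comp[OF a(2)])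
    obtain x where x: "x \<^bold>\<in> s" "h x = y" using assms(4)[OF y] by blast
    obtain z where "z \<^bold>\<in> a" "f z = x" using a(3) x(1) unfolding bij_def by blast
    then show ?thesis using least(2)[OF d, of z] x(2) ord_mem[OF oa] unfolding k_def by blast
  qed
  have "\<exists>b. ordinal b \<and> b \<^bold>\<subseteq> a \<and> equinumerous b t"
    by (rule order_type[OF dk oa]) (use k in metis)+
  then obtain b where b: "ordinal b" "b \<^bold>\<subseteq> a" "equinumerous b t" by blast
  then have "b \<^bold>\<in> c" using ord_subset[OF b(1) oa] a(1) ord_trans[OF assms(2)] by metis
  then show ?thesis using b(3) unfolding smaller_than_def by blast
qed

section \<open>Complete ultrafilters\<close>

lemma sep_cong: "(\<And>x. x \<^bold>\<in> a \<Longrightarrow> P x \<longleftrightarrow> Q x) \<Longrightarrow> sep a P = sep a Q"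
proof -
  assume *: "\<And>x. x \<^bold>\<in> a \<Longrightarrow> P x \<longleftrightarrow> Q x"
  have "(\<lambda>b. \<forall>z. z \<^bold>\<in> b \<longleftrightarrow> z \<^bold>\<in> a \<and> P z) = (\<lambda>b. \<forall>z. z \<^bold>\<in> b \<longleftrightarrow> z \<^bold>\<in> a \<and> Q z)"
    using * by (simp cong: conj_cong)
  then show ?thesis unfolding sep_def by simp
qed

lemma sep_subset: "dP P \<Longrightarrow> sep a P \<^bold>\<subseteq> a"
  unfolding subset_def by (simp add: mem_sep)

lemma sep_mem: "A \<^bold>\<subseteq> X \<Longrightarrow> sep X (\<lambda>z. z \<^bold>\<in> A) = A"
proof -
  assume A: "A \<^bold>\<subseteq> X"
  have d: "dP (\<lambda>z. z \<^bold>\<in> A)" by (intro dfn)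
  show ?thesis by (rule ext) (use A in \<open>auto simp: mem_sep[OF d] subset_def\<close>)
qed

lemma ultrafilter_over_dfn [THEN defn_lift2, dfn]:
  "defn {} (\<lambda>e. ultrafilter_over (e 0) (e 1))"
  unfolding ultrafilter_over_def by (intro dfn)

lemma complete_ultrafilter_over_dfn [THEN defn_lift3, dfn]:
  "defn {} (\<lambda>e. complete_ultrafilter_over (e 0) (e 1) (e 2))"
  unfolding complete_ultrafilter_over_def by (intro dfn)

text \<open>For an ultrafilter \<open>U\<close> over \<open>X\<close> this says that \<open>P\<close> holds \<open>U\<close>-almost everywhere.\<close>

abbreviation big :: "'v \<Rightarrow> 'v \<Rightarrow> ('v \<Rightarrow> bool) \<Rightarrow> bool" where
  "big U X P \<equiv> sep X P \<^bold>\<in> U"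

context
  fixes X U assumes U: "ultrafilter_over X U"
begin

lemma uf_subset: "A \<^bold>\<in> U \<Longrightarrow> A \<^bold>\<subseteq> X"
  and uf_top: "X \<^bold>\<in> U"
  and uf_nonempty: "A \<^bold>\<in> U \<Longrightarrow> \<exists>z. z \<^bold>\<in> A"
  and uf_upward: "A \<^bold>\<in> U \<Longrightarrow> A \<^bold>\<subseteq> B \<Longrightarrow> B \<^bold>\<subseteq> X \<Longrightarrow> B \<^bold>\<in> U"
  and uf_inter: "A \<^bold>\<in> U \<Longrightarrow> B \<^bold>\<in> U \<Longrightarrow> (\<And>z. z \<^bold>\<in> C \<longleftrightarrow> z \<^bold>\<in> A \<and> z \<^bold>\<in> B) \<Longrightarrow> C \<^bold>\<in> U"
  and uf_compl: "A \<^bold>\<subseteq> X \<Longrightarrow> (\<And>z. z \<^bold>\<in> B \<longleftrightarrow> z \<^bold>\<in> X \<and> \<not> z \<^bold>\<in> A) \<Longrightarrow> A \<^bold>\<in> U \<or> B \<^bold>\<in> U"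
  using U unfolding ultrafilter_over_def by blast+

lemma big_mono: "dP P \<Longrightarrow> dP Q \<Longrightarrow> big U X P \<Longrightarrow> (\<And>z. z \<^bold>\<in> X \<Longrightarrow> P z \<Longrightarrow> Q z) \<Longrightarrow> big U X Q"
  by (rule uf_upward) (auto simp: mem_sep subset_def)

lemma big_all: "dP P \<Longrightarrow> (\<And>z. z \<^bold>\<in> X \<Longrightarrow> P z) \<Longrightarrow> big U X P"
  by (rule uf_upward[OF uf_top]) (auto simp: mem_sep subset_def)

lemma big_conj: "dP P \<Longrightarrow> dP Q \<Longrightarrow> big U X P \<Longrightarrow> big U X Q \<Longrightarrow> big U X (\<lambda>z. P z \<and> Q z)"
  by (rule uf_inter[of "sep X P" "sep X Q"]) (auto simp: mem_sep defn_and)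

lemma big_ex: "dP P \<Longrightarrow> big U X P \<Longrightarrow> \<exists>z. z \<^bold>\<in> X \<and> P z"
  using uf_nonempty by (metis mem_sep)

lemma big_not: assumes P: "dP P" shows "big U X (\<lambda>z. \<not> P z) \<longleftrightarrow> \<not> big U X P"
proof
  note nP = defn_not[OF P]
  show "\<not> big U X P" if n: "big U X (\<lambda>z. \<not> P z)"
  proof
    assume "big U X P"
    then show False using big_ex[OF defn_and[OF P nP] big_conj[OF P nP _ n]] by blast
  qed
  show "big U X (\<lambda>z. \<not> P z)" if "\<not> big U X P"
    using that uf_compl[OF sep_subset[OF P], of "sep X (\<lambda>z. \<not> P z)"] mem_sep[OF P] mem_sep[OF nP] by blast
qed

lemma big_const: "big U X (\<lambda>z. c) \<longleftrightarrow> c"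
proof (cases c)
  case True
  have "big U X (\<lambda>z. True)" by (rule big_all) (intro dfn, simp)
  with True show ?thesis by simp
next
  case False
  have "\<not> big U X (\<lambda>z. False)" using big_ex[OF defn_False] by blast
  with False show ?thesis by simp
qed

lemma big_mem: "A \<^bold>\<subseteq> X \<Longrightarrow> big U X (\<lambda>z. z \<^bold>\<in> A) \<longleftrightarrow> A \<^bold>\<in> U"
  by (simp add: sep_mem)

end

lemma kuf_uf: "complete_ultrafilter_over k X U \<Longrightarrow> ultrafilter_over X U"
  unfolding complete_ultrafilter_over_def by blast

lemma big_complete:
  assumes U: "complete_ultrafilter_over k X U" and k: "ordinal k" and I: "smaller_than I k"
    and R: "defn UNIV (\<lambda>e. R (e 0) (e 1))" and b: "\<And>i. i \<^bold>\<in> I \<Longrightarrow> big U X (R i)"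
  shows "big U X (\<lambda>z. \<forall>i. i \<^bold>\<in> I \<longrightarrow> R i z)"
proof -
  note Rc = defn_comp2[OF R subset_UNIV]
  have Ri: "dP (R i)" for i by (intro dfn Rc)
  let ?h = "\<lambda>i. sep X (R i)"
  have h: "dF ?h" by (intro dfn Rc)
  have "smaller_than (img I ?h) k"
    by (rule smaller_than_image[OF I k h]) (auto simp: mem_img[OF h])
  moreover have "img I ?h \<^bold>\<subseteq> U" using b by (auto simp: subset_def mem_img[OF h])
  moreover have d: "dP (\<lambda>z. \<forall>i. i \<^bold>\<in> I \<longrightarrow> R i z)" by (intro dfn Rc)
  have "z \<^bold>\<in> sep X (\<lambda>z. \<forall>i. i \<^bold>\<in> I \<longrightarrow> R i z) \<longleftrightarrow> z \<^bold>\<in> X \<and> (\<forall>A. A \<^bold>\<in> img I ?h \<longrightarrow> z \<^bold>\<in> A)" for z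
    unfolding mem_sep[OF d] mem_img[OF h] using mem_sep[OF Ri] by blast
  ultimately show ?thesis using U unfolding complete_ultrafilter_over_def by blast
qed

section \<open>Construction of complete ultrafilters\<close>

lemma kufI:
  assumes Q: "dP Q" and top: "Q Y"
    and ne: "\<And>A. A \<^bold>\<subseteq> Y \<Longrightarrow> Q A \<Longrightarrow> \<exists>z. z \<^bold>\<in> A"
    and up: "\<And>A B. Q A \<Longrightarrow> A \<^bold>\<subseteq> B \<Longrightarrow> B \<^bold>\<subseteq> Y \<Longrightarrow> Q B"
    and int: "\<And>A B C. Q A \<Longrightarrow> Q B \<Longrightarrow> (\<And>z. z \<^bold>\<in> C \<longleftrightarrow> z \<^bold>\<in> A \<and> z \<^bold>\<in> B) \<Longrightarrow> Q C"
    and compl: "\<And>A B. A \<^bold>\<subseteq> Y \<Longrightarrow> (\<And>z. z \<^bold>\<in> B \<longleftrightarrow> z \<^bold>\<in> Y \<and> \<not> z \<^bold>\<in> A) \<Longrightarrow> Q A \<or> Q B"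
    and kint: "\<And>S C. (\<And>A. A \<^bold>\<in> S \<Longrightarrow> Q A) \<Longrightarrow> smaller_than S k \<Longrightarrow>
       (\<And>z. z \<^bold>\<in> C \<longleftrightarrow> z \<^bold>\<in> Y \<and> (\<forall>A. A \<^bold>\<in> S \<longrightarrow> z \<^bold>\<in> A)) \<Longrightarrow> Q C"
  shows "complete_ultrafilter_over k Y (sep (Pw Y) Q)"
  unfolding complete_ultrafilter_over_def ultrafilter_over_def mem_sep[OF Q] mem_Pw
proof (intro conjI allI impI)
  show "Y \<^bold>\<subseteq> Y" by (simp add: subset_def)
  show "Q Y" by (rule top)
  fix A B C
  show "A \<^bold>\<subseteq> Y" if "A \<^bold>\<subseteq> Y \<and> Q A" using that by blast
  show "\<exists>z. z \<^bold>\<in> A" if "A \<^bold>\<subseteq> Y \<and> Q A" using that ne by blast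
  show "B \<^bold>\<subseteq> Y" if "B \<^bold>\<subseteq> Y" by (rule that)
  show "Q B" if "A \<^bold>\<subseteq> Y \<and> Q A" "A \<^bold>\<subseteq> B" "B \<^bold>\<subseteq> Y" using that up by blast
  show "C \<^bold>\<subseteq> Y" if "A \<^bold>\<subseteq> Y \<and> Q A" "\<forall>z. z \<^bold>\<in> C \<longleftrightarrow> z \<^bold>\<in> A \<and> z \<^bold>\<in> B" using that unfolding subset_def by blast
  show "Q C" if "A \<^bold>\<subseteq> Y \<and> Q A" "B \<^bold>\<subseteq> Y \<and> Q B" "\<forall>z. z \<^bold>\<in> C \<longleftrightarrow> z \<^bold>\<in> A \<and> z \<^bold>\<in> B" using that int by blast
  show "A \<^bold>\<subseteq> Y \<and> Q A \<or> B \<^bold>\<subseteq> Y \<and> Q B" if "A \<^bold>\<subseteq> Y" "\<forall>z. z \<^bold>\<in> B \<longleftrightarrow> z \<^bold>\<in> Y \<and> \<not> z \<^bold>\<in> A"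
    using that compl unfolding subset_def by blast
next
  fix S C assume S: "S \<^bold>\<subseteq> sep (Pw Y) Q" "smaller_than S k" "\<forall>z. z \<^bold>\<in> C \<longleftrightarrow> z \<^bold>\<in> Y \<and> (\<forall>A. A \<^bold>\<in> S \<longrightarrow> z \<^bold>\<in> A)"
  show "C \<^bold>\<subseteq> Y" using S(3) unfolding subset_def by blast
  show "Q C" by (rule kint[OF _ S(2)]) (use S(1,3) in \<open>auto simp: subset_def mem_sep[OF Q]\<close>)
qed

text \<open>The trivial ultrafilter over the ordinal 1. It is the parameter of definitions from
  ordinals alone, and as a second factor it makes the image of an ultrafilter a case of the Fubini
  product.\<close>

lemma kuf_principal: "complete_ultrafilter_over k (num 1) (sep (Pw (num 1)) (\<lambda>A. emp \<^bold>\<in> A))"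
  by (rule kufI) (intro dfn, auto simp: subset_def)

text \<open>The quantifier "for almost all" is iterated, and each property is checked for
  \<open>W\<close> inside and then for \<open>U\<close> outside. The map \<open>f\<close> transports
  the product to \<open>Y\<close> at the same time.\<close>

lemma kuf_fubini:
  assumes U: "complete_ultrafilter_over k X U" and W: "complete_ultrafilter_over k Z W" and k: "ordinal k"
    and f: "dterm UNIV (\<lambda>e. f (e 0) (e 1))" "\<And>x z. x \<^bold>\<in> X \<Longrightarrow> z \<^bold>\<in> Z \<Longrightarrow> f x z \<^bold>\<in> Y"
  shows "complete_ultrafilter_over k Y (sep (Pw Y) (\<lambda>A. big U X (\<lambda>x. big W Z (\<lambda>z. f x z \<^bold>\<in> A))))"
    (is "complete_ultrafilter_over k Y (sep (Pw Y) ?Q)")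
proof -
  note U' = kuf_uf[OF U] and W' = kuf_uf[OF W]
  note fc = dterm_comp2[OF f(1) subset_UNIV]
  have d1: "dP (\<lambda>z. f x z \<^bold>\<in> A)" for x A by (intro dfn fc)
  have d2: "dP (\<lambda>x. big W Z (\<lambda>z. f x z \<^bold>\<in> A))" for A by (intro dfn fc)
  have mono: "?Q B" if "?Q A" "\<And>x z. x \<^bold>\<in> X \<Longrightarrow> z \<^bold>\<in> Z \<Longrightarrow> f x z \<^bold>\<in> A \<Longrightarrow> f x z \<^bold>\<in> B" for A B
    by (rule big_mono[OF U' d2 d2 that(1)], rule big_mono[OF W' d1 d1]) (use that(2) in blast)+
  show ?thesis
  proof (rule kufI)
    show "dP ?Q" by (intro dfn fc)
    show "?Q Y" by (rule big_all[OF U' d2], rule big_all[OF W' d1], rule f(2))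
    show "\<exists>z. z \<^bold>\<in> A" if "?Q A" for A using big_ex[OF U' d2 that] big_ex[OF W' d1] by blast
    show "?Q B" if "?Q A" "A \<^bold>\<subseteq> B" for A B using mono[OF that(1)] that(2) unfolding subset_def by blast
    show "?Q C" if "?Q A" "?Q B" "\<And>z. z \<^bold>\<in> C \<longleftrightarrow> z \<^bold>\<in> A \<and> z \<^bold>\<in> B" for A B C
    proof -
      have "big U X (\<lambda>x. big W Z (\<lambda>z. f x z \<^bold>\<in> A) \<and> big W Z (\<lambda>z. f x z \<^bold>\<in> B))"
        by (rule big_conj[OF U' d2 d2 that(1,2)])
      then show ?thesis
      proof (rule big_mono[OF U' defn_and[OF d2 d2] d2])
        fix x assume "big W Z (\<lambda>z. f x z \<^bold>\<in> A) \<and> big W Z (\<lambda>z. f x z \<^bold>\<in> B)"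
        then have "big W Z (\<lambda>z. f x z \<^bold>\<in> A \<and> f x z \<^bold>\<in> B)" using big_conj[OF W' d1 d1] by blast
        then show "big W Z (\<lambda>z. f x z \<^bold>\<in> C)" unfolding that(3) .
      qed
    qed
    show "?Q A \<or> ?Q B" if "\<And>z. z \<^bold>\<in> B \<longleftrightarrow> z \<^bold>\<in> Y \<and> \<not> z \<^bold>\<in> A" for A B
    proof (rule disjCI)
      assume "\<not> ?Q B"
      then have "big U X (\<lambda>x. \<not> big W Z (\<lambda>z. f x z \<^bold>\<in> B))" using big_not[OF U' d2] by blast
      then show "?Q A"
      proof (rule big_mono[OF U' defn_not[OF d2] d2])
        fix x assume x: "x \<^bold>\<in> X" "\<not> big W Z (\<lambda>z. f x z \<^bold>\<in> B)"
        then have "big W Z (\<lambda>z. \<not> f x z \<^bold>\<in> B)" using big_not[OF W' d1] by blast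
        then show "big W Z (\<lambda>z. f x z \<^bold>\<in> A)"
          by (rule big_mono[OF W' defn_not[OF d1] d1]) (use that f(2)[OF x(1)] in blast)
      qed
    qed
    show "?Q C" if S: "\<And>A. A \<^bold>\<in> S \<Longrightarrow> ?Q A" "smaller_than S k"
      "\<And>z. z \<^bold>\<in> C \<longleftrightarrow> z \<^bold>\<in> Y \<and> (\<forall>A. A \<^bold>\<in> S \<longrightarrow> z \<^bold>\<in> A)" for S C
    proof -
      let ?R = "\<lambda>A x. big W Z (\<lambda>z. f x z \<^bold>\<in> A)"
      have R: "defn UNIV (\<lambda>e. ?R (e 0) (e 1))" by (intro dfn fc)
      have "big U X (\<lambda>x. \<forall>A. A \<^bold>\<in> S \<longrightarrow> ?R A x)"
        by (rule big_complete[where R = ?R, OF U k S(2) R S(1)])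
      then show ?thesis
      proof (rule big_mono[OF U', rotated 2])
        show "dP (\<lambda>x. \<forall>A. A \<^bold>\<in> S \<longrightarrow> ?R A x)" by (intro dfn fc)
        show "dP (\<lambda>x. big W Z (\<lambda>z. f x z \<^bold>\<in> C))" by (rule d2)
        fix x assume x: "x \<^bold>\<in> X" "\<forall>A. A \<^bold>\<in> S \<longrightarrow> ?R A x"
        have *: "big W Z (\<lambda>z. \<forall>A. A \<^bold>\<in> S \<longrightarrow> f x z \<^bold>\<in> A)"
          by (rule big_complete[where R = "\<lambda>A z. f x z \<^bold>\<in> A", OF W k S(2)]) (intro dfn fc, use x(2) in blast)
        have "dP (\<lambda>z. \<forall>A. A \<^bold>\<in> S \<longrightarrow> f x z \<^bold>\<in> A)" by (intro dfn fc)
        then show "big W Z (\<lambda>z. f x z \<^bold>\<in> C)"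
          by (rule big_mono[OF W' _ d1 *]) (use S(3) f(2)[OF x(1)] in blast)
      qed
    qed
  qed
qed

lemma kuf_push:
  assumes U: "complete_ultrafilter_over k X U" and k: "ordinal k"
    and f: "dF f" "\<And>x. x \<^bold>\<in> X \<Longrightarrow> f x \<^bold>\<in> Y"
  shows "complete_ultrafilter_over k Y (sep (Pw Y) (\<lambda>A. big U X (\<lambda>x. f x \<^bold>\<in> A)))"
proof -
  have "dterm UNIV (\<lambda>e. f (e 0))" by (rule f(1))
  from kuf_fubini[where f = "\<lambda>x z. f x", OF U kuf_principal k this f(2)] show ?thesis
    unfolding big_const[OF kuf_uf[OF kuf_principal]] by simp
qed

text \<open>Maximality: if a set in \<open>W\<close> were missing from \<open>U\<close>, its
  complement would lie in \<open>U\<close> and so in \<open>W\<close> together with it.\<close>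

lemma uf_subset_eq:
  assumes "ultrafilter_over X U" "ultrafilter_over X W" "\<And>A. A \<^bold>\<in> U \<Longrightarrow> A \<^bold>\<in> W"
  shows "U = W"
proof (rule ext)
  fix A show "A \<^bold>\<in> U \<longleftrightarrow> A \<^bold>\<in> W"
  proof
    assume A: "A \<^bold>\<in> W"
    have AX: "A \<^bold>\<subseteq> X" by (rule uf_subset[OF assms(2) A])
    have d: "dP (\<lambda>z. z \<^bold>\<in> A)" by (intro dfn)
    show "A \<^bold>\<in> U"
    proof (rule ccontr)
      assume "\<not> A \<^bold>\<in> U"
      then have "big U X (\<lambda>z. \<not> z \<^bold>\<in> A)" using big_not[OF assms(1) d] big_mem[OF assms(1) AX] by blast
      then show False using assms(3) big_not[OF assms(2) d] big_mem[OF assms(2) AX] A by blast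
    qed
  qed (rule assms(3))
qed

section \<open>The inner model\<close>

definition kuf_on_ord :: "'v \<Rightarrow> 'v \<Rightarrow> bool" where
  "kuf_on_ord k U \<longleftrightarrow> (\<exists>d. ordinal d \<and> complete_ultrafilter_over k d U)"

lemma kuf_on_ord_dfn [THEN defn_lift2, dfn]:
  "defn {} (\<lambda>e. kuf_on_ord (e 0) (e 1))"
  unfolding kuf_on_ord_def by (intro dfn)

lemma kOD_iff: "x \<in> kOD k \<longleftrightarrow> (\<exists>U. kuf_on_ord k U \<and> od U x)"
  unfolding kOD_def kuf_on_ord_def OD_from_iff by blast

lemma kOD_dfn [THEN defn_lift2, dfn]:
  "defn {} (\<lambda>e. e 0 \<in> kOD (e 1))"
  unfolding kOD_iff by (intro dfn)

lemma kHOD_iff: "x \<in> kHOD k \<longleftrightarrow> x \<in> kOD k \<and> (\<forall>y. y \<^bold>\<in> tcl x \<longrightarrow> y \<in> kOD k)"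
  unfolding kHOD_def is_transitive_closure_iff by blast

lemma kHOD_dfn [THEN defn_lift2, dfn]:
  "defn {} (\<lambda>e. e 0 \<in> kHOD (e 1))"
  unfolding kHOD_iff by (intro dfn)

section \<open>Merging ultrafilter parameters\<close>

lemma od_closed: "dterm B (\<lambda>e. x) \<Longrightarrow> (\<And>b. b \<in> B \<Longrightarrow> od T b) \<Longrightarrow> od T x"
  by (rule dterm_od, erule dterm_trans, rule od_dterm)

lemma od_trans: "od T U \<Longrightarrow> od U x \<Longrightarrow> od T x"
  by (rule od_closed[OF od_dterm]) (auto intro: od_basic(1))

lemma ex_kuf_on_ord: "\<exists>U. kuf_on_ord k U"
  unfolding kuf_on_ord_def using kuf_principal ord_num by blast

text \<open>The images of \<open>?T\<close> under the two components of \<open>unpair\<close> are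
  \<open>U\<close> and \<open>W\<close> again, so each is definable from \<open>?T\<close> and the
  ordinals \<open>d\<close>, \<open>g\<close>, \<open>t\<close>.\<close>

lemma kuf_on_ord_join:
  assumes k: "ordinal k" and "kuf_on_ord k U" "kuf_on_ord k W"
  shows "\<exists>T. kuf_on_ord k T \<and> od T U \<and> od T W"
proof -
  obtain d where d: "ordinal d" "complete_ultrafilter_over k d U" using assms(2) unfolding kuf_on_ord_def by blast
  obtain g where g: "ordinal g" "complete_ultrafilter_over k g W" using assms(3) unfolding kuf_on_ord_def by blast
  note U' = kuf_uf[OF d(2)] and W' = kuf_uf[OF g(2)]
  have "dF (\<lambda>p. cod (fs p) (sn p))" by (intro dfn)
  from ord_bound[OF this, of "prod d g"] obtain t where t: "ordinal t"
    "\<And>p. p \<^bold>\<in> prod d g \<Longrightarrow> cod (fs p) (sn p) \<^bold>\<in> t" by auto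
  have ct: "cod x z \<^bold>\<in> t" if "x \<^bold>\<in> d" "z \<^bold>\<in> g" for x z
    using t(2)[of "pr x z"] that by (simp add: mem_prod)
  let ?T = "sep (Pw t) (\<lambda>A. big U d (\<lambda>x. big W g (\<lambda>z. cod x z \<^bold>\<in> A)))"
  have "complete_ultrafilter_over k t ?T"
    by (rule kuf_fubini[OF d(2) g(2) k _ ct]) (intro dfn)
  then have T: "kuf_on_ord k ?T" using t(1) unfolding kuf_on_ord_def by blast
  have dQ: "dP (\<lambda>A. big U d (\<lambda>x. big W g (\<lambda>z. cod x z \<^bold>\<in> A)))" by (intro dfn)
  have un: "unpair (cod x z) = pr x z" if "x \<^bold>\<in> d" "z \<^bold>\<in> g" for x z
    using that ord_mem[OF d(1)] ord_mem[OF g(1)] by simp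
  have sub: "sep t P \<^bold>\<subseteq> t" if "dP P" for P by (rule sep_subset[OF that])
  have Tiff: "sep t P \<^bold>\<in> ?T \<longleftrightarrow> big U d (\<lambda>x. big W g (\<lambda>z. P (cod x z)))" if P: "dP P" for P
  proof -
    have "sep g (\<lambda>z. cod x z \<^bold>\<in> sep t P) = sep g (\<lambda>z. P (cod x z))" if "x \<^bold>\<in> d" for x
      by (rule sep_cong) (use ct[OF that] mem_sep[OF P] in blast)
    then have "sep d (\<lambda>x. big W g (\<lambda>z. cod x z \<^bold>\<in> sep t P)) = sep d (\<lambda>x. big W g (\<lambda>z. P (cod x z)))"
      by (intro sep_cong) simp
    then show ?thesis unfolding mem_sep[OF dQ] mem_Pw using sub[OF P] by simp
  qed
  have bU: "B \<^bold>\<in> U \<longleftrightarrow> sep t (\<lambda>a. fs (unpair a) \<^bold>\<in> B) \<^bold>\<in> ?T" if B: "B \<^bold>\<subseteq> d" for B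
  proof -
    have dB: "dP (\<lambda>a. fs (unpair a) \<^bold>\<in> B)" by (intro dfn)
    have "sep g (\<lambda>z. fs (unpair (cod x z)) \<^bold>\<in> B) = sep g (\<lambda>z. x \<^bold>\<in> B)" if "x \<^bold>\<in> d" for x
      by (rule sep_cong) (simp add: un[OF that])
    then have "sep d (\<lambda>x. big W g (\<lambda>z. fs (unpair (cod x z)) \<^bold>\<in> B)) = sep d (\<lambda>x. x \<^bold>\<in> B)"
      by (intro sep_cong) (simp add: big_const[OF W'])
    then show ?thesis using Tiff[OF dB] big_mem[OF U' B] by simp
  qed
  have bW: "B \<^bold>\<in> W \<longleftrightarrow> sep t (\<lambda>a. sn (unpair a) \<^bold>\<in> B) \<^bold>\<in> ?T" if B: "B \<^bold>\<subseteq> g" for B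
  proof -
    have dB: "dP (\<lambda>a. sn (unpair a) \<^bold>\<in> B)" by (intro dfn)
    have "sep g (\<lambda>z. sn (unpair (cod x z)) \<^bold>\<in> B) = sep g (\<lambda>z. z \<^bold>\<in> B)" if "x \<^bold>\<in> d" for x
      by (rule sep_cong) (simp add: un[OF that])
    then have "sep d (\<lambda>x. big W g (\<lambda>z. sn (unpair (cod x z)) \<^bold>\<in> B)) = sep d (\<lambda>x. B \<^bold>\<in> W)"
      by (intro sep_cong) (simp add: big_mem[OF W' B])
    then show ?thesis using Tiff[OF dB] big_const[OF U'] by simp
  qed
  have "U = sep (Pw d) (\<lambda>B. sep t (\<lambda>a. fs (unpair a) \<^bold>\<in> B) \<^bold>\<in> ?T)"
  proof (rule ext)
    have dd: "dP (\<lambda>B. sep t (\<lambda>a. fs (unpair a) \<^bold>\<in> B) \<^bold>\<in> ?T)" by (intro dfn)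
    show "B \<^bold>\<in> U \<longleftrightarrow> B \<^bold>\<in> sep (Pw d) (\<lambda>B. sep t (\<lambda>a. fs (unpair a) \<^bold>\<in> B) \<^bold>\<in> ?T)" for B
      unfolding mem_sep[OF dd] mem_Pw using bU uf_subset[OF U'] by blast
  qed
  moreover have "W = sep (Pw g) (\<lambda>B. sep t (\<lambda>a. sn (unpair a) \<^bold>\<in> B) \<^bold>\<in> ?T)"
  proof (rule ext)
    have dd: "dP (\<lambda>B. sep t (\<lambda>a. sn (unpair a) \<^bold>\<in> B) \<^bold>\<in> ?T)" by (intro dfn)
    show "B \<^bold>\<in> W \<longleftrightarrow> B \<^bold>\<in> sep (Pw g) (\<lambda>B. sep t (\<lambda>a. sn (unpair a) \<^bold>\<in> B) \<^bold>\<in> ?T)" for B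
      unfolding mem_sep[OF dd] mem_Pw using bW uf_subset[OF W'] by blast
  qed
  moreover have "od S (sep (Pw d) (\<lambda>B. sep t (\<lambda>a. fs (unpair a) \<^bold>\<in> B) \<^bold>\<in> S))"
    "od S (sep (Pw g) (\<lambda>B. sep t (\<lambda>a. sn (unpair a) \<^bold>\<in> B) \<^bold>\<in> S))" for S
    by (rule dterm_od, intro dfn dterm_const; simp add: d(1) g(1) t(1))+
  ultimately show ?thesis using T by metis
qed

text \<open>Only conjunction brings two ultrafilters together, and there they are merged; a
  derivation contains finitely many conjunctions.\<close>

lemma defn_kOD:
  assumes k: "ordinal k" and "defn (kOD k) P"
  shows "\<exists>U. kuf_on_ord k U \<and> defn (insert U {a. ordinal a}) P"
  using assms(2)
proof (induction rule: defn.induct)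
  case (defn_mem i j)
  then show ?case using ex_kuf_on_ord defn.defn_mem by blast
next
  case (defn_eq i j)
  then show ?case using ex_kuf_on_ord defn.defn_eq by blast
next
  case (defn_const a i)
  then obtain U where U: "kuf_on_ord k U" "od U a" unfolding kOD_iff by blast
  have "defn (insert U {a. ordinal a}) (\<lambda>e. e i = a)"
    by (intro defn_eq_term dterm_var od_dterm U)
  with U(1) show ?case by blast
next
  case (defn_neg P)
  then show ?case using defn.defn_neg by blast
next
  case (defn_conj P Q)
  then obtain U W where UW: "kuf_on_ord k U" "defn (insert U {a. ordinal a}) P" "kuf_on_ord k W" "defn (insert W {a. ordinal a}) Q"
    by blast
  obtain T where T: "kuf_on_ord k T" "od T U" "od T W" using kuf_on_ord_join[OF k UW(1,3)] by blast
  have "defn (insert T {a. ordinal a}) P" "defn (insert T {a. ordinal a}) Q"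
    by (rule defn_trans[OF UW(2)], use T(2) in \<open>auto intro: od_dterm od_basic(1)\<close>)
      (rule defn_trans[OF UW(4)], use T(3) in \<open>auto intro: od_dterm od_basic(1)\<close>)
  then show ?case using T(1) defn.defn_conj by blast
next
  case (defn_ex0 P)
  then show ?case using defn.defn_ex0 by blast
qed

lemma kOD_closed:
  assumes "ordinal k" "dterm (kOD k) (\<lambda>e. x)" shows "x \<in> kOD k"
proof -
  obtain U where "kuf_on_ord k U" "defn (insert U {a. ordinal a}) (\<lambda>e. e 0 = x)"
    using defn_kOD[OF assms(1) assms(2)[unfolded dterm_def]] by blast
  then show ?thesis unfolding kOD_iff od_iff dterm_def by blast
qed

lemma ord_kOD: "ordinal a \<Longrightarrow> a \<in> kOD k"
  unfolding kOD_iff using ex_kuf_on_ord od_basic(1) by blast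

lemma kHOD_kOD: "x \<in> kHOD k \<Longrightarrow> x \<in> kOD k"
  by (simp add: kHOD_iff)

lemma kHOD_trans: "x \<in> kHOD k \<Longrightarrow> y \<^bold>\<in> x \<Longrightarrow> y \<in> kHOD k"
proof -
  assume x: "x \<in> kHOD k" and y: "y \<^bold>\<in> x"
  have *: "x \<^bold>\<subseteq> tcl x" "transitive (tcl x)" "\<And>s. y \<^bold>\<subseteq> s \<Longrightarrow> transitive s \<Longrightarrow> tcl y \<^bold>\<subseteq> s"
    using tcl[of x] tcl[of y] unfolding is_transitive_closure_def by blast+
  have "y \<^bold>\<in> tcl x" using *(1) y unfolding subset_def by blast
  moreover have "tcl y \<^bold>\<subseteq> tcl x" using * \<open>y \<^bold>\<in> tcl x\<close> unfolding transitive_def by blast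
  ultimately show ?thesis using x unfolding kHOD_iff subset_def by blast
qed

text \<open>The elements of \<kappa>-HOD in the transitive closure form a transitive set that
  includes \<open>x\<close>, hence exhaust the closure; Separation applies because \<kappa>-HOD is a
  class.\<close>

lemma kHODI:
  assumes "x \<in> kOD k" "\<And>y. y \<^bold>\<in> x \<Longrightarrow> y \<in> kHOD k" shows "x \<in> kHOD k"
proof -
  let ?s = "sep (tcl x) (\<lambda>z. z \<in> kHOD k)"
  have d: "dP (\<lambda>z. z \<in> kHOD k)" by (intro dfn)
  have t: "x \<^bold>\<subseteq> tcl x" "transitive (tcl x)" "\<And>s. x \<^bold>\<subseteq> s \<Longrightarrow> transitive s \<Longrightarrow> tcl x \<^bold>\<subseteq> s"
    using tcl[of x] unfolding is_transitive_closure_def by blast+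
  have "x \<^bold>\<subseteq> ?s" using t(1) assms(2) unfolding subset_def mem_sep[OF d] by blast
  moreover have "transitive ?s"
    using t(2) kHOD_trans unfolding transitive_def subset_def mem_sep[OF d] by blast
  ultimately have "tcl x \<^bold>\<subseteq> ?s" using t(3) by blast
  then show ?thesis using assms(1) kHOD_kOD unfolding kHOD_iff[of x] subset_def mem_sep[OF d] by blast
qed

text \<open>The criterion for constructing sets in \<kappa>-HOD. Its parameters range over
  \<kappa>-OD, not just over \<kappa>-HOD, which matters for the axiom of choice.\<close>

lemma kHOD_closed:
  "ordinal k \<Longrightarrow> dterm (kOD k) (\<lambda>e. x) \<Longrightarrow> (\<And>y. y \<^bold>\<in> x \<Longrightarrow> y \<in> kHOD k) \<Longrightarrow> x \<in> kHOD k"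
  by (rule kHODI[OF kOD_closed])

lemma ord_kHOD: "ordinal a \<Longrightarrow> a \<in> kHOD k"
proof (rule ord_induct[where P = "\<lambda>a. a \<in> kHOD k"])
  fix a assume a: "ordinal a" "\<And>b. b \<^bold>\<in> a \<Longrightarrow> b \<in> kHOD k"
  show "a \<in> kHOD k" by (rule kHODI[OF ord_kOD[OF a(1)] a(2)])
qed (intro dfn)

section \<open>The axioms of ZF inside \<kappa>-HOD\<close>

context
  fixes k assumes k: "ordinal k"
begin

lemma k_dterm: "dterm (kOD k) (\<lambda>e. k)"
  by (rule dterm_const[OF ord_kOD[OF k]])

lemma kHOD_dterm: "x \<in> kHOD k \<Longrightarrow> dterm (kOD k) (\<lambda>e. x)"
  by (rule dterm_const[OF kHOD_kOD])

lemma kHOD_ext: "extensionality (kHOD k)"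
  unfolding extensionality_def using kHOD_trans by (intro ballI impI ext) blast

lemma kHOD_foundation: "foundation (kHOD k)"
  unfolding foundation_def using kHOD_trans foundation_set by meson

lemma kHOD_pairing: "pairing (kHOD k)"
  unfolding pairing_def
proof (intro ballI)
  fix x y assume xy: "x \<in> kHOD k" "y \<in> kHOD k"
  have "upr x y \<in> kHOD k"
    by (rule kHOD_closed[OF k], intro upr_dfn kHOD_dterm xy) (use xy in auto)
  then show "\<exists>p\<in>kHOD k. \<forall>z\<in>kHOD k. z \<^bold>\<in> p \<longleftrightarrow> z = x \<or> z = y"
    by (intro bexI[of _ "upr x y"]) simp_all
qed

lemma kHOD_union: "union (kHOD k)"
  unfolding union_def
proof (intro ballI)
  fix x assume x: "x \<in> kHOD k"
  have "Uni x \<in> kHOD k"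
    by (rule kHOD_closed[OF k], intro Uni_dfn kHOD_dterm x) (use kHOD_trans[OF kHOD_trans[OF x]] in auto)
  then show "\<exists>u\<in>kHOD k. \<forall>z\<in>kHOD k. z \<^bold>\<in> u \<longleftrightarrow> (\<exists>y\<in>kHOD k. y \<^bold>\<in> x \<and> z \<^bold>\<in> y)"
    using x kHOD_trans by (intro bexI[of _ "Uni x"]) auto
qed

lemma kHOD_power: "power_set (kHOD k)"
  unfolding power_set_def
proof (intro ballI)
  fix x assume x: "x \<in> kHOD k"
  have d: "dP (\<lambda>z. z \<in> kHOD k)" by (intro dfn)
  let ?p = "sep (Pw x) (\<lambda>z. z \<in> kHOD k)"
  have "?p \<in> kHOD k"
  proof (rule kHOD_closed[OF k])
    show "dterm (kOD k) (\<lambda>e. ?p)" by (intro dfn k_dterm kHOD_dterm x)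
  qed (simp add: mem_sep[OF d])
  moreover have "z \<^bold>\<in> ?p \<longleftrightarrow> (\<forall>w\<in>kHOD k. w \<^bold>\<in> z \<longrightarrow> w \<^bold>\<in> x)" if "z \<in> kHOD k" for z
    unfolding mem_sep[OF d] mem_Pw subset_def using that kHOD_trans[OF that] by blast
  ultimately show "\<exists>p\<in>kHOD k. \<forall>z\<in>kHOD k. z \<^bold>\<in> p \<longleftrightarrow> (\<forall>w\<in>kHOD k. w \<^bold>\<in> z \<longrightarrow> w \<^bold>\<in> x)" by blast
qed

lemma kHOD_infinity: "infinity (kHOD k)"
  unfolding infinity_def
proof (rule bexI[of _ omega], intro conjI ballI impI)
  show "\<exists>e\<in>kHOD k. e \<^bold>\<in> omega \<and> (\<forall>z\<in>kHOD k. \<not> z \<^bold>\<in> e)"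
    using emp_omega ord_kHOD[OF ord_emp] by (intro bexI[of _ emp]) auto
  fix y assume "y \<^bold>\<in> omega"
  then show "\<exists>s\<in>kHOD k. s \<^bold>\<in> omega \<and> (\<forall>z\<in>kHOD k. z \<^bold>\<in> s \<longleftrightarrow> z \<^bold>\<in> y \<or> z = y)"
    using succ_omega ord_mem[OF ord_omega] by (intro bexI[of _ "ins y y"]) (auto intro!: ord_kHOD ord_succ)
qed (rule ord_kHOD[OF ord_omega])

lemma kHOD_separation: "separation (kHOD k)"
  unfolding separation_def
proof (intro allI impI ballI)
  fix \<phi> and env :: "nat \<Rightarrow> 'v" and a
  assume env: "range env \<subseteq> kHOD k" and a: "a \<in> kHOD k"
  let ?P = "\<lambda>z. sat E (kHOD k) (case_nat z env) \<phi>"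
  \<comment> \<open>Satisfaction in \<kappa>-HOD is definable with \<open>k\<close> as an additional
    parameter, which as an ordinal is in \<kappa>-OD.\<close>
  have dK: "defn A (\<lambda>e. e 0 \<in> kHOD k)" if "k \<in> A" for A by (intro dfn dterm_const that)
  have d: "defn (kOD k) (\<lambda>e. ?P (e 0))"
    by (rule sat_defn_env[OF dK]) (use env kHOD_kOD ord_kOD[OF k] in auto)
  have d': "dP ?P" by (rule defn_mono[OF d]) simp
  let ?b = "sep a ?P"
  have "?b \<in> kHOD k"
  proof (rule kHOD_closed[OF k])
    show "dterm (kOD k) (\<lambda>e. ?b)" by (intro sep_dfn kHOD_dterm a d)
  qed (use kHOD_trans[OF a] in \<open>simp add: mem_sep[OF d']\<close>)
  then show "\<exists>b\<in>kHOD k. \<forall>z\<in>kHOD k. z \<^bold>\<in> b \<longleftrightarrow> z \<^bold>\<in> a \<and> ?P z"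
    by (intro bexI[of _ ?b]) (simp_all add: mem_sep[OF d'])
qed

lemma kHOD_replacement: "replacement (kHOD k)"
  unfolding replacement_def
proof (intro allI impI ballI)
  fix \<phi> and env :: "nat \<Rightarrow> 'v" and a
  let ?M = "kHOD k"
  let ?R = "\<lambda>x y. sat E ?M (case_nat x (case_nat y env)) \<phi>"
  assume env: "range env \<subseteq> ?M" and a: "a \<in> ?M"
    and fn: "\<forall>x\<in>?M. x \<^bold>\<in> a \<longrightarrow> (\<forall>y\<in>?M. \<forall>y'\<in>?M. ?R x y \<longrightarrow> ?R x y' \<longrightarrow> y = y')"
  have dK: "defn (kOD k) (\<lambda>e. e 0 \<in> ?M)" by (intro dfn k_dterm)
  have "range env \<subseteq> kOD k" using env kHOD_kOD by blast
  note R = sat_defn_env(2)[OF dK this, of \<phi>]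
  note Rc = defn_comp2[where P = ?R, OF R]
  let ?g = "\<lambda>x. iota (\<lambda>y. y \<in> ?M \<and> ?R x y)"
  let ?Q = "\<lambda>y. y \<in> ?M \<and> (\<exists>x. x \<^bold>\<in> a \<and> ?R x y)"
  have dg: "dterm (kOD k) (\<lambda>e. ?g (e 0))" by (intro dfn Rc k_dterm subset_refl)
  have dQ: "defn (kOD k) (\<lambda>e. ?Q (e 0))" by (intro dfn Rc k_dterm kHOD_dterm a subset_refl)
  have dg': "dF ?g" by (rule dterm_mono[OF dg]) simp
  have dQ': "dP ?Q" by (rule defn_mono[OF dQ]) simp
  \<comment> \<open>Where no value exists, \<open>?g\<close> returns \<open>emp\<close>; the
    condition \<open>?Q\<close> removes this element unless it is a genuine value.\<close>
  let ?b = "sep (img a ?g) ?Q"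
  have "dterm (kOD k) (\<lambda>e. ?b)" by (intro sep_dfn img_dfn kHOD_dterm a dg dQ)
  then have "?b \<in> ?M" by (rule kHOD_closed[OF k]) (simp add: mem_sep[OF dQ'])
  moreover have "y \<^bold>\<in> ?b \<longleftrightarrow> (\<exists>x\<in>?M. x \<^bold>\<in> a \<and> ?R x y)" if y: "y \<in> ?M" for y
  proof
    assume "y \<^bold>\<in> ?b"
    then show "\<exists>x\<in>?M. x \<^bold>\<in> a \<and> ?R x y" unfolding mem_sep[OF dQ'] using kHOD_trans[OF a] by blast
  next
    assume "\<exists>x\<in>?M. x \<^bold>\<in> a \<and> ?R x y"
    then obtain x where x: "x \<in> ?M" "x \<^bold>\<in> a" "?R x y" by blast
    have "?g x = y" by (rule iota_eq) (use x y fn in blast)+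
    then show "y \<^bold>\<in> ?b" unfolding mem_sep[OF dQ'] mem_img[OF dg'] using x y by blast
  qed
  ultimately show "\<exists>b\<in>?M. \<forall>y\<in>?M. y \<^bold>\<in> b \<longleftrightarrow> (\<exists>x\<in>?M. x \<^bold>\<in> a \<and> ?R x y)" by blast
qed

lemma kHOD_inner_model: "inner_model_of_ZF (kHOD k)"
  unfolding inner_model_of_ZF_def
proof (intro conjI allI impI)
  have "dP (\<lambda>x. x \<in> kHOD k)" by (intro dfn)
  from defn_UNIV_sat[OF this, of 1 "\<lambda>_. emp"] obtain \<phi> env where
    "\<forall>xs. length xs = 1 \<longrightarrow> (env_app xs (\<lambda>_. emp) 0 \<in> kHOD k \<longleftrightarrow> sat E UNIV (env_app xs env) \<phi>)" by blast
  from this[THEN spec, of "[_]"] have "x \<in> kHOD k \<longleftrightarrow> sat E UNIV (case_nat x env) \<phi>" for x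
    by (simp add: env_app_Cons)
  then show "is_class (kHOD k)" unfolding is_class_def by blast
  show "y \<in> kHOD k" if "x \<in> kHOD k" "y \<^bold>\<in> x" for x y by (rule kHOD_trans[OF that])
  show "a \<in> kHOD k" if "ordinal a" for a by (rule ord_kHOD[OF that])
  show "ZF (kHOD k)" unfolding ZF_def
    using kHOD_ext kHOD_foundation kHOD_pairing kHOD_union kHOD_power kHOD_infinity
      kHOD_separation kHOD_replacement by blast
qed

end

end

section \<open>The axiom of choice\<close>

locale zfc_model = zf_model E for E :: "'v \<Rightarrow> 'v \<Rightarrow> bool" (infix "\<^bold>\<in>" 50) +
  assumes AC: "choice UNIV"
begin

section \<open>Well-orderings and cardinals in the universe\<close>

lemma transversal:
  assumes "\<And>x. x \<^bold>\<in> F \<Longrightarrow> \<exists>z. z \<^bold>\<in> x"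
    and "\<And>x y z. x \<^bold>\<in> F \<Longrightarrow> y \<^bold>\<in> F \<Longrightarrow> z \<^bold>\<in> x \<Longrightarrow> z \<^bold>\<in> y \<Longrightarrow> x = y"
  shows "\<exists>c. \<forall>x. x \<^bold>\<in> F \<longrightarrow> (\<exists>!z. z \<^bold>\<in> x \<and> z \<^bold>\<in> c)"
proof -
  have "\<exists>c\<in>UNIV. \<forall>x\<in>UNIV. x \<^bold>\<in> F \<longrightarrow> (\<exists>!z. z \<in> UNIV \<and> z \<^bold>\<in> x \<and> z \<^bold>\<in> c)"
    by (rule AC[unfolded choice_def, THEN bspec, OF UNIV_I, THEN mp]) (use assms in blast)
  then show ?thesis by simp
qed

text \<open>Zermelo's argument. Each nonempty subset of \<open>X\<close> is tagged by itself to make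
  the family disjoint; a transversal is then a choice function on these subsets and drives the
  enumeration.\<close>

lemma well_order: "\<exists>t f. ordinal t \<and> dF f \<and> bij f t X"
proof -
  let ?N = "sep (Pw X) (\<lambda>x. x \<noteq> emp)"
  let ?h = "\<lambda>x. prod (upr x x) x"
  have dN: "dP (\<lambda>x. x \<noteq> emp)" by (intro dfn)
  have dh: "dF ?h" by (intro dfn)
  let ?F = "img ?N ?h"
  have F: "y \<^bold>\<in> ?F \<longleftrightarrow> (\<exists>x. x \<^bold>\<subseteq> X \<and> x \<noteq> emp \<and> y = ?h x)" for y
    unfolding mem_img[OF dh] mem_sep[OF dN] by auto
  have h: "z \<^bold>\<in> ?h x \<longleftrightarrow> (\<exists>y. y \<^bold>\<in> x \<and> z = pr x y)" for x z by (auto simp: mem_prod)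
  have 1: "\<exists>z. z \<^bold>\<in> x" if x: "x \<^bold>\<in> ?F" for x
  proof -
    obtain y where y: "y \<noteq> emp" "x = ?h y" using x unfolding F by blast
    then obtain w where "w \<^bold>\<in> y" unfolding eq_emp by blast
    then have "pr y w \<^bold>\<in> x" unfolding y(2) h by blast
    then show ?thesis by blast
  qed
  have 2: "x = y" if xy: "x \<^bold>\<in> ?F" "y \<^bold>\<in> ?F" and z: "z \<^bold>\<in> x" "z \<^bold>\<in> y" for x y z
  proof -
    obtain x' y' where xy: "x = ?h x'" "y = ?h y'" using xy unfolding F by blast
    then have "x' = y'" using z unfolding xy h by auto
    with xy show ?thesis by simp
  qed
  have "\<exists>c. \<forall>x. x \<^bold>\<in> ?F \<longrightarrow> (\<exists>!z. z \<^bold>\<in> x \<and> z \<^bold>\<in> c)" by (rule transversal[OF 1 2])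
  then obtain c where c: "\<And>x. x \<^bold>\<in> ?F \<Longrightarrow> \<exists>!z. z \<^bold>\<in> x \<and> z \<^bold>\<in> c" by blast
  define s where "s S = sn (iota (\<lambda>z. z \<^bold>\<in> ?h (diff X S) \<and> z \<^bold>\<in> c))" for S
  have ds: "dF s" unfolding s_def by (intro dfn)
  have sel: "s S \<^bold>\<in> X \<and> \<not> s S \<^bold>\<in> S" if ex: "\<exists>x. x \<^bold>\<in> X \<and> \<not> x \<^bold>\<in> S" for S
  proof -
    have "diff X S \<noteq> emp" "diff X S \<^bold>\<subseteq> X" unfolding eq_emp subset_def mem_diff using ex by blast+
    then have "?h (diff X S) \<^bold>\<in> ?F" unfolding F by blast
    from c[OF this] obtain z where z: "z \<^bold>\<in> ?h (diff X S)" "z \<^bold>\<in> c" "\<And>y. y \<^bold>\<in> ?h (diff X S) \<Longrightarrow> y \<^bold>\<in> c \<Longrightarrow> y = z"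
      by blast
    have "iota (\<lambda>z. z \<^bold>\<in> ?h (diff X S) \<and> z \<^bold>\<in> c) = z" by (rule iota_eq) (use z in blast)+
    then have "s S \<^bold>\<in> diff X S" using z(1) unfolding s_def h by auto
    then show ?thesis unfolding mem_diff .
  qed
  from enum_bij[OF ds sel] obtain t where "ordinal t" "bij (enum s) t X" by blast
  moreover have "dF (enum s)" by (intro dfn dF_comp[OF ds])
  ultimately show ?thesis by blast
qed

text \<open>The cardinal is that of the power set of the union of \<open>X\<close> and
  \<open>m\<close>. Cantor's diagonal set excludes that it lies below \<open>m\<close>, which the
  cardinal of the union itself may do; singletons embed \<open>X\<close>.\<close>

lemma ex_cardinal:
  assumes m: "ordinal m"
  shows "\<exists>l f. cardinal l \<and> m \<^bold>\<subseteq> l \<and> dF f \<and> (\<forall>x. x \<^bold>\<in> X \<longrightarrow> f x \<^bold>\<in> l)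
     \<and> (\<forall>x y. x \<^bold>\<in> X \<longrightarrow> y \<^bold>\<in> X \<longrightarrow> f x = f y \<longrightarrow> x = y)"
proof -
  let ?Y = "Pw (un X m)"
  obtain t g where t: "ordinal t" "dF g" "bij g t ?Y" using well_order by blast
  let ?l = "least (\<lambda>a. equinumerous a ?Y)"
  have d: "dP (\<lambda>a. equinumerous a ?Y)" by (intro dfn)
  have "equinumerous t ?Y" unfolding equinumerous_iff using t(2,3) by blast
  note l = least[OF d t(1) this]
  obtain g where g: "dF g" "bij g ?l ?Y" using l(2) unfolding equinumerous_iff by blast
  obtain h where h: "dF h" "bij h ?Y ?l" using bij_inverse[OF g] by blast
  have "cardinal ?l" unfolding cardinal_def using l(1,3) equinumerous_trans[OF _ l(2)] by blast
  moreover have "m \<^bold>\<subseteq> ?l"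
  proof (rule ccontr)
    assume "\<not> m \<^bold>\<subseteq> ?l"
    then have lm: "?l \<^bold>\<in> m" using ord_subset[OF m l(1)] ord_linear[OF m l(1)] by blast
    let ?D = "sep ?l (\<lambda>x. \<not> x \<^bold>\<in> g x)"
    have dD: "dP (\<lambda>x. \<not> x \<^bold>\<in> g x)" by (intro dfn dF_comp[OF g(1)])
    have "?D \<^bold>\<in> ?Y" using ord_trans[OF m lm] by (auto simp: subset_def mem_sep[OF dD])
    then obtain x where "x \<^bold>\<in> ?l" "g x = ?D" using g(2) unfolding bij_def by blast
    then show False using mem_sep[OF dD, of x ?l] by simp
  qed
  moreover have "dF (\<lambda>x. h (upr x x))" by (intro dfn dF_comp[OF h(1)])
  moreover have Y: "upr x x \<^bold>\<in> ?Y" if "x \<^bold>\<in> X" for x using that by (auto simp: subset_def)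
  moreover have "h (upr x x) \<^bold>\<in> ?l" if "x \<^bold>\<in> X" for x using h(2) Y[OF that] unfolding bij_def by blast
  moreover have "x = y" if "x \<^bold>\<in> X" "y \<^bold>\<in> X" "h (upr x x) = h (upr y y)" for x y
  proof -
    have "upr x x = upr y y" using h(2) Y that unfolding bij_def by blast
    then show ?thesis by (metis mem_upr)
  qed
  ultimately show ?thesis by (intro exI[of _ ?l] exI[of _ "\<lambda>x. h (upr x x)"]) blast
qed

subsection \<open>The uncountable case\<close>

lemma iteration:
  assumes p: "dF p" shows "\<exists>q. dF q \<and> q emp = a \<and> (\<forall>n. n \<^bold>\<in> omega \<longrightarrow> q (ins n n) = p (q n))"
proof -
  \<comment> \<open>At a successor stage the domain of \<open>f\<close> is the successor of
    \<open>n\<close>, whose union is \<open>n\<close>; only at stage zero is \<open>f\<close>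
    empty.\<close>
  let ?G = "\<lambda>f. if f = emp then a else p (ap f (Uni (img f fs)))"
  have dG: "dF ?G" by (intro dfn dF_comp[OF p])
  have dr: "dF (rec ?G)" by (rule recD[OF dG])
  have "lam emp (rec ?G) = emp" by (rule eq_emp[THEN iffD2]) (simp add: mem_lam[OF dr])
  then have 1: "rec ?G emp = a" using rec[OF dG ord_emp] by simp
  have 2: "rec ?G (ins n n) = p (rec ?G n)" if n: "n \<^bold>\<in> omega" for n
  proof -
    have on: "ordinal n" by (rule ord_mem[OF ord_omega n])
    have "pr n (rec ?G n) \<^bold>\<in> lam (ins n n) (rec ?G)" unfolding mem_lam[OF dr] by auto
    then have ne: "lam (ins n n) (rec ?G) \<noteq> emp" by (metis mem_emp)
    have u: "Uni (img (lam (ins n n) (rec ?G)) fs) = n"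
      unfolding img_lam_fs[OF dr] by (rule ext) (auto dest: ord_trans[OF on])
    show ?thesis unfolding rec[OF dG ord_succ[OF on]] using ne u by (simp add: ap_lam[OF dr])
  qed
  show ?thesis using dr 1 2 by blast
qed

text \<open>The order of the ultrapower by \<open>W\<close>, on representing functions over
  \<open>t\<close>.\<close>

definition less_mod :: "'v \<Rightarrow> 'v \<Rightarrow> 'v \<Rightarrow> 'v \<Rightarrow> bool" where
  "less_mod W t f g \<longleftrightarrow> big W t (\<lambda>x. ap f x \<^bold>\<in> ap g x)"

lemma less_mod_dfn [dfn]:
  assumes "dterm A W" "dterm A t" "dterm A f" "dterm A g"
  shows "defn A (\<lambda>e. less_mod (W e) (t e) (f e) (g e))"
  unfolding less_mod_def by (intro dfn dterm_rename[OF assms(1)] dterm_rename[OF assms(2)] dterm_rename[OF assms(3)]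
    dterm_rename[OF assms(4)])

text \<open>The ultrapower of \<open>d\<close> by \<open>W\<close> is well-founded: by countable completeness, a sequence that descends
  modulo \<open>W\<close> descends at a single point.\<close>

lemma less_mod_minimal:
  assumes W: "complete_ultrafilter_over k t W" and k: "ordinal k" "omega \<^bold>\<in> k"
    and Z: "\<And>g. g \<^bold>\<in> Z \<Longrightarrow> is_function g t d" "z \<^bold>\<in> Z" and d: "ordinal d"
  shows "\<exists>g. g \<^bold>\<in> Z \<and> (\<forall>f. f \<^bold>\<in> Z \<longrightarrow> \<not> less_mod W t f g)"
proof (rule ccontr)
  assume n: "\<not> ?thesis"
  obtain s h where h: "ordinal s" "dF h" "bij h s Z" using well_order by blast
  \<comment> \<open>Dependent choice made definable: a well-ordering of \<open>Z\<close> selects the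
    smaller function.\<close>
  define p where "p g = h (least (\<lambda>x. x \<^bold>\<in> s \<and> less_mod W t (h x) g))" for g
  have dp: "dF p" unfolding p_def by (intro dfn dF_comp[OF h(2)])
  have p: "p g \<^bold>\<in> Z \<and> less_mod W t (p g) g" if g: "g \<^bold>\<in> Z" for g
  proof -
    obtain f where f: "f \<^bold>\<in> Z" "less_mod W t f g" using n g by blast
    obtain x where x: "x \<^bold>\<in> s" "h x = f" using h(3) f(1) unfolding bij_def by blast
    have dd: "dP (\<lambda>x. x \<^bold>\<in> s \<and> less_mod W t (h x) g)" by (intro dfn dF_comp[OF h(2)])
    have "least (\<lambda>x. x \<^bold>\<in> s \<and> less_mod W t (h x) g) \<^bold>\<in> s \<and> less_mod W t (p g) g"
      unfolding p_def by (rule least(2)[OF dd ord_mem[OF h(1) x(1)]]) (use x f in simp)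
    then show ?thesis using h(3) unfolding p_def bij_def by blast
  qed
  obtain q where q: "dF q" "q emp = z" "\<And>n. n \<^bold>\<in> omega \<Longrightarrow> q (ins n n) = p (q n)" using iteration[OF dp] by blast
  have qZ: "q n \<^bold>\<in> Z" if "n \<^bold>\<in> omega" for n
  proof (rule omega_induct[where P = "\<lambda>n. q n \<^bold>\<in> Z", OF _ _ _ that])
    show "dP (\<lambda>n. q n \<^bold>\<in> Z)" by (intro dfn dF_comp[OF q(1)])
  qed (use q Z(2) p in simp_all)
  let ?R = "\<lambda>n x. ap (q (ins n n)) x \<^bold>\<in> ap (q n) x"
  have dR: "defn UNIV (\<lambda>e. ?R (e 0) (e 1))" by (intro dfn dF_comp[OF q(1)])
  have "equinumerous omega omega" unfolding equinumerous_iff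
    by (rule exI[of _ "\<lambda>x. x"]) (auto simp: bij_def intro: dterm_var)
  then have "smaller_than omega k" unfolding smaller_than_def using k(2) by blast
  then have b: "big W t (\<lambda>x. \<forall>n. n \<^bold>\<in> omega \<longrightarrow> ?R n x)"
    by (rule big_complete[where R = ?R, OF W k(1) _ dR]) (use p qZ q(3) in \<open>simp add: less_mod_def\<close>)
  have "dP (\<lambda>x. \<forall>n. n \<^bold>\<in> omega \<longrightarrow> ?R n x)" by (intro dfn dF_comp[OF q(1)])
  from big_ex[OF kuf_uf[OF W] this b] obtain x where x: "x \<^bold>\<in> t" "\<And>n. n \<^bold>\<in> omega \<Longrightarrow> ?R n x" by blast
  \<comment> \<open>At the point \<open>x\<close> the values descend strictly, so this nonempty
    class of ordinals has no least element.\<close>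
  let ?P = "\<lambda>a. \<exists>n. n \<^bold>\<in> omega \<and> ap (q n) x = a"
  have dP: "dP ?P" by (intro dfn dF_comp[OF q(1)])
  have "ordinal (ap (q emp) x)"
    using ord_mem[OF d is_function_ap(1)[OF Z(1)[OF qZ[OF emp_omega]] x(1)]] .
  from ord_minimal[where P = ?P, OF dP this] emp_omega
  obtain a where "?P a" "\<And>c. c \<^bold>\<in> a \<Longrightarrow> \<not> ?P c" by blast
  then show False using x(2) succ_omega by blast
qed

definition push :: "'v \<Rightarrow> 'v \<Rightarrow> 'v \<Rightarrow> 'v \<Rightarrow> 'v" where
  "push W t d g = sep (Pw d) (\<lambda>B. big W t (\<lambda>x. ap g x \<^bold>\<in> B))"

lemma push_dfn [dfn]:
  assumes "dterm A W" "dterm A t" "dterm A d" "dterm A g"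
  shows "dterm A (\<lambda>e. push (W e) (t e) (d e) (g e))"
  unfolding push_def by (intro dfn dterm_rename[OF assms(1)] dterm_rename[OF assms(2)] dterm_rename[OF assms(3)]
    dterm_rename[OF assms(4)])

lemma push_eq:
  assumes W: "ultrafilter_over t W" and e: "big W t (\<lambda>x. ap f x = ap g x)"
  shows "push W t d f = push W t d g"
proof -
  have d: "dP (\<lambda>x. ap f x \<^bold>\<in> B)" for f B by (intro dfn)
  have de: "dP (\<lambda>x. ap f x = ap g x)" by (intro dfn)
  have "big W t (\<lambda>x. ap f x \<^bold>\<in> B) \<longleftrightarrow> big W t (\<lambda>x. ap g x \<^bold>\<in> B)" for B
  proof
    assume "big W t (\<lambda>x. ap f x \<^bold>\<in> B)"
    from big_conj[OF W d de this e] show "big W t (\<lambda>x. ap g x \<^bold>\<in> B)"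
      by (rule big_mono[OF W defn_and[OF d de] d]) auto
  next
    assume "big W t (\<lambda>x. ap g x \<^bold>\<in> B)"
    from big_conj[OF W d de this e] show "big W t (\<lambda>x. ap f x \<^bold>\<in> B)"
      by (rule big_mono[OF W defn_and[OF d de] d]) auto
  qed
  then show ?thesis unfolding push_def by simp
qed

text \<open>Trichotomy of ordinals holds at each point, and the ultrafilter decides between the
  three alternatives.\<close>

lemma less_mod_linear:
  assumes W: "ultrafilter_over t W" and f: "is_function f t d" and g: "is_function g t d" and d: "ordinal d"
    and n: "\<not> less_mod W t f g" "\<not> less_mod W t g f"
  shows "big W t (\<lambda>x. ap f x = ap g x)"
proof -
  have d1: "dP (\<lambda>x. ap f x \<^bold>\<in> ap g x)" and d2: "dP (\<lambda>x. ap g x \<^bold>\<in> ap f x)" and d3: "dP (\<lambda>x. ap f x = ap g x)"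
    by (intro dfn)+
  have "big W t (\<lambda>x. \<not> ap f x \<^bold>\<in> ap g x)" "big W t (\<lambda>x. \<not> ap g x \<^bold>\<in> ap f x)"
    using n big_not[OF W d1] big_not[OF W d2] unfolding less_mod_def by blast+
  from big_conj[OF W defn_not[OF d1] defn_not[OF d2] this] show ?thesis
    by (rule big_mono[OF W defn_and[OF defn_not[OF d1] defn_not[OF d2]] d3])
      (use ord_linear ord_mem[OF d is_function_ap(1)[OF f]] ord_mem[OF d is_function_ap(1)[OF g]] in blast)
qed

text \<open>The ultrafilters below \<open>W\<close> are enumerated, definably from \<open>W\<close>, along the ordinals of the
  ultrapower by \<open>W\<close>: the least function with a new image is unique modulo \<open>W\<close>.\<close>

lemma od_push:
  assumes W: "complete_ultrafilter_over k t W" and k: "ordinal k" "omega \<^bold>\<in> k" and t: "ordinal t"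
    and d: "ordinal d" and g: "is_function g t d"
  shows "od W (push W t d g)"
proof -
  let ?F = "sep (Pw (prod t d)) (\<lambda>g. is_function g t d)"
  have dfun: "dP (\<lambda>g. is_function g t d)" by (intro dfn)
  have F: "g \<^bold>\<in> ?F \<longleftrightarrow> is_function g t d" for g
  proof -
    have "g \<^bold>\<subseteq> prod t d" if "is_function g t d"
      using that unfolding is_function_def subset_def mem_prod is_pair_iff by blast
    then show ?thesis unfolding mem_sep[OF dfun] mem_Pw by blast
  qed
  let ?M = "\<lambda>g S. is_function g t d \<and> \<not> push W t d g \<^bold>\<in> S \<and>
     (\<forall>f. is_function f t d \<longrightarrow> \<not> push W t d f \<^bold>\<in> S \<longrightarrow> \<not> less_mod W t f g)"
  \<comment> \<open>The selected object is the image, not the function: a minimal function is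
    determined only modulo \<open>W\<close>, and \<open>push\<close> does not depend on the
    representative.\<close>
  define s where "s S = iota (\<lambda>u. \<exists>g. ?M g S \<and> u = push W t d g)" for S
  let ?X = "\<lambda>u. \<exists>g. is_function g t d \<and> u = push W t d g"
  have ds: "dF s" unfolding s_def by (intro dfn)
  have sel: "?X (s S) \<and> \<not> s S \<^bold>\<in> S" if ex: "\<exists>x. ?X x \<and> \<not> x \<^bold>\<in> S" for S
  proof -
    obtain g0 where g0: "is_function g0 t d" "\<not> push W t d g0 \<^bold>\<in> S" using ex by blast
    let ?Z = "sep ?F (\<lambda>g. \<not> push W t d g \<^bold>\<in> S)"
    have dZ: "dP (\<lambda>g. \<not> push W t d g \<^bold>\<in> S)" by (intro dfn)
    have Z: "g \<^bold>\<in> ?Z \<longleftrightarrow> is_function g t d \<and> \<not> push W t d g \<^bold>\<in> S" for g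
      unfolding mem_sep[OF dZ] F by blast
    have "\<exists>g. g \<^bold>\<in> ?Z \<and> (\<forall>f. f \<^bold>\<in> ?Z \<longrightarrow> \<not> less_mod W t f g)"
      by (rule less_mod_minimal[OF W k _ _ d]) (use Z g0 in blast)+
    then obtain h where h: "is_function h t d" "\<not> push W t d h \<^bold>\<in> S"
      "\<And>f. is_function f t d \<Longrightarrow> \<not> push W t d f \<^bold>\<in> S \<Longrightarrow> \<not> less_mod W t f h" unfolding Z by blast
    have "s S = push W t d h" unfolding s_def
    proof (rule iota_eq)
      have "?M h S" by (intro conjI allI impI h)
      then show "\<exists>f. ?M f S \<and> push W t d h = push W t d f" by blast
      fix u assume "\<exists>f. ?M f S \<and> u = push W t d f"
      then obtain f where f: "?M f S" "u = push W t d f" by (elim exE conjE) simp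
      then have f': "is_function f t d" "\<not> push W t d f \<^bold>\<in> S" by simp_all
      have "\<not> less_mod W t h f" using f(1) h(1,2) by simp
      from less_mod_linear[OF kuf_uf[OF W] f'(1) h(1) d h(3)[OF f'] this]
      show "u = push W t d h" using push_eq[OF kuf_uf[OF W]] f(2) by simp
    qed
    then show ?thesis using h(1,2) by auto
  qed
  have "enum s (idx s (push W t d g)) = push W t d g"
  proof (rule enum_idx[where X = ?X, OF ds sel])
    show "?X (push W t d g)" using g by blast
    have dp: "dF (push W t d)" by (intro dfn)
    \<comment> \<open>All candidates are images under functions from \<open>t\<close> to
      \<open>d\<close>; these form a set, which bounds the selections.\<close>
    show "\<exists>B. \<forall>S. \<not> push W t d g \<^bold>\<in> S \<longrightarrow> s S \<^bold>\<in> B"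
    proof (intro exI[of _ "img ?F (push W t d)"] allI impI)
      fix S assume "\<not> push W t d g \<^bold>\<in> S"
      then have "?X (s S)" using sel g by blast
      then show "s S \<^bold>\<in> img ?F (push W t d)" unfolding mem_img[OF dp] F by blast
    qed
  qed
  moreover have "od W (enum s a)" if a: "ordinal a" for a
  proof (rule dterm_od)
    let ?A = "insert W {a. ordinal a}"
    have c: "dterm ?A (\<lambda>e. W)" "dterm ?A (\<lambda>e. t)" "dterm ?A (\<lambda>e. d)" "dterm ?A (\<lambda>e. a)"
      by (rule dterm_const; simp add: t d a)+
    show "dterm ?A (\<lambda>e. enum s a)" unfolding s_def by (intro dfn c)
  qed
  ultimately show ?thesis using ord_idx by metis
qed

text \<open>Let a cardinal index \<open>Vs r\<close>. By fineness almost every small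
  \<open>x\<close> contains the index of a given \<open>B\<close> in \<open>U\<close>; sending
  \<open>x\<close> to a point common to all members of \<open>U\<close> indexed in \<open>x\<close>
  therefore projects \<open>F\<close> to \<open>U\<close>.\<close>

lemma common_ultrafilter:
  assumes sc: "strongly_compact k" and k: "ordinal k" "omega \<^bold>\<in> k" and A: "\<And>a. a \<^bold>\<in> A \<Longrightarrow> a \<in> kOD k"
  shows "\<exists>W. kuf_on_ord k W \<and> (\<forall>a. a \<^bold>\<in> A \<longrightarrow> od W a)"
proof -
  have dR: "defn UNIV (\<lambda>e. kuf_on_ord k (e 1) \<and> od (e 1) (e 0))" by (intro dfn)
  have "\<And>x. x \<^bold>\<in> A \<Longrightarrow> \<exists>y. kuf_on_ord k y \<and> od y x" using A unfolding kOD_iff by blast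
  \<comment> \<open>Collection bounds the ranks of suitable ultrafilters for all elements of
    \<open>A\<close> at once.\<close>
  from collection[where R = "\<lambda>a U. kuf_on_ord k U \<and> od U a", OF dR this] obtain r where
    r: "ordinal r" "\<And>a. a \<^bold>\<in> A \<Longrightarrow> \<exists>U. U \<^bold>\<in> Vs r \<and> kuf_on_ord k U \<and> od U a" by blast
  obtain l i where l: "cardinal l" "k \<^bold>\<subseteq> l" "dF i" "\<And>x. x \<^bold>\<in> Vs r \<Longrightarrow> i x \<^bold>\<in> l"
    "\<And>x y. x \<^bold>\<in> Vs r \<Longrightarrow> y \<^bold>\<in> Vs r \<Longrightarrow> i x = i y \<Longrightarrow> x = y" using ex_cardinal[OF k(1), of "Vs r"] by blast
  obtain P F where PF: "is_Pk P k l" "complete_ultrafilter_over k P F" "fine P l F"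
    using sc l(1,2) unfolding strongly_compact_def by blast
  note F' = kuf_uf[OF PF(2)]
  obtain t h where t: "ordinal t" "dF h" "bij h t P" using well_order by blast
  obtain j where j: "dF j" "bij j P t" "\<And>y. y \<^bold>\<in> P \<Longrightarrow> h (j y) = y" using bij_inverse[OF t(2,3)] by blast
  \<comment> \<open>The fine ultrafilter lives on a set of sets; a well-ordering of \<open>P\<close>
    carries it to an ordinal, as \<open>kOD\<close> demands.\<close>
  define W where "W = sep (Pw t) (\<lambda>B. big F P (\<lambda>x. j x \<^bold>\<in> B))"
  have W: "complete_ultrafilter_over k t W" unfolding W_def
    by (rule kuf_push[OF PF(2) k(1) j(1)]) (use j(2) in \<open>auto simp: bij_def\<close>)
  have dW: "dP (\<lambda>B. big F P (\<lambda>x. j x \<^bold>\<in> B))" by (intro dfn dF_comp[OF j(1)])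
  have "od W U" if U: "U \<^bold>\<in> Vs r" "kuf_on_ord k U" for U
  proof -
    obtain d where d: "ordinal d" "complete_ultrafilter_over k d U" using U(2) unfolding kuf_on_ord_def by blast
    note U' = kuf_uf[OF d(2)]
    have UV: "B \<^bold>\<in> Vs r" if "B \<^bold>\<in> U" for B using Vs_trans[OF r(1)] U(1) that unfolding transitive_def subset_def by blast
    \<comment> \<open>The points common to all members of \<open>U\<close> indexed in
      \<open>x\<close>; such points exist because fewer than \<open>k\<close> members are
      involved.\<close>
    let ?C = "\<lambda>x z. z \<^bold>\<in> d \<and> (\<forall>B. B \<^bold>\<in> U \<longrightarrow> i B \<^bold>\<in> x \<longrightarrow> z \<^bold>\<in> B)"
    let ?f = "\<lambda>x. least (?C x)"
    have dC: "dP (?C x)" for x by (intro dfn dF_comp[OF l(3)])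
    have df: "dF ?f" by (intro dfn dF_comp[OF l(3)])
    have f: "?C x (?f x)" if x: "x \<^bold>\<in> P" for x
    proof -
      let ?I = "sep U (\<lambda>B. i B \<^bold>\<in> x)"
      have dI: "dP (\<lambda>B. i B \<^bold>\<in> x)" by (intro dfn dF_comp[OF l(3)])
      have sx: "smaller_than x k" using PF(1) x unfolding is_Pk_def by blast
      have dh: "dF (\<lambda>y. iota (\<lambda>B. B \<^bold>\<in> Vs r \<and> i B = y))" by (intro dfn dF_comp[OF l(3)])
      have hB: "\<exists>y. y \<^bold>\<in> x \<and> iota (\<lambda>B. B \<^bold>\<in> Vs r \<and> i B = y) = B" if B: "B \<^bold>\<in> ?I" for B
      proof -
        have B': "B \<^bold>\<in> U" "i B \<^bold>\<in> x" using B unfolding mem_sep[OF dI] by blast+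
        have "iota (\<lambda>B'. B' \<^bold>\<in> Vs r \<and> i B' = i B) = B" by (rule iota_eq) (use UV[OF B'(1)] l(5) in blast)+
        then show ?thesis using B'(2) by blast
      qed
      have "smaller_than ?I k" by (rule smaller_than_image[OF sx k(1) dh hB])
      then have "big U d (\<lambda>z. \<forall>B. B \<^bold>\<in> ?I \<longrightarrow> z \<^bold>\<in> B)"
      proof (rule big_complete[where R = "\<lambda>B z. z \<^bold>\<in> B", OF d(2) k(1)])
        show "defn UNIV (\<lambda>e. e 1 \<^bold>\<in> e 0)" by (intro dfn)
        fix B assume "B \<^bold>\<in> ?I"
        then have "B \<^bold>\<in> U" unfolding mem_sep[OF dI] by blast
        then show "big U d (\<lambda>z. z \<^bold>\<in> B)" using big_mem[OF U' uf_subset[OF U']] by blast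
      qed
      moreover have "dP (\<lambda>z. \<forall>B. B \<^bold>\<in> ?I \<longrightarrow> z \<^bold>\<in> B)" by (intro dfn dF_comp[OF l(3)])
      ultimately have "\<exists>z. z \<^bold>\<in> d \<and> (\<forall>B. B \<^bold>\<in> ?I \<longrightarrow> z \<^bold>\<in> B)" by (rule big_ex[OF U', rotated])
      then obtain z where "z \<^bold>\<in> d" "\<forall>B. B \<^bold>\<in> ?I \<longrightarrow> z \<^bold>\<in> B" by blast
      then have "?C x z" unfolding mem_sep[OF dI] by blast
      then show ?thesis using least(2)[where P = "?C x", OF dC] ord_mem[OF d(1)] by blast
    qed
    let ?g = "lam t (\<lambda>a. ?f (h a))"
    have dfh: "dF (\<lambda>a. ?f (h a))" by (rule dF_comp[OF df t(2)])
    have hP: "h a \<^bold>\<in> P" if "a \<^bold>\<in> t" for a using t(3) that unfolding bij_def by blast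
    have g: "is_function ?g t d" by (rule is_function_lam[OF dfh]) (use f hP in blast)
    \<comment> \<open>By maximality of ultrafilters one inclusion suffices, and fineness gives
      it.\<close>
    have "U = push W t d ?g"
    proof (rule uf_subset_eq[OF U'])
      have dg: "dF (ap ?g)" by (intro dfn dF_comp[OF dfh])
      show "ultrafilter_over d (push W t d ?g)" unfolding push_def
        by (rule kuf_uf[OF kuf_push[OF W k(1) dg]]) (rule is_function_ap(1)[OF g])
      have dpu: "dP (\<lambda>B. big W t (\<lambda>x. ap ?g x \<^bold>\<in> B))" by (intro dfn dF_comp[OF dg])
      fix B assume B: "B \<^bold>\<in> U"
      have dgB: "dP (\<lambda>a. ap ?g a \<^bold>\<in> B)" by (intro dfn dF_comp[OF dg])
      have "big F P (\<lambda>x. i B \<^bold>\<in> x)"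
      proof -
        have dd: "dP (\<lambda>x. i B \<^bold>\<in> x)" by (intro dfn)
        show ?thesis using PF(3) l(4)[OF UV[OF B]] mem_sep[OF dd] unfolding fine_def by blast
      qed
      then have "big F P (\<lambda>x. j x \<^bold>\<in> sep t (\<lambda>a. ap ?g a \<^bold>\<in> B))"
      proof (rule big_mono[OF F', rotated 2])
        show "dP (\<lambda>x. i B \<^bold>\<in> x)" by (intro dfn)
        show "dP (\<lambda>x. j x \<^bold>\<in> sep t (\<lambda>a. ap ?g a \<^bold>\<in> B))" by (intro dfn dF_comp[OF j(1)] dF_comp[OF dfh])
        fix x assume x: "x \<^bold>\<in> P" "i B \<^bold>\<in> x"
        have jx: "j x \<^bold>\<in> t" using j(2) x(1) unfolding bij_def by blast
        have "ap ?g (j x) = ?f x" using ap_lam[OF dfh jx] j(3)[OF x(1)] by simp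
        moreover have "?f x \<^bold>\<in> B" using f[OF x(1)] B x(2) by blast
        ultimately show "j x \<^bold>\<in> sep t (\<lambda>a. ap ?g a \<^bold>\<in> B)" unfolding mem_sep[OF dgB] using jx by simp
      qed
      then have "big W t (\<lambda>a. ap ?g a \<^bold>\<in> B)" unfolding W_def mem_sep[OF dW] using sep_subset[OF dgB] by simp
      then show "B \<^bold>\<in> push W t d ?g" unfolding push_def mem_sep[OF dpu] using uf_subset[OF U' B] by simp
    qed
    then show ?thesis using od_push[OF W k t(1) d(1) g] by simp
  qed
  then have "od W a" if "a \<^bold>\<in> A" for a using r(2)[OF that] od_trans by blast
  moreover have "kuf_on_ord k W" using W t(1) unfolding kuf_on_ord_def by blast
  ultimately show ?thesis by blast
qed

subsection \<open>The countable case\<close>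

text \<open>Induction on the number of elements, adding one ordinal at a time. It is carried out
  inside the model, whose \<open>omega\<close> may contain nonstandard numbers.\<close>

lemma od_finite:
  assumes "n \<^bold>\<in> omega" "equinumerous n s" "\<And>x. x \<^bold>\<in> s \<Longrightarrow> ordinal x" shows "od emp s"
proof -
  let ?P = "\<lambda>n. \<forall>s. equinumerous n s \<longrightarrow> (\<forall>x. x \<^bold>\<in> s \<longrightarrow> ordinal x) \<longrightarrow> od emp s"
  have "?P n"
  proof (rule omega_induct[where P = ?P, OF _ _ _ assms(1)])
    show "dP ?P" by (intro dfn)
    show "?P emp"
    proof (intro allI impI)
      fix s assume "equinumerous emp s"
      then have "s = emp" unfolding equinumerous_iff bij_def eq_emp using mem_emp by blast
      then show "od emp s" using od_basic(1)[OF ord_emp] by simp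
    qed
    fix n assume n: "n \<^bold>\<in> omega" "?P n"
    show "?P (ins n n)"
    proof (intro allI impI)
      fix s assume s: "equinumerous (ins n n) s" "\<forall>x. x \<^bold>\<in> s \<longrightarrow> ordinal x"
      then obtain f where f: "dF f" "bij f (ins n n) s" unfolding equinumerous_iff by blast
      let ?s = "img n f"
      have im: "z \<^bold>\<in> ?s \<longleftrightarrow> (\<exists>x. x \<^bold>\<in> n \<and> z = f x)" for z by (rule mem_img[OF f(1)])
      have "bij f n ?s" using f(2) unfolding bij_def im mem_ins by blast
      then have "equinumerous n ?s" unfolding equinumerous_iff using f(1) by blast
      moreover have "ordinal x" if "x \<^bold>\<in> ?s" for x using that f(2) s(2) unfolding im bij_def mem_ins by blast
      ultimately have "od emp ?s" using n(2) by blast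
      moreover have "od emp (f n)" using od_basic(1) f(2) s(2) unfolding bij_def mem_ins by blast
      ultimately have "od emp (ins (f n) ?s)" by (intro od_ops)
      moreover have "ins (f n) ?s = s"
      proof (rule ext)
        show "z \<^bold>\<in> ins (f n) ?s \<longleftrightarrow> z \<^bold>\<in> s" for z using f(2) unfolding mem_ins im bij_def by blast
      qed
      ultimately show "od emp s" by simp
    qed
  qed
  then show ?thesis using assms(2,3) by blast
qed

text \<open>The coded structure \<open>(s, R)\<close> determines the transitive set to which it collapses.\<close>

definition codes :: "'v \<Rightarrow> 'v \<Rightarrow> 'v \<Rightarrow> 'v \<Rightarrow> bool" where
  "codes s R t b \<longleftrightarrow> transitive t \<and> (\<forall>x. x \<^bold>\<in> t \<longrightarrow> ap b x \<^bold>\<in> s) \<and>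
     (\<forall>x y. x \<^bold>\<in> t \<longrightarrow> y \<^bold>\<in> t \<longrightarrow> ap b x = ap b y \<longrightarrow> x = y) \<and> (\<forall>y. y \<^bold>\<in> s \<longrightarrow> (\<exists>x. x \<^bold>\<in> t \<and> ap b x = y)) \<and>
     (\<forall>x y. x \<^bold>\<in> t \<longrightarrow> y \<^bold>\<in> t \<longrightarrow> (x \<^bold>\<in> y \<longleftrightarrow> cod (ap b x) (ap b y) \<^bold>\<in> R))"

lemma codes_dfn [dfn]:
  assumes "dterm A s" "dterm A R" "dterm A t" "dterm A b"
  shows "defn A (\<lambda>e. codes (s e) (R e) (t e) (b e))"
  unfolding codes_def by (intro dfn dterm_rename[OF assms(1)] dterm_rename[OF assms(2)] dterm_rename[OF assms(3)]
    dterm_rename[OF assms(4)])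

text \<open>Uniqueness of the Mostowski collapse, by membership induction: an element of
  \<open>t\<close> and the element of \<open>t'\<close> with the same code have the same
  elements.\<close>

lemma codes_unique:
  assumes "codes s R t b" "codes s R t' b'" "x \<^bold>\<in> t"
  shows "x \<^bold>\<in> t' \<and> ap b' x = ap b x"
proof -
  have c: "transitive t" "\<And>x. x \<^bold>\<in> t \<Longrightarrow> ap b x \<^bold>\<in> s" "\<And>y. y \<^bold>\<in> s \<Longrightarrow> \<exists>x. x \<^bold>\<in> t \<and> ap b x = y"
    "\<And>x y. x \<^bold>\<in> t \<Longrightarrow> y \<^bold>\<in> t \<Longrightarrow> x \<^bold>\<in> y \<longleftrightarrow> cod (ap b x) (ap b y) \<^bold>\<in> R"
    "\<And>x y. x \<^bold>\<in> t \<Longrightarrow> y \<^bold>\<in> t \<Longrightarrow> ap b x = ap b y \<Longrightarrow> x = y"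
    using assms(1) unfolding codes_def by blast+
  have c': "transitive t'" "\<And>x. x \<^bold>\<in> t' \<Longrightarrow> ap b' x \<^bold>\<in> s" "\<And>y. y \<^bold>\<in> s \<Longrightarrow> \<exists>x. x \<^bold>\<in> t' \<and> ap b' x = y"
    "\<And>x y. x \<^bold>\<in> t' \<Longrightarrow> y \<^bold>\<in> t' \<Longrightarrow> x \<^bold>\<in> y \<longleftrightarrow> cod (ap b' x) (ap b' y) \<^bold>\<in> R"
    "\<And>x y. x \<^bold>\<in> t' \<Longrightarrow> y \<^bold>\<in> t' \<Longrightarrow> ap b' x = ap b' y \<Longrightarrow> x = y"
    using assms(2) unfolding codes_def by blast+
  have "x \<^bold>\<in> t \<longrightarrow> x \<^bold>\<in> t' \<and> ap b' x = ap b x"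
  proof (rule eps_induct[where P = "\<lambda>x. x \<^bold>\<in> t \<longrightarrow> x \<^bold>\<in> t' \<and> ap b' x = ap b x"])
    show "dP (\<lambda>x. x \<^bold>\<in> t \<longrightarrow> x \<^bold>\<in> t' \<and> ap b' x = ap b x)" by (intro dfn)
    fix x assume IH: "\<And>y. y \<^bold>\<in> x \<Longrightarrow> y \<^bold>\<in> t \<longrightarrow> y \<^bold>\<in> t' \<and> ap b' y = ap b y"
    show "x \<^bold>\<in> t \<longrightarrow> x \<^bold>\<in> t' \<and> ap b' x = ap b x"
    proof
      assume x: "x \<^bold>\<in> t"
      obtain x' where x': "x' \<^bold>\<in> t'" "ap b' x' = ap b x" using c'(3)[OF c(2)[OF x]] by blast
      have "y \<^bold>\<in> x \<longleftrightarrow> y \<^bold>\<in> x'" for y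
      proof
        assume y: "y \<^bold>\<in> x"
        have yt: "y \<^bold>\<in> t" using c(1) x y unfolding transitive_def subset_def by blast
        then have y': "y \<^bold>\<in> t'" "ap b' y = ap b y" using IH[OF y] by blast+
        then show "y \<^bold>\<in> x'" using c(4)[OF yt x] c'(4)[OF y'(1) x'(1)] y x'(2) by simp
      next
        assume y: "y \<^bold>\<in> x'"
        have yt': "y \<^bold>\<in> t'" using c'(1) x'(1) y unfolding transitive_def subset_def by blast
        obtain z where z: "z \<^bold>\<in> t" "ap b z = ap b' y" using c(3)[OF c'(2)[OF yt']] by blast
        then have zx: "z \<^bold>\<in> x" using c(4)[OF z(1) x] c'(4)[OF yt' x'(1)] y x'(2) by simp
        then have "z \<^bold>\<in> t'" "ap b' z = ap b' y" using IH[OF zx] z by simp_all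
        then have "z = y" using c'(5) yt' by blast
        then show "y \<^bold>\<in> x" using zx by simp
      qed
      then have "x = x'" by (rule ext)
      then show "x \<^bold>\<in> t' \<and> ap b' x = ap b x" using x' by simp
    qed
  qed
  then show ?thesis using assms(3) by blast
qed

text \<open>It suffices to define a set \<open>A\<close> of ordinals that codes membership on some
  \<open>Vs r\<close>. The traces of \<open>A\<close> on members of \<open>P\<close> are replaced by
  their indices in \<open>od_enum emp\<close>, so that \<open>A\<close> is recovered from the
  resulting ultrafilter over an ordinal without being mentioned.\<close>

lemma kOD_everything:
  assumes sc: "strongly_compact k" and k: "ordinal k" "k \<^bold>\<subseteq> omega" shows "c \<in> kOD k"
proof -
  obtain r where r: "ordinal r" "c \<^bold>\<in> Vs r" using ex_Vs by blast
  let ?T = "Vs r"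
  obtain s h where h: "ordinal s" "dF h" "bij h s ?T" using well_order by blast
  obtain g where g: "dF g" "bij g ?T s" using bij_inverse[OF h(2,3)] by blast
  have og: "ordinal (g x)" if "x \<^bold>\<in> ?T" for x using g(2) that ord_mem[OF h(1)] unfolding bij_def by blast
  \<comment> \<open>An isomorphic copy, on the ordinal \<open>s\<close>, of membership on
    \<open>Vs r\<close>, coded as a set of ordinals.\<close>
  define A where "A = img (sep (prod ?T ?T) (\<lambda>p. fs p \<^bold>\<in> sn p)) (\<lambda>p. cod (g (fs p)) (g (sn p)))"
  have A: "z \<^bold>\<in> A \<longleftrightarrow> (\<exists>x y. x \<^bold>\<in> ?T \<and> y \<^bold>\<in> ?T \<and> x \<^bold>\<in> y \<and> z = cod (g x) (g y))" for z
  proof -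
    have 1: "dF (\<lambda>p. cod (g (fs p)) (g (sn p)))" by (intro dfn dF_comp[OF g(1)])
    have 2: "dP (\<lambda>p. fs p \<^bold>\<in> sn p)" by (intro dfn)
    show ?thesis unfolding A_def mem_img[OF 1] mem_sep[OF 2] mem_prod by fastforce
  qed
  have oA: "ordinal z" if "z \<^bold>\<in> A" for z using that unfolding A by auto
  have cd: "codes s A ?T (lam ?T g)"
  proof -
    have a: "ap (lam ?T g) x = g x" if "x \<^bold>\<in> ?T" for x by (rule ap_lam[OF g(1) that])
    have "x \<^bold>\<in> y \<longleftrightarrow> cod (g x) (g y) \<^bold>\<in> A" if xy: "x \<^bold>\<in> ?T" "y \<^bold>\<in> ?T" for x y
    proof
      show "cod (g x) (g y) \<^bold>\<in> A" if "x \<^bold>\<in> y" using that xy unfolding A by blast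
      assume "cod (g x) (g y) \<^bold>\<in> A"
      then obtain x' y' where xy': "x' \<^bold>\<in> ?T" "y' \<^bold>\<in> ?T" "x' \<^bold>\<in> y'" "cod (g x) (g y) = cod (g x') (g y')"
        unfolding A by blast
      then have "g x = g x'" "g y = g y'" using cod_inject[of "g x" "g y" "g x'" "g y'"] og xy by auto
      then show "x \<^bold>\<in> y" using xy xy' g(2) unfolding bij_def by metis
    qed
    then show ?thesis unfolding codes_def using a g(2) Vs_trans[OF r(1)] unfolding bij_def
      by (simp cong: conj_cong)
  qed
  obtain m where m: "ordinal m" "\<And>z. z \<^bold>\<in> A \<Longrightarrow> z \<^bold>\<in> m"
    using ord_bound[of "\<lambda>x. x" A] oA dterm_var by blast
  obtain l where l: "cardinal l" "un k m \<^bold>\<subseteq> l" using ex_cardinal[OF ord_un[OF k(1) m(1)]] by blast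
  have ol: "ordinal l" using l(1) by (simp add: cardinal_def)
  have Al: "z \<^bold>\<in> l" if "z \<^bold>\<in> A" for z using l(2) m(2)[OF that] by (simp add: subset_def)
  have "k \<^bold>\<subseteq> l" using l(2) by (simp add: subset_def)
  then obtain P F where PF: "is_Pk P k l" "complete_ultrafilter_over k P F" "fine P l F"
    using sc l(1) unfolding strongly_compact_def by blast
  note F' = kuf_uf[OF PF(2)]
  have dA: "dP (\<lambda>z. z \<^bold>\<in> A)" by (intro dfn)
  \<comment> \<open>The trace of \<open>A\<close> on \<open>x\<close> is finite and hence OD, so it
    has an index; the parameter \<open>emp\<close> gives plain ordinal definability.\<close>
  let ?Q = "\<lambda>x a. od_enum emp a = sep x (\<lambda>z. z \<^bold>\<in> A)"
  define j where "j x = least (?Q x)" for x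
  have dj: "dF j" unfolding j_def by (intro dfn)
  have j: "od_enum emp (j x) = sep x (\<lambda>z. z \<^bold>\<in> A)" if x: "x \<^bold>\<in> P" for x
  proof -
    have id: "dF (\<lambda>z. z)" by (rule dterm_var)
    have "smaller_than x k" using PF(1) x unfolding is_Pk_def by blast
    then have "smaller_than (sep x (\<lambda>z. z \<^bold>\<in> A)) k"
      by (rule smaller_than_image[OF _ k(1) id]) (simp add: mem_sep[OF dA])
    then obtain n where n: "n \<^bold>\<in> k" "equinumerous n (sep x (\<lambda>z. z \<^bold>\<in> A))" unfolding smaller_than_def by blast
    have "od emp (sep x (\<lambda>z. z \<^bold>\<in> A))"
      by (rule od_finite[OF subset_omega[OF k(2) n(1)] n(2)]) (use oA in \<open>simp add: mem_sep[OF dA]\<close>)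
    then obtain a where a: "ordinal a" "?Q x a" unfolding od_def by blast
    have "dP (?Q x)" by (intro dfn)
    from least(2)[where P = "?Q x", OF this a] show ?thesis unfolding j_def .
  qed
  have "ordinal (j x)" for x by (simp add: j_def)
  then obtain t where t: "ordinal t" "\<And>x. x \<^bold>\<in> P \<Longrightarrow> j x \<^bold>\<in> t" using ord_bound[OF dj] by blast
  define W where "W = sep (Pw t) (\<lambda>B. big F P (\<lambda>x. j x \<^bold>\<in> B))"
  have W: "complete_ultrafilter_over k t W"
    unfolding W_def by (rule kuf_push[OF PF(2) k(1) dj t(2)])
  have dW: "dP (\<lambda>B. big F P (\<lambda>x. j x \<^bold>\<in> B))" by (intro dfn dF_comp[OF dj])
  have AW: "z \<^bold>\<in> A \<longleftrightarrow> big W t (\<lambda>a. z \<^bold>\<in> od_enum emp a)" if z: "z \<^bold>\<in> l" for z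
  proof -
    have dz: "dP (\<lambda>a. z \<^bold>\<in> od_enum emp a)" by (intro dfn)
    have "sep P (\<lambda>x. j x \<^bold>\<in> sep t (\<lambda>a. z \<^bold>\<in> od_enum emp a)) = sep P (\<lambda>x. z \<^bold>\<in> x \<and> z \<^bold>\<in> A)"
      by (rule sep_cong) (use t(2) j mem_sep[OF dz] mem_sep[OF dA] in simp)
    then have 1: "big W t (\<lambda>a. z \<^bold>\<in> od_enum emp a) \<longleftrightarrow> big F P (\<lambda>x. z \<^bold>\<in> x \<and> z \<^bold>\<in> A)"
      unfolding W_def mem_sep[OF dW] using sep_subset[OF dz] by simp
    have dd: "dP (\<lambda>x. z \<^bold>\<in> x)" by (intro dfn)
    have "big F P (\<lambda>x. z \<^bold>\<in> x)" using PF(3) z mem_sep[OF dd] unfolding fine_def by blast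
    then have "big F P (\<lambda>x. z \<^bold>\<in> x \<and> z \<^bold>\<in> A)" if "z \<^bold>\<in> A" using that by simp
    moreover have "\<not> big F P (\<lambda>x. z \<^bold>\<in> x \<and> z \<^bold>\<in> A)" if "\<not> z \<^bold>\<in> A" using that big_const[OF F', of False] by simp
    ultimately show ?thesis using 1 by blast
  qed
  have "A = sep l (\<lambda>z. big W t (\<lambda>a. z \<^bold>\<in> od_enum emp a))"
  proof (rule ext)
    have dd: "dP (\<lambda>z. big W t (\<lambda>a. z \<^bold>\<in> od_enum emp a))" by (intro dfn)
    show "z \<^bold>\<in> A \<longleftrightarrow> z \<^bold>\<in> sep l (\<lambda>z. big W t (\<lambda>a. z \<^bold>\<in> od_enum emp a))" for z
      unfolding mem_sep[OF dd] using AW Al by blast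
  qed
  moreover have "od W (sep l (\<lambda>z. big W t (\<lambda>a. z \<^bold>\<in> od_enum emp a)))"
    by (rule dterm_od, intro dfn dterm_const) (simp_all add: ol t(1))
  ultimately have odA: "od W A" by simp
  \<comment> \<open>The set \<open>c\<close> is the point of the collapse with code
    \<open>u\<close>; by uniqueness of the collapse this defines it from \<open>s\<close>,
    \<open>A\<close> and \<open>u\<close>.\<close>
  define u where "u = g c"
  let ?S = "\<lambda>c. \<exists>t b. codes s A t b \<and> c \<^bold>\<in> t \<and> ap b c = u"
  have "iota ?S = c"
  proof (rule iota_eq)
    show "?S c" using cd r(2) ap_lam[OF g(1) r(2)] unfolding u_def by blast
    fix c' assume "?S c'"
    then obtain t b where tb: "codes s A t b" "c' \<^bold>\<in> t" "ap b c' = u" by blast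
    have "c' \<^bold>\<in> ?T" "ap (lam ?T g) c' = ap b c'" using codes_unique[OF tb(1) cd tb(2)] by blast+
    then have "g c' = g c" using tb(3) ap_lam[OF g(1)] unfolding u_def by metis
    then show "c' = c" using g(2) r(2) \<open>c' \<^bold>\<in> ?T\<close> unfolding bij_def by blast
  qed
  moreover have "od W (iota ?S)"
  proof (rule od_closed[of "{s, A, u}"])
    show "dterm {s, A, u} (\<lambda>e. iota ?S)" by (intro dfn dterm_const) simp_all
    have "ordinal u" unfolding u_def by (rule og[OF r(2)])
    then show "od W b" if "b \<in> {s, A, u}" for b using that odA h(1) od_basic(1) by blast
  qed
  ultimately have "od W c" by simp
  moreover have "kuf_on_ord k W" using W t(1) unfolding kuf_on_ord_def by blast
  ultimately show ?thesis unfolding kOD_iff by blast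
qed

lemma kHOD_choice:
  assumes sc: "strongly_compact k" shows "choice (kHOD k)"
proof -
  have k: "ordinal k" using sc by (simp add: strongly_compact_def cardinal_def)
  consider "k \<^bold>\<subseteq> omega" | "omega \<^bold>\<in> k" using ord_subset[OF k ord_omega] ord_linear[OF k ord_omega] by blast
  then show ?thesis
  proof cases
    case 1
    \<comment> \<open>Here \<kappa>-HOD is the whole universe, in which choice is assumed.\<close>
    have "x \<in> kHOD k" for x unfolding kHOD_iff using kOD_everything[OF sc k 1] by blast
    then have "kHOD k = UNIV" by blast
    with AC show ?thesis by simp
  next
    case 2
    show ?thesis unfolding choice_def
    proof (intro ballI impI)
      let ?M = "kHOD k"
      fix F assume F: "F \<in> ?M"
        and *: "(\<forall>x\<in>?M. x \<^bold>\<in> F \<longrightarrow> (\<exists>z\<in>?M. z \<^bold>\<in> x)) \<and>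
          (\<forall>x\<in>?M. \<forall>y\<in>?M. x \<^bold>\<in> F \<longrightarrow> y \<^bold>\<in> F \<longrightarrow> x \<noteq> y \<longrightarrow> \<not> (\<exists>z\<in>?M. z \<^bold>\<in> x \<and> z \<^bold>\<in> y))"
      have tr: "x \<in> ?M" "z \<in> ?M" if "x \<^bold>\<in> F" "z \<^bold>\<in> x" for x z
        using that kHOD_trans F by blast+
      have ne: "\<exists>z. z \<^bold>\<in> x" if "x \<^bold>\<in> F" for x using * that kHOD_trans[OF F] by blast
      have dj: "x = y" if "x \<^bold>\<in> F" "y \<^bold>\<in> F" "z \<^bold>\<in> x" "z \<^bold>\<in> y" for x y z
        using * that tr kHOD_trans[OF F] by metis
      have "a \<in> kOD k" if "a \<^bold>\<in> Uni F" for a using that tr kHOD_kOD by auto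
      then obtain T where T: "kuf_on_ord k T" "\<And>a. a \<^bold>\<in> Uni F \<Longrightarrow> od T a"
        using common_ultrafilter[OF sc k 2, of "Uni F"] by blast
      \<comment> \<open>The ultrafilter \<open>T\<close> need not be in \<kappa>-HOD; being in
        \<kappa>-OD qualifies it as a parameter in \<open>kHOD_closed\<close>.\<close>
      have TK: "T \<in> kOD k" unfolding kOD_iff using T(1) od_basic(3)[OF ord_emp] by blast
      define ix where "ix z = least (\<lambda>a. od_enum T a = z)" for z
      have ix: "ordinal (ix z)" "od_enum T (ix z) = z" if "z \<^bold>\<in> x" "x \<^bold>\<in> F" for x z
      proof -
        show "ordinal (ix z)" by (simp add: ix_def)
        have d: "dP (\<lambda>a. od_enum T a = z)" by (intro dfn)
        have "od T z" by (rule T(2)) (use that in auto)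
        then obtain a where "ordinal a" "od_enum T a = z" unfolding od_def by blast
        then show "od_enum T (ix z) = z" using least(2)[OF d] unfolding ix_def by blast
      qed
      \<comment> \<open>The elements of least index within their own member of \<open>F\<close>,
        which disjointness makes unique.\<close>
      let ?Q = "\<lambda>z. \<exists>x. x \<^bold>\<in> F \<and> z \<^bold>\<in> x \<and> (\<forall>w. w \<^bold>\<in> x \<longrightarrow> \<not> ix w \<^bold>\<in> ix z)"
      let ?c = "sep (Uni F) ?Q"
      have dQ: "dP ?Q" unfolding ix_def by (intro dfn)
      have c: "z \<^bold>\<in> ?c \<longleftrightarrow> ?Q z" for z unfolding mem_sep[OF dQ] by auto
      have cM: "?c \<in> ?M"
      proof (rule kHOD_closed[OF k])
        show "dterm (kOD k) (\<lambda>e. ?c)" unfolding ix_def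
          by (intro dfn kHOD_dterm[OF k F] dterm_const[OF TK])
        show "y \<in> ?M" if "y \<^bold>\<in> ?c" for y using that tr unfolding c by blast
      qed
      have "\<exists>!z. z \<in> ?M \<and> z \<^bold>\<in> x \<and> z \<^bold>\<in> ?c" if x: "x \<^bold>\<in> F" for x
      proof -
        let ?R = "\<lambda>a. \<exists>z. z \<^bold>\<in> x \<and> ix z = a"
        have dR: "dP ?R" unfolding ix_def by (intro dfn)
        obtain z0 where z0: "z0 \<^bold>\<in> x" using ne[OF x] by blast
        from ord_minimal[where P = ?R, OF dR ix(1)[OF z0 x]] z0
        obtain a where a: "?R a" "\<And>b. b \<^bold>\<in> a \<Longrightarrow> \<not> ?R b" by blast
        then obtain z where z: "z \<^bold>\<in> x" "ix z = a" by blast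
        have zc: "z \<^bold>\<in> ?c" unfolding c using x z a(2) by blast
        have uniq: "z' = z" if z': "z' \<^bold>\<in> x" "z' \<^bold>\<in> ?c" for z'
        proof -
          obtain y where y: "y \<^bold>\<in> F" "z' \<^bold>\<in> y" "\<And>w. w \<^bold>\<in> y \<Longrightarrow> \<not> ix w \<^bold>\<in> ix z'" using z'(2) unfolding c by blast
          have "y = x" using dj[OF y(1) x y(2) z'(1)] .
          then have "\<not> ix z \<^bold>\<in> ix z'" using y(3) z(1) by blast
          moreover have "\<not> ix z' \<^bold>\<in> ix z" using a(2) z'(1) z(2) by blast
          ultimately have eq: "ix z' = ix z" using ord_linear[OF ix(1)[OF z'(1) x] ix(1)[OF z(1) x]] by blast
          have "z' = od_enum T (ix z')" by (rule ix(2)[OF z'(1) x, symmetric])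
          also have "\<dots> = z" unfolding eq by (rule ix(2)[OF z(1) x])
          finally show ?thesis .
        qed
        show ?thesis
        proof (rule ex1I[of _ z])
          show "z \<in> ?M \<and> z \<^bold>\<in> x \<and> z \<^bold>\<in> ?c" by (intro conjI tr(2)[OF x z(1)] z(1) zc)
          show "z' = z" if "z' \<in> ?M \<and> z' \<^bold>\<in> x \<and> z' \<^bold>\<in> ?c" for z' using that by (elim conjE) (rule uniq)
        qed
      qed
      then show "\<exists>c\<in>?M. \<forall>x\<in>?M. x \<^bold>\<in> F \<longrightarrow> (\<exists>!z. z \<in> ?M \<and> z \<^bold>\<in> x \<and> z \<^bold>\<in> c)"
        by (intro bexI[OF _ cM] ballI impI)
    qed
  qed
qed

end

theorem theorem7p4:
  fixes E :: "'v \<Rightarrow> 'v \<Rightarrow> bool" and \<kappa> :: 'v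
  assumes "set_universe.ZFC E UNIV"
    and "set_universe.cardinal E \<kappa>"
  shows "set_universe.inner_model_of_ZF E (set_universe.kHOD E \<kappa>) \<and>
    (set_universe.strongly_compact E \<kappa> \<longrightarrow> set_universe.choice E (set_universe.kHOD E \<kappa>))"
proof -
  interpret zfc_model E
    by unfold_locales (use assms(1) in \<open>simp_all add: set_universe.ZFC_def\<close>)
  have "ordinal \<kappa>" using assms(2) by (simp add: cardinal_def)
  then show ?thesis using kHOD_inner_model kHOD_choice by blast
qed

end
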